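(* Let $\mathsf{C}$ be a locally finitely presentable category that satisfies the amalgamation property and admits an extremal projective generator $G$, and let $V := \mathsf{C}(G,-)\colon\mathsf{C}\to\mathsf{Set}$. The following are equivalent: (1) $\mathsf{C}$ satisfies ES (equivalently, WES; equivalently, SES); (2) for every finite $n$, every continuous implicit partial operation $V^{n} \rightsquigarrow V$ can be extended to a total one.
   Context: All categories are assumed to be locally small. An object $X$ of a category $\mathsf{C}$ is finitely presentable (respectively, finitely generated) if the functor $\mathsf{C}(X,-)\colon\mathsf{C}\to\mathsf{Set}$ preserves directed colimits (respectively, directed colimits of monomorphisms, i.e. colimits of directed diagrams all of whose connecting morphisms are monomorphisms). A category is locally finitely presentable if it is cocomplete and admits a (small) set $\mathsf{G}$ of finitely presentable objects such that every object is a directed colimit of objects from $\mathsf{G}$. A category has the amalgamation property if for any pair of monomorphisms $\alpha,\beta$ with common domain there are monomorphisms $\gamma,\delta$ with $\delta\circ\alpha=\gamma\circ\beta$. An epimorphism $e$ is extremal if, for any decomposition $e = m\circ f$ with $m$ a monomorphism, $m$ is an isomorphism. A category satisfies ES if every epimorphism is an extremal epimorphism; it satisfies WES if every epimorphism between finitely generated objects is an extremal epimorphism; it satisfies SES if every monomorphism is a regular monomorphism (an equaliser of some parallel pair). An object $G$ of $\mathsf{C}$ is an extremal generator if for every set $I$ the $I$-fold copower $\coprod_I G$ exists in $\mathsf{C}$ and, for every object $X$ of $\mathsf{C}$, the canonical arrow $\coprod_{\mathsf{C}(G,X)} G\to X$ is an extremal epimorphism. An object $A$ is extremal projective if the functor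 $\mathsf{C}(A,-)\colon\mathsf{C}\to\mathsf{Set}$ preserves extremal epimorphisms. An extremal projective generator is an object that is both extremal projective and an extremal generator. For a functor $V\colon\mathsf{C}\to\mathsf{Set}$ and a set $I$, $V^I$ denotes the functor $A\mapsto V(A)^I$; when $I$ is a finite set of cardinality $n$ one writes $V^n$. An implicit partial operation of arity $I$, written $f\colon V^{I}\rightsquigarrow V$, consists of a subfunctor $d\colon D\rightarrowtail V^{I}$ (the domain of $f$) together with a natural transformation $f\colon D\to V$. It is total if $d$ is the identity. It can be extended to a total one if there is a natural transformation $g\colon V^I\to V$ with $g\circ d=f$. It is continuous if the functor $D$ preserves (small) limits. *)

theory Defs
  imports "HOL-Library.FuncSet"
begin

unbundle cardinal_syntax

section \<open>Size\<close>

text \<open>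
  The type \<open>'u\<close> plays the role of the universe of all sets: its elements are the (codes of) sets,
  its subsets are the classes, and a set of any type is small if it has fewer elements
  than \<open>'u\<close>. The predicate \<open>universe\<close> lists the closure properties (infinity, power set,
  replacement and union) that make small sets behave like the sets of set theory; it says
  that the cardinality of \<open>'u\<close> is (strongly) inaccessible, as for a Grothendieck universe.
\<close>

definition small :: "'u itself \<Rightarrow> 'x set \<Rightarrow> bool" where
  "small U X \<longleftrightarrow> |X| <o |UNIV :: 'u set|"

definition universe :: "'u itself \<Rightarrow> bool" where
  "universe U \<longleftrightarrow>
     small U (UNIV :: nat set) \<and>
     (\<forall>X :: 'u set. small U X \<longrightarrow> small U (Pow X)) \<and>
     (\<forall>(X :: 'u set) (F :: 'u \<Rightarrow> 'u set).
        small U X \<longrightarrow> (\<forall>x\<in>X. small U (F x)) \<longrightarrow> small U (\<Union>x\<in>X. F x))"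

section \<open>Categories and functors\<close>

text \<open>Composition is written in applicative order: \<open>Comp C g f\<close> is \<open>g\<close> after \<open>f\<close>.\<close>

record ('o, 'a) cat =
  Ob :: "'o set"
  Ar :: "'a set"
  Dom :: "'a \<Rightarrow> 'o"
  Cod :: "'a \<Rightarrow> 'o"
  Id :: "'o \<Rightarrow> 'a"
  Comp :: "'a \<Rightarrow> 'a \<Rightarrow> 'a"

definition hom :: "('o, 'a) cat \<Rightarrow> 'o \<Rightarrow> 'o \<Rightarrow> 'a set" where
  "hom C A B = {f \<in> Ar C. Dom C f = A \<and> Cod C f = B}"

definition category :: "('o, 'a) cat \<Rightarrow> bool" where
  "category C \<longleftrightarrow>
     (\<forall>f\<in>Ar C. Dom C f \<in> Ob C \<and> Cod C f \<in> Ob C) \<and>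
     (\<forall>A\<in>Ob C. Id C A \<in> hom C A A) \<and>
     (\<forall>f\<in>Ar C. \<forall>g\<in>Ar C. Cod C f = Dom C g \<longrightarrow> Comp C g f \<in> hom C (Dom C f) (Cod C g)) \<and>
     (\<forall>f\<in>Ar C. Comp C f (Id C (Dom C f)) = f \<and> Comp C (Id C (Cod C f)) f = f) \<and>
     (\<forall>f\<in>Ar C. \<forall>g\<in>Ar C. \<forall>h\<in>Ar C. Cod C f = Dom C g \<longrightarrow> Cod C g = Dom C h \<longrightarrow>
        Comp C h (Comp C g f) = Comp C (Comp C h g) f)"

definition locally_small :: "('o, 'u) cat \<Rightarrow> bool" where
  "locally_small C \<longleftrightarrow> (\<forall>A\<in>Ob C. \<forall>B\<in>Ob C. small TYPE('u) (hom C A B))"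

definition small_category :: "('u, 'u) cat \<Rightarrow> bool" where
  "small_category J \<longleftrightarrow> category J \<and> small TYPE('u) (Ob J) \<and> small TYPE('u) (Ar J)"

record ('o, 'a, 'p, 'b) func =
  fob :: "'o \<Rightarrow> 'p"
  far :: "'a \<Rightarrow> 'b"

definition is_functor ::
    "('o, 'a) cat \<Rightarrow> ('p, 'b) cat \<Rightarrow> ('o, 'a, 'p, 'b) func \<Rightarrow> bool" where
  "is_functor C D F \<longleftrightarrow>
     category C \<and> category D \<and>
     (\<forall>A\<in>Ob C. fob F A \<in> Ob D) \<and>
     (\<forall>f\<in>Ar C. far F f \<in> hom D (fob F (Dom C f)) (fob F (Cod C f))) \<and>
     (\<forall>A\<in>Ob C. far F (Id C A) = Id D (fob F A)) \<and>
     (\<forall>f\<in>Ar C. \<forall>g\<in>Ar C. Cod C f = Dom C g \<longrightarrow>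
        far F (Comp C g f) = Comp D (far F g) (far F f))"

definition comp_func ::
    "('p, 'b, 'q, 'c) func \<Rightarrow> ('o, 'a, 'p, 'b) func \<Rightarrow> ('o, 'a, 'q, 'c) func" where
  "comp_func G F = \<lparr>fob = fob G \<circ> fob F, far = far G \<circ> far F\<rparr>"

section \<open>The category of sets\<close>

text \<open>
  An arrow between sets is a function together with its source and its target; functions are
  extensional, so that equality of arrows is equality of functions.
\<close>

datatype 'x setarr = SetArr (src: "'x set") (fn: "'x \<Rightarrow> 'x") (trg: "'x set")

text \<open>
  For every type \<open>'x\<close> with at least as many elements as \<open>'u\<close>, \<open>set_cat TYPE('u)\<close> over
  \<open>'x\<close> is (up to equivalence) the category of all small sets. It is used below with
  \<open>'x = 'u\<close> and with \<open>'x = 'i \<Rightarrow> 'u\<close>.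
\<close>

definition set_cat :: "'u itself \<Rightarrow> ('x set, 'x setarr) cat" where
  "set_cat U =
     \<lparr>Ob = {X. small U X},
      Ar = {a. small U (src a) \<and> small U (trg a) \<and> fn a \<in> src a \<rightarrow>\<^sub>E trg a},
      Dom = src,
      Cod = trg,
      Id = (\<lambda>X. SetArr X (\<lambda>x\<in>X. x) X),
      Comp = (\<lambda>g f. SetArr (src f) (compose (src f) (fn g) (fn f)) (trg g))\<rparr>"

definition hom_functor :: "('o, 'a) cat \<Rightarrow> 'o \<Rightarrow> ('o, 'a, 'a set, 'a setarr) func" where
  "hom_functor C X =
     \<lparr>fob = hom C X,
      far = (\<lambda>h. SetArr (hom C X (Dom C h)) (\<lambda>f\<in>hom C X (Dom C h). Comp C h f)
                   (hom C X (Cod C h)))\<rparr>"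

section \<open>Limits and colimits\<close>

definition is_cocone :: "('j, 'k) cat \<Rightarrow> ('o, 'a) cat \<Rightarrow> ('j, 'k, 'o, 'a) func \<Rightarrow>
    'o \<Rightarrow> ('j \<Rightarrow> 'a) \<Rightarrow> bool" where
  "is_cocone J C F X \<iota> \<longleftrightarrow>
     X \<in> Ob C \<and> (\<forall>j\<in>Ob J. \<iota> j \<in> hom C (fob F j) X) \<and>
     (\<forall>u\<in>Ar J. Comp C (\<iota> (Cod J u)) (far F u) = \<iota> (Dom J u))"

definition is_colimit :: "('j, 'k) cat \<Rightarrow> ('o, 'a) cat \<Rightarrow> ('j, 'k, 'o, 'a) func \<Rightarrow>
    'o \<Rightarrow> ('j \<Rightarrow> 'a) \<Rightarrow> bool" where
  "is_colimit J C F X \<iota> \<longleftrightarrow>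
     is_cocone J C F X \<iota> \<and>
     (\<forall>Y \<kappa>. is_cocone J C F Y \<kappa> \<longrightarrow>
        (\<exists>!h. h \<in> hom C X Y \<and> (\<forall>j\<in>Ob J. Comp C h (\<iota> j) = \<kappa> j)))"

definition is_cone :: "('j, 'k) cat \<Rightarrow> ('o, 'a) cat \<Rightarrow> ('j, 'k, 'o, 'a) func \<Rightarrow>
    'o \<Rightarrow> ('j \<Rightarrow> 'a) \<Rightarrow> bool" where
  "is_cone J C F X \<pi> \<longleftrightarrow>
     X \<in> Ob C \<and> (\<forall>j\<in>Ob J. \<pi> j \<in> hom C X (fob F j)) \<and>
     (\<forall>u\<in>Ar J. Comp C (far F u) (\<pi> (Dom J u)) = \<pi> (Cod J u))"

definition is_limit :: "('j, 'k) cat \<Rightarrow> ('o, 'a) cat \<Rightarrow> ('j, 'k, 'o, 'a) func \<Rightarrow>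
    'o \<Rightarrow> ('j \<Rightarrow> 'a) \<Rightarrow> bool" where
  "is_limit J C F X \<pi> \<longleftrightarrow>
     is_cone J C F X \<pi> \<and>
     (\<forall>Y \<kappa>. is_cone J C F Y \<kappa> \<longrightarrow>
        (\<exists>!h. h \<in> hom C Y X \<and> (\<forall>j\<in>Ob J. Comp C (\<pi> j) h = \<kappa> j)))"

definition preserves_colimits_of :: "('j, 'k) cat \<Rightarrow> ('j, 'k, 'o, 'a) func \<Rightarrow>
    ('o, 'a) cat \<Rightarrow> ('p, 'b) cat \<Rightarrow> ('o, 'a, 'p, 'b) func \<Rightarrow> bool" where
  "preserves_colimits_of J F C D H \<longleftrightarrow>
     (\<forall>X \<iota>. is_colimit J C F X \<iota> \<longrightarrow>
        is_colimit J D (comp_func H F) (fob H X) (\<lambda>j. far H (\<iota> j)))"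

definition preserves_small_limits ::
    "('o, 'u) cat \<Rightarrow> ('p, 'b) cat \<Rightarrow> ('o, 'u, 'p, 'b) func \<Rightarrow> bool" where
  "preserves_small_limits C D H \<longleftrightarrow>
     (\<forall>(J :: ('u, 'u) cat) F X \<pi>.
        small_category J \<longrightarrow> is_functor J C F \<longrightarrow> is_limit J C F X \<pi> \<longrightarrow>
        is_limit J D (comp_func H F) (fob H X) (\<lambda>j. far H (\<pi> j)))"

definition cocomplete :: "('o, 'u) cat \<Rightarrow> bool" where
  "cocomplete C \<longleftrightarrow>
     (\<forall>(J :: ('u, 'u) cat) F. small_category J \<longrightarrow> is_functor J C F \<longrightarrow>
        (\<exists>X \<iota>. is_colimit J C F X \<iota>))"

text \<open>A poset as a category: the pair \<open>(x, y) \<in> r\<close> is the unique arrow from \<open>x\<close> to \<open>y\<close>.\<close>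

definition poset_cat :: "'i set \<Rightarrow> 'i rel \<Rightarrow> ('i, 'i \<times> 'i) cat" where
  "poset_cat I r =
     \<lparr>Ob = I, Ar = r, Dom = fst, Cod = snd, Id = (\<lambda>x. (x, x)),
      Comp = (\<lambda>g f. (fst f, snd g))\<rparr>"

definition directed_poset :: "'i set \<Rightarrow> 'i rel \<Rightarrow> bool" where
  "directed_poset I r \<longleftrightarrow>
     partial_order_on I r \<and> I \<noteq> {} \<and>
     (\<forall>x\<in>I. \<forall>y\<in>I. \<exists>z\<in>I. (x, z) \<in> r \<and> (y, z) \<in> r)"

definition directed_diagram ::
    "('o, 'u) cat \<Rightarrow> 'u set \<Rightarrow> 'u rel \<Rightarrow> ('u, 'u \<times> 'u, 'o, 'u) func \<Rightarrow> bool" where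
  "directed_diagram C I r F \<longleftrightarrow>
     small TYPE('u) I \<and> directed_poset I r \<and> is_functor (poset_cat I r) C F"

definition discrete_cat :: "'i set \<Rightarrow> ('i, 'i) cat" where
  "discrete_cat I =
     \<lparr>Ob = I, Ar = I, Dom = (\<lambda>i. i), Cod = (\<lambda>i. i), Id = (\<lambda>i. i), Comp = (\<lambda>g f. f)\<rparr>"

definition is_copower ::
    "('o, 'a) cat \<Rightarrow> 'i set \<Rightarrow> 'o \<Rightarrow> 'o \<Rightarrow> ('i \<Rightarrow> 'a) \<Rightarrow> bool" where
  "is_copower C I G P \<iota> \<longleftrightarrow>
     is_colimit (discrete_cat I) C \<lparr>fob = (\<lambda>_. G), far = (\<lambda>_. Id C G)\<rparr> P \<iota>"

section \<open>Classes of arrows\<close>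

definition monic :: "('o, 'a) cat \<Rightarrow> 'a \<Rightarrow> bool" where
  "monic C m \<longleftrightarrow> m \<in> Ar C \<and>
     (\<forall>f\<in>Ar C. \<forall>g\<in>Ar C. Dom C f = Dom C g \<longrightarrow> Cod C f = Dom C m \<longrightarrow> Cod C g = Dom C m \<longrightarrow>
        Comp C m f = Comp C m g \<longrightarrow> f = g)"

definition epic :: "('o, 'a) cat \<Rightarrow> 'a \<Rightarrow> bool" where
  "epic C e \<longleftrightarrow> e \<in> Ar C \<and>
     (\<forall>f\<in>Ar C. \<forall>g\<in>Ar C. Cod C f = Cod C g \<longrightarrow> Dom C f = Cod C e \<longrightarrow> Dom C g = Cod C e \<longrightarrow>
        Comp C f e = Comp C g e \<longrightarrow> f = g)"

definition isomorphism :: "('o, 'a) cat \<Rightarrow> 'a \<Rightarrow> bool" where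
  "isomorphism C f \<longleftrightarrow> f \<in> Ar C \<and>
     (\<exists>g\<in>hom C (Cod C f) (Dom C f).
        Comp C g f = Id C (Dom C f) \<and> Comp C f g = Id C (Cod C f))"

definition extremal_epi :: "('o, 'a) cat \<Rightarrow> 'a \<Rightarrow> bool" where
  "extremal_epi C e \<longleftrightarrow> epic C e \<and>
     (\<forall>m f. monic C m \<longrightarrow> f \<in> Ar C \<longrightarrow> Cod C f = Dom C m \<longrightarrow> e = Comp C m f \<longrightarrow> isomorphism C m)"

definition is_equaliser :: "('o, 'a) cat \<Rightarrow> 'a \<Rightarrow> 'a \<Rightarrow> 'a \<Rightarrow> bool" where
  "is_equaliser C m f g \<longleftrightarrow>
     m \<in> Ar C \<and> f \<in> Ar C \<and> g \<in> Ar C \<and>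
     Dom C f = Cod C m \<and> Dom C g = Cod C m \<and> Cod C f = Cod C g \<and>
     Comp C f m = Comp C g m \<and>
     (\<forall>h\<in>Ar C. Cod C h = Cod C m \<longrightarrow> Comp C f h = Comp C g h \<longrightarrow>
        (\<exists>!k. k \<in> hom C (Dom C h) (Dom C m) \<and> Comp C m k = h))"

definition regular_mono :: "('o, 'a) cat \<Rightarrow> 'a \<Rightarrow> bool" where
  "regular_mono C m \<longleftrightarrow> (\<exists>f g. is_equaliser C m f g)"

section \<open>Properties of objects and categories\<close>

definition finitely_presentable :: "('o, 'u) cat \<Rightarrow> 'o \<Rightarrow> bool" where
  "finitely_presentable C X \<longleftrightarrow> X \<in> Ob C \<and>
     (\<forall>I r F. directed_diagram C I r F \<longrightarrow>
        preserves_colimits_of (poset_cat I r) F C (set_cat TYPE('u)) (hom_functor C X))"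

definition finitely_generated :: "('o, 'u) cat \<Rightarrow> 'o \<Rightarrow> bool" where
  "finitely_generated C X \<longleftrightarrow> X \<in> Ob C \<and>
     (\<forall>I r F. directed_diagram C I r F \<longrightarrow> (\<forall>u\<in>r. monic C (far F u)) \<longrightarrow>
        preserves_colimits_of (poset_cat I r) F C (set_cat TYPE('u)) (hom_functor C X))"

definition locally_finitely_presentable :: "('o, 'u) cat \<Rightarrow> bool" where
  "locally_finitely_presentable C \<longleftrightarrow>
     category C \<and> cocomplete C \<and>
     (\<exists>\<G>. small TYPE('u) \<G> \<and> (\<forall>X\<in>\<G>. finitely_presentable C X) \<and>
        (\<forall>X\<in>Ob C. \<exists>I r F \<iota>. directed_diagram C I r F \<and> (\<forall>i\<in>I. fob F i \<in> \<G>) \<and>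
           is_colimit (poset_cat I r) C F X \<iota>))"

definition amalgamation_property :: "('o, 'a) cat \<Rightarrow> bool" where
  "amalgamation_property C \<longleftrightarrow>
     (\<forall>\<alpha> \<beta>. monic C \<alpha> \<longrightarrow> monic C \<beta> \<longrightarrow> Dom C \<alpha> = Dom C \<beta> \<longrightarrow>
        (\<exists>\<gamma> \<delta>. monic C \<gamma> \<and> monic C \<delta> \<and>
           Dom C \<delta> = Cod C \<alpha> \<and> Dom C \<gamma> = Cod C \<beta> \<and> Cod C \<delta> = Cod C \<gamma> \<and>
           Comp C \<delta> \<alpha> = Comp C \<gamma> \<beta>))"

definition ES :: "('o, 'a) cat \<Rightarrow> bool" where
  "ES C \<longleftrightarrow> (\<forall>e. epic C e \<longrightarrow> extremal_epi C e)"

definition WES :: "('o, 'u) cat \<Rightarrow> bool" where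
  "WES C \<longleftrightarrow>
     (\<forall>e. epic C e \<longrightarrow> finitely_generated C (Dom C e) \<longrightarrow> finitely_generated C (Cod C e) \<longrightarrow>
        extremal_epi C e)"

definition SES :: "('o, 'a) cat \<Rightarrow> bool" where
  "SES C \<longleftrightarrow> (\<forall>m. monic C m \<longrightarrow> regular_mono C m)"

text \<open>
  The canonical arrow from the copower of \<open>G\<close> over the set of arrows from \<open>G\<close> to \<open>X\<close> is the
  arrow \<open>e\<close> that composes with the injection at \<open>f\<close> to \<open>f\<close>.
\<close>

definition extremal_generator :: "('o, 'u) cat \<Rightarrow> 'o \<Rightarrow> bool" where
  "extremal_generator C G \<longleftrightarrow> G \<in> Ob C \<and>
     (\<forall>I :: 'u set. small TYPE('u) I \<longrightarrow> (\<exists>P \<iota>. is_copower C I G P \<iota>)) \<and>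
     (\<forall>X\<in>Ob C. \<forall>P \<iota> e. is_copower C (hom C G X) G P \<iota> \<longrightarrow> e \<in> hom C P X \<longrightarrow>
        (\<forall>f\<in>hom C G X. Comp C e (\<iota> f) = f) \<longrightarrow> extremal_epi C e)"

definition extremal_projective :: "('o, 'u) cat \<Rightarrow> 'o \<Rightarrow> bool" where
  "extremal_projective C A \<longleftrightarrow> A \<in> Ob C \<and>
     (\<forall>e. extremal_epi C e \<longrightarrow>
        extremal_epi (set_cat TYPE('u)) (far (hom_functor C A) e))"

definition extremal_projective_generator :: "('o, 'u) cat \<Rightarrow> 'o \<Rightarrow> bool" where
  "extremal_projective_generator C G \<longleftrightarrow> extremal_projective C G \<and> extremal_generator C G"

section \<open>Implicit partial operations\<close>

definition power_functor :: "'i set \<Rightarrow> ('o, 'a, 'x set, 'x setarr) func \<Rightarrow>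
    ('o, 'a, ('i \<Rightarrow> 'x) set, ('i \<Rightarrow> 'x) setarr) func" where
  "power_functor I V =
     \<lparr>fob = (\<lambda>A. I \<rightarrow>\<^sub>E fob V A),
      far = (\<lambda>h. SetArr (I \<rightarrow>\<^sub>E src (far V h))
                   (\<lambda>t\<in>I \<rightarrow>\<^sub>E src (far V h). \<lambda>i\<in>I. fn (far V h) (t i))
                   (I \<rightarrow>\<^sub>E trg (far V h)))\<rparr>"

definition subfunctor :: "('o, 'u) cat \<Rightarrow> ('o, 'u, 'x set, 'x setarr) func \<Rightarrow>
    ('o, 'u, 'x set, 'x setarr) func \<Rightarrow> bool" where
  "subfunctor C D F \<longleftrightarrow>
     is_functor C (set_cat TYPE('u)) D \<and>
     (\<forall>A\<in>Ob C. fob D A \<subseteq> fob F A) \<and>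
     (\<forall>h\<in>Ar C. \<forall>x\<in>fob D (Dom C h). fn (far D h) x = fn (far F h) x)"

text \<open>
  Natural transformations between set-valued functors whose values may consist of elements of
  different types; only the values of the component \<open>\<eta> A\<close> on \<open>fob F A\<close> matter.
\<close>

definition set_natural :: "('o, 'a) cat \<Rightarrow> ('o, 'a, 'x set, 'x setarr) func \<Rightarrow>
    ('o, 'a, 'y set, 'y setarr) func \<Rightarrow> ('o \<Rightarrow> 'x \<Rightarrow> 'y) \<Rightarrow> bool" where
  "set_natural C F G \<eta> \<longleftrightarrow>
     (\<forall>A\<in>Ob C. \<eta> A \<in> fob F A \<rightarrow> fob G A) \<and>
     (\<forall>h\<in>Ar C. \<forall>x\<in>fob F (Dom C h).
        \<eta> (Cod C h) (fn (far F h) x) = fn (far G h) (\<eta> (Dom C h) x))"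

definition implicit_partial_operation :: "('o, 'u) cat \<Rightarrow> ('o, 'u, 'u set, 'u setarr) func \<Rightarrow>
    'i set \<Rightarrow> ('o, 'u, ('i \<Rightarrow> 'u) set, ('i \<Rightarrow> 'u) setarr) func \<Rightarrow>
    ('o \<Rightarrow> ('i \<Rightarrow> 'u) \<Rightarrow> 'u) \<Rightarrow> bool" where
  "implicit_partial_operation C V I D f \<longleftrightarrow>
     subfunctor C D (power_functor I V) \<and> set_natural C D V f"

definition continuous_domain ::
    "('o, 'u) cat \<Rightarrow> ('o, 'u, 'x set, 'x setarr) func \<Rightarrow> bool" where
  "continuous_domain C D \<longleftrightarrow> preserves_small_limits C (set_cat TYPE('u)) D"

definition extends_to_total :: "('o, 'u) cat \<Rightarrow> ('o, 'u, 'u set, 'u setarr) func \<Rightarrow>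
    'i set \<Rightarrow> ('o, 'u, ('i \<Rightarrow> 'u) set, ('i \<Rightarrow> 'u) setarr) func \<Rightarrow>
    ('o \<Rightarrow> ('i \<Rightarrow> 'u) \<Rightarrow> 'u) \<Rightarrow> bool" where
  "extends_to_total C V I D f \<longleftrightarrow>
     (\<exists>g. set_natural C (power_functor I V) V g \<and>
        (\<forall>A\<in>Ob C. \<forall>x\<in>fob D A. g A x = f A x))"

end

theory Submission
  imports Defs
begin

text \<open>
  Call the arrows \<open>G \<rightarrow> X\<close> the elements of \<open>X\<close>; they form the set \<open>V X\<close>. The whole proof rests on
  the remark that an extremal projective generator makes elements behave as in a category of
  algebras: an arrow is monic iff it is injective on elements and extremal epic iff it is
  surjective on them (\<open>extremal_lift\<close>, \<open>monic_elementwise\<close>, \<open>extremal_elementwise\<close>). The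
  quotient of \<open>X\<close> by the pairs of elements that \<open>f : X \<rightarrow> Y\<close> identifies embeds into \<open>Y\<close>, because
  elements of a quotient lift; so every arrow has an image, every extremal epimorphism is the
  quotient by its kernel, and extremal epimorphisms are orthogonal to monomorphisms
  (\<open>image_factorisation\<close>, \<open>extremal_descent\<close>, \<open>fill_in\<close>).

  Amalgamation enters through one fact, \<open>epic_into_dominion\<close>. The dominion of \<open>A \<rightarrow> B\<close> consists
  of those elements of \<open>B\<close> on which any two arrows out of \<open>B\<close> agree once they agree on \<open>A\<close>. With
  amalgamation, \<open>A\<close> is epic in every subobject \<open>E\<close> of \<open>B\<close> through which it factors and that lies
  inside its dominion, since the two coprojections of the cokernel pair of \<open>A \<rightarrow> E\<close> can both be
  extended to \<open>B\<close>. Hence, under ES, the dominion of a subobject is the subobject itself, so that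
  a monomorphism is the equaliser of its cokernel pair: this is SES. The converse is formal.

  For WES implies ES, let \<open>m : A \<rightarrow> B\<close> be monic and epic, let \<open>b\<close> be an arrow to \<open>B\<close> with
  finitely presentable domain \<open>K\<close>, and write \<open>A\<close> as a directed colimit of finitely presentable
  \<open>A\<^sub>i\<close>. The images \<open>M\<^sub>i\<close> of \<open>A\<^sub>i + K\<close> in \<open>B\<close> are finitely generated. By \<open>epic_into_dominion\<close>,
  \<open>A\<close> is epic in their union, so the two coprojections of the cokernel pairs of \<open>A\<^sub>i \<rightarrow> M\<^sub>i\<close>
  agree on \<open>K\<close> in the colimit, and therefore already at some stage \<open>i\<close>. There \<open>A\<^sub>i \<rightarrow> M\<^sub>i\<close> is an
  epimorphism between finitely generated objects, hence extremal, and a fill-in shows that \<open>b\<close>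
  factors through \<open>m\<close>.

  Operations correspond to elements. A tuple of \<open>n\<close> elements of \<open>A\<close> is an arrow \<open>n G \<rightarrow> A\<close> from a
  finite copower, and the total operations are given by composition with the elements of \<open>n G\<close>.
  If SES holds and \<open>D\<close> is the domain of a continuous operation \<open>f\<close>, then membership in \<open>D\<close>
  descends from \<open>A\<close> to the image of the tuple, the inclusion of the image being an equaliser.
  Applied to one product that contains a representative of every member of \<open>D\<close> up to kernel,
  this gives a tuple in \<open>D\<close>, jointly covering its object \<open>M\<close>, from which all members of \<open>D\<close> are
  obtained along arrows out of \<open>M\<close>; a lift to \<open>n G\<close> of its value under \<open>f\<close> is the total
  extension (\<open>SES_extends\<close>). Conversely, a finitely generated \<open>A\<close> is an extremal quotient of
  some \<open>n G\<close>. For an epimorphism \<open>e : A \<rightarrow> B\<close> the functor represented by \<open>B\<close> is then the domain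
  of a continuous operation for each element of \<open>B\<close>, and a total extension of that operation is
  a preimage of the element (\<open>extension_imp_WES\<close>).
\<close>

section \<open>Small sets\<close>

lemma small_image: "small U A \<Longrightarrow> small U (f ` A)"
  unfolding small_def using card_of_image ordLeq_ordLess_trans by blast

lemma small_inj: "inj_on f A \<Longrightarrow> f ` A \<subseteq> B \<Longrightarrow> small U B \<Longrightarrow> small U A"
  unfolding small_def by (rule ordLeq_ordLess_trans[OF card_of_ordLeqI]) auto

lemma small_subset: "A \<subseteq> B \<Longrightarrow> small U B \<Longrightarrow> small U A"
  by (rule small_inj[of id]) auto

lemma small_code:
  assumes "small TYPE('u) A"
  obtains c :: "'x \<Rightarrow> 'u" where "inj_on c A" "small TYPE('u) (c ` A)"
proof -
  have "|A| \<le>o |UNIV :: 'u set|"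
    using assms unfolding small_def by (rule ordLess_imp_ordLeq)
  then obtain c :: "'x \<Rightarrow> 'u" where "inj_on c A"
    using card_of_ordLeq[of A "UNIV :: 'u set"] by auto
  then show ?thesis using that small_image[OF assms] by blast
qed

lemma infinite_universe:
  assumes "universe TYPE('u)"
  shows "infinite (UNIV :: 'u set)"
proof
  assume f: "finite (UNIV :: 'u set)"
  have "small TYPE('u) (UNIV :: nat set)" using assms unfolding universe_def by blast
  then obtain c :: "nat \<Rightarrow> 'u" where "inj_on c UNIV" by (rule small_code)
  then have "finite (UNIV :: nat set)" using f finite_imageD[of c UNIV] finite_subset[OF subset_UNIV f] by blast
  then show False by simp
qed

lemma small_finite:
  assumes "universe TYPE('u)" "finite A"
  shows "small TYPE('u) A"
proof -
  have "infinite (Field |UNIV :: 'u set| )" using infinite_universe[OF assms(1)] by (simp only: Field_card_of not_False_eq_True)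
  moreover have "finite (Field |A| )" using assms(2) by (simp only: Field_card_of)
  ultimately show ?thesis
    unfolding small_def using finite_ordLess_infinite[OF card_of_Well_order card_of_Well_order] by blast
qed

lemma small_Pow:
  assumes "universe TYPE('u)" "small TYPE('u) A"
  shows "small TYPE('u) (Pow A)"
proof -
  obtain c :: "_ \<Rightarrow> 'u" where c: "inj_on c A" "small TYPE('u) (c ` A)" by (rule small_code[OF assms(2)])
  have "small TYPE('u) (Pow (c ` A))" using assms(1) c(2) unfolding universe_def by blast
  moreover have "inj_on (image c) (Pow A)" using c(1) by (simp add: inj_on_image_Pow)
  moreover have "image c ` Pow A \<subseteq> Pow (c ` A)" by auto
  ultimately show ?thesis by - (rule small_inj)
qed

text \<open>
  The closure conditions on the universe only concern sets of elements of \<open>'u\<close>, so that the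
  family has to be coded there before they apply.
\<close>

lemma small_Sigma:
  assumes U: "universe TYPE('u)" and A: "small TYPE('u) A" and B: "\<And>x. x \<in> A \<Longrightarrow> small TYPE('u) (B x)"
  shows "small TYPE('u) (Sigma A B)"
proof -
  obtain c :: "_ \<Rightarrow> 'u" where c: "inj_on c A" "small TYPE('u) (c ` A)" by (rule small_code[OF A])
  have "\<exists>d :: _ \<Rightarrow> 'u. inj_on d (B x)" if "x \<in> A" for x using small_code[OF B[OF that]] by metis
  then obtain d :: "_ \<Rightarrow> _ \<Rightarrow> 'u" where d: "\<And>x. x \<in> A \<Longrightarrow> inj_on (d x) (B x)" by metis
  obtain p :: "'u \<times> 'u \<Rightarrow> 'u" where p: "inj p"
    using card_of_Times_same_infinite[OF infinite_universe[OF U]] card_of_ordIso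
    unfolding UNIV_Times_UNIV by (metis bij_betw_def)
  define F where "F u = (\<lambda>y. p (u, d (inv_into A c u) y)) ` B (inv_into A c u)" for u
  have "small TYPE('u) (\<Union>u\<in>c ` A. F u)"
  proof -
    have "\<forall>u\<in>c ` A. small TYPE('u) (F u)"
      unfolding F_def using B inv_into_into small_image by metis
    then show ?thesis using U c(2) unfolding universe_def by blast
  qed
  moreover have "inj_on (\<lambda>(x, y). p (c x, d x y)) (Sigma A B)"
  proof (rule inj_onI, clarify)
    fix x y x' y' assume x: "x \<in> A" "x' \<in> A" and y: "y \<in> B x" "y' \<in> B x'"
      and e: "p (c x, d x y) = p (c x', d x' y')"
    have "c x = c x'" "d x y = d x' y'" using injD[OF p e] by simp_all
    moreover from this(1) have "x = x'" using inj_onD[OF c(1)] x by blast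
    ultimately show "x = x' \<and> y = y'" using inj_onD[OF d[OF x(1)]] y by blast
  qed
  moreover have "(\<lambda>(x, y). p (c x, d x y)) ` Sigma A B \<subseteq> (\<Union>u\<in>c ` A. F u)"
    unfolding F_def by (force simp: inv_into_f_f[OF c(1)])
  ultimately show ?thesis by - (rule small_inj)
qed

lemma small_Times:
  "universe TYPE('u) \<Longrightarrow> small TYPE('u) A \<Longrightarrow> small TYPE('u) B \<Longrightarrow> small TYPE('u) (A \<times> B)"
  by (rule small_Sigma)

lemma small_PiE:
  assumes U: "universe TYPE('u)" and A: "small TYPE('u) A" and B: "\<And>x. x \<in> A \<Longrightarrow> small TYPE('u) (B x)"
  shows "small TYPE('u) (PiE A B)"
proof (rule small_inj)
  show "small TYPE('u) (Pow (Sigma A B))" by (rule small_Pow[OF U small_Sigma[OF U A B]])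
  show "(\<lambda>f. (\<lambda>x. (x, f x)) ` A) ` PiE A B \<subseteq> Pow (Sigma A B)" by (auto simp: PiE_def)
  show "inj_on (\<lambda>f. (\<lambda>x. (x, f x)) ` A) (PiE A B)"
  proof (rule inj_onI)
    fix f g assume f: "f \<in> PiE A B" and g: "g \<in> PiE A B"
      and e: "(\<lambda>x. (x, f x)) ` A = (\<lambda>x. (x, g x)) ` A"
    show "f = g"
      by (rule PiE_ext[OF f g]) (use e in auto)
  qed
qed

section \<open>Arrows in a category\<close>

locale cat =
  fixes C :: "('o, 'a) cat"
  assumes category: "category C"
begin

abbreviation comp (infixr "\<cdot>" 75) where "g \<cdot> f \<equiv> Comp C g f"

lemma hom_iff: "f \<in> hom C A B \<longleftrightarrow> f \<in> Ar C \<and> Dom C f = A \<and> Cod C f = B"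
  by (auto simp: hom_def)

lemma hom_Ob: "f \<in> hom C A B \<Longrightarrow> A \<in> Ob C" "f \<in> hom C A B \<Longrightarrow> B \<in> Ob C"
  using category unfolding category_def hom_iff by metis+

lemma Ar_Ob: "f \<in> Ar C \<Longrightarrow> Dom C f \<in> Ob C" "f \<in> Ar C \<Longrightarrow> Cod C f \<in> Ob C"
  using category unfolding category_def by blast+

lemma Ar_hom: "f \<in> Ar C \<Longrightarrow> f \<in> hom C (Dom C f) (Cod C f)"
  by (simp add: hom_iff)

lemma Id_hom: "A \<in> Ob C \<Longrightarrow> Id C A \<in> hom C A A"
  using category unfolding category_def by blast

lemma comp_hom: "f \<in> hom C A B \<Longrightarrow> g \<in> hom C B D \<Longrightarrow> g \<cdot> f \<in> hom C A D"
  using category unfolding category_def hom_iff by metis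

lemma comp_Id: "f \<in> hom C A B \<Longrightarrow> f \<cdot> Id C A = f"
  using category unfolding category_def hom_iff by metis

lemma Id_comp: "f \<in> hom C A B \<Longrightarrow> Id C B \<cdot> f = f"
  using category unfolding category_def hom_iff by metis

lemma assoc:
  "f \<in> hom C A B \<Longrightarrow> g \<in> hom C B D \<Longrightarrow> h \<in> hom C D E \<Longrightarrow> (h \<cdot> g) \<cdot> f = h \<cdot> g \<cdot> f"
  using category unfolding category_def hom_iff by metis

lemma monicI:
  assumes "m \<in> hom C A B"
    and "\<And>X f g. f \<in> hom C X A \<Longrightarrow> g \<in> hom C X A \<Longrightarrow> m \<cdot> f = m \<cdot> g \<Longrightarrow> f = g"
  shows "monic C m"
  using assms unfolding monic_def hom_iff by metis

lemma monicD:
  "monic C m \<Longrightarrow> m \<in> hom C A B \<Longrightarrow> f \<in> hom C X A \<Longrightarrow> g \<in> hom C X A \<Longrightarrow> m \<cdot> f = m \<cdot> g \<Longrightarrow> f = g"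
  unfolding monic_def hom_iff by auto

lemma epicI:
  assumes "e \<in> hom C A B"
    and "\<And>X f g. f \<in> hom C B X \<Longrightarrow> g \<in> hom C B X \<Longrightarrow> f \<cdot> e = g \<cdot> e \<Longrightarrow> f = g"
  shows "epic C e"
  using assms unfolding epic_def hom_iff by metis

lemma epicD:
  "epic C e \<Longrightarrow> e \<in> hom C A B \<Longrightarrow> f \<in> hom C B X \<Longrightarrow> g \<in> hom C B X \<Longrightarrow> f \<cdot> e = g \<cdot> e \<Longrightarrow> f = g"
  unfolding epic_def hom_iff by auto

lemma extremal_epic: "extremal_epi C e \<Longrightarrow> epic C e"
  by (simp add: extremal_epi_def)

lemma isomorphismE:
  assumes "isomorphism C f" "f \<in> hom C A B"
  obtains g where "g \<in> hom C B A" "g \<cdot> f = Id C A" "f \<cdot> g = Id C B"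
  using assms that unfolding isomorphism_def by (auto simp: hom_iff)

lemma split_epi_monic_iso:
  assumes m: "monic C m" "m \<in> hom C A B" and s: "s \<in> hom C B A" "m \<cdot> s = Id C B"
  shows "isomorphism C m"
proof -
  have "m \<cdot> (s \<cdot> m) = m \<cdot> Id C A"
    using assoc[OF m(2) s(1) m(2)] s(2) Id_comp[OF m(2)] comp_Id[OF m(2)] by simp
  then have "s \<cdot> m = Id C A"
    using monicD[OF m] comp_hom[OF m(2) s(1)] Id_hom hom_Ob(1)[OF m(2)] by blast
  then show ?thesis using m(2) s unfolding isomorphism_def by (metis hom_iff)
qed

lemma split_monic:
  assumes m: "m \<in> hom C A B" and r: "r \<in> hom C B A" "r \<cdot> m = Id C A"
  shows "monic C m"
proof (rule monicI[OF m])
  fix X f g assume f: "f \<in> hom C X A" and g: "g \<in> hom C X A" and e: "m \<cdot> f = m \<cdot> g"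
  have "f = (r \<cdot> m) \<cdot> f" using Id_comp[OF f] r(2) by simp
  also have "\<dots> = (r \<cdot> m) \<cdot> g" using assoc[OF f m r(1)] assoc[OF g m r(1)] e by simp
  finally show "f = g" using Id_comp[OF g] r(2) by simp
qed

lemma comp_monic:
  assumes m: "monic C m" "m \<in> hom C A B" and n: "monic C n" "n \<in> hom C B D"
  shows "monic C (n \<cdot> m)"
proof (rule monicI[OF comp_hom[OF m(2) n(2)]])
  fix X f g assume f: "f \<in> hom C X A" and g: "g \<in> hom C X A" and e: "(n \<cdot> m) \<cdot> f = (n \<cdot> m) \<cdot> g"
  have "n \<cdot> (m \<cdot> f) = n \<cdot> (m \<cdot> g)" using assoc[OF f m(2) n(2)] assoc[OF g m(2) n(2)] e by simp
  then show "f = g" using monicD[OF n comp_hom[OF f m(2)] comp_hom[OF g m(2)]] monicD[OF m f g] by blast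
qed

lemma monic_cancel:
  assumes m: "m \<in> hom C A B" and n: "n \<in> hom C B D" and nm: "monic C (n \<cdot> m)"
  shows "monic C m"
proof (rule monicI[OF m])
  fix X f g assume f: "f \<in> hom C X A" and g: "g \<in> hom C X A" and e: "m \<cdot> f = m \<cdot> g"
  have "(n \<cdot> m) \<cdot> f = (n \<cdot> m) \<cdot> g" using assoc[OF f m n] assoc[OF g m n] e by simp
  then show "f = g" by (rule monicD[OF nm comp_hom[OF m n] f g])
qed

lemma extremal_monic_iso:
  assumes e: "extremal_epi C e" "monic C e"
  shows "isomorphism C e"
proof -
  have "e \<in> Ar C" using e(2) unfolding monic_def by simp
  then have h: "e \<in> hom C (Dom C e) (Cod C e)" by (rule Ar_hom)
  have "Id C (Dom C e) \<in> hom C (Dom C e) (Dom C e)" by (rule Id_hom[OF hom_Ob(1)[OF h]])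
  then show ?thesis using e comp_Id[OF h] unfolding extremal_epi_def hom_iff by metis
qed

text \<open>
  A monomorphism that is the second factor of an epimorphism is itself epic.
\<close>

lemma ES_I:
  assumes iso: "\<And>m A B. m \<in> hom C A B \<Longrightarrow> monic C m \<Longrightarrow> epic C m \<Longrightarrow> isomorphism C m"
  shows "ES C"
  unfolding ES_def extremal_epi_def
proof (intro allI impI conjI)
  fix e m f assume e: "epic C e" and m: "monic C m" and f: "f \<in> Ar C" "Cod C f = Dom C m" and emf: "e = m \<cdot> f"
  have mh: "m \<in> hom C (Dom C m) (Cod C m)" using m by (simp add: monic_def hom_iff)
  have fh: "f \<in> hom C (Dom C f) (Dom C m)" using f by (simp add: hom_iff)
  have "epic C m"
  proof (rule epicI[OF mh])
    fix X s t assume s: "s \<in> hom C (Cod C m) X" and t: "t \<in> hom C (Cod C m) X" and st: "s \<cdot> m = t \<cdot> m"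
    have "s \<cdot> e = t \<cdot> e" using assoc[OF fh mh s] assoc[OF fh mh t] st emf by simp
    then show "s = t" using epicD[OF e _ s t] comp_hom[OF fh mh] emf by simp
  qed
  then show "isomorphism C m" by (rule iso[OF mh m])
qed (assumption)

lemma extremalD:
  assumes "extremal_epi C (m \<cdot> f)" "monic C m" "m \<in> hom C B D" "f \<in> hom C A B"
  shows "isomorphism C m"
  using assms unfolding extremal_epi_def hom_iff by blast

end

section \<open>Colimits of arbitrary small shape\<close>

text \<open>
  The shape of a parallel pair. Cocompleteness and continuity quantify over shapes that live on
  the universe, whence the code \<open>c\<close>: the objects \<open>c 0\<close> and \<open>c 1\<close> are their own identities, and
  the parallel arrows are \<open>c 2\<close> and \<open>c 3\<close>.
\<close>

definition parallel_cat :: "(nat \<Rightarrow> 'u) \<Rightarrow> ('u, 'u) cat" where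
  "parallel_cat c =
     \<lparr>Ob = {c 0, c 1}, Ar = {c 0, c 1, c 2, c 3},
      Dom = (\<lambda>x. if x = c 1 then c 1 else c 0), Cod = (\<lambda>x. if x = c 0 then c 0 else c 1),
      Id = (\<lambda>x. x), Comp = (\<lambda>g f. if f = c 0 \<or> f = c 1 then g else f)\<rparr>"

definition parallel_func :: "(nat \<Rightarrow> 'u) \<Rightarrow> ('o, 'a) cat \<Rightarrow> 'a \<Rightarrow> 'a \<Rightarrow> ('u, 'u, 'o, 'a) func" where
  "parallel_func c C u v =
     \<lparr>fob = (\<lambda>x. if x = c 0 then Dom C u else Cod C u),
      far = (\<lambda>x. if x = c 0 then Id C (Dom C u) else if x = c 1 then Id C (Cod C u)
                 else if x = c 2 then u else v)\<rparr>"

lemma parallel_cat_small: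
  assumes U: "universe TYPE('u)" and c: "inj c"
  shows "small_category (parallel_cat c :: ('u, 'u) cat)"
  unfolding small_category_def
proof (intro conjI)
  have d: "c 0 \<noteq> c 1" "c 0 \<noteq> c 2" "c 0 \<noteq> c 3" "c 1 \<noteq> c 2" "c 1 \<noteq> c 3" "c 2 \<noteq> c 3"
    using inj_eq[OF c] by simp_all
  show "category (parallel_cat c)"
    unfolding category_def hom_def parallel_cat_def using d by auto
  show "small TYPE('u) (Ob (parallel_cat c))" "small TYPE('u) (Ar (parallel_cat c))"
    unfolding parallel_cat_def by (auto intro: small_finite[OF U])
qed

lemma functorD:
  assumes "is_functor J C F"
  shows "category J" "\<And>j. j \<in> Ob J \<Longrightarrow> fob F j \<in> Ob C"
    "\<And>a. a \<in> Ar J \<Longrightarrow> far F a \<in> hom C (fob F (Dom J a)) (fob F (Cod J a))"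
    "\<And>j. j \<in> Ob J \<Longrightarrow> far F (Id J j) = Id C (fob F j)"
    "\<And>a b. a \<in> Ar J \<Longrightarrow> b \<in> Ar J \<Longrightarrow> Cod J a = Dom J b \<Longrightarrow> far F (Comp J b a) = Comp C (far F b) (far F a)"
  using assms unfolding is_functor_def by simp_all

lemma cocone_hom: "is_cocone J C F X \<iota> \<Longrightarrow> j \<in> Ob J \<Longrightarrow> \<iota> j \<in> hom C (fob F j) X"
  and cocone_comm: "is_cocone J C F X \<iota> \<Longrightarrow> u \<in> Ar J \<Longrightarrow> Comp C (\<iota> (Cod J u)) (far F u) = \<iota> (Dom J u)"
  and cocone_Ob: "is_cocone J C F X \<iota> \<Longrightarrow> X \<in> Ob C"
  by (simp_all add: is_cocone_def)

context cat
begin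

lemma parallel_functor:
  assumes U: "universe TYPE('u)" and c: "inj (c :: nat \<Rightarrow> 'u)" and u: "u \<in> hom C S X" and v: "v \<in> hom C S X"
  shows "is_functor (parallel_cat c) C (parallel_func c C u v)"
  unfolding is_functor_def
proof (intro conjI)
  have d: "c 0 \<noteq> c 1" "c 0 \<noteq> c 2" "c 0 \<noteq> c 3" "c 1 \<noteq> c 2" "c 1 \<noteq> c 3" "c 2 \<noteq> c 3"
    using inj_eq[OF c] by simp_all
  have I: "Id C S \<in> hom C S S" "Id C X \<in> hom C X X" using hom_Ob[OF u] by (simp_all add: Id_hom)
  note d = d d[symmetric]
  note s = parallel_cat_def parallel_func_def
  have e: "Dom C u = S" "Cod C u = X" using u by (simp_all add: hom_iff)
  show "category (parallel_cat c)" using parallel_cat_small[OF U c] by (simp add: small_category_def)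
  show "category C" by (rule category)
  show "\<forall>A\<in>Ob (parallel_cat c). fob (parallel_func c C u v) A \<in> Ob C"
    using hom_Ob[OF u] by (simp add: s e)
  show "\<forall>f\<in>Ar (parallel_cat c). far (parallel_func c C u v) f \<in>
    hom C (fob (parallel_func c C u v) (Dom (parallel_cat c) f)) (fob (parallel_func c C u v) (Cod (parallel_cat c) f))"
    using I u v d by (simp add: s e)
  show "\<forall>A\<in>Ob (parallel_cat c). far (parallel_func c C u v) (Id (parallel_cat c) A) = Id C (fob (parallel_func c C u v) A)"
    using d by (simp add: s e)
  show "\<forall>f\<in>Ar (parallel_cat c). \<forall>g\<in>Ar (parallel_cat c). Cod (parallel_cat c) f = Dom (parallel_cat c) g \<longrightarrow>
    far (parallel_func c C u v) (Comp (parallel_cat c) g f) = far (parallel_func c C u v) g \<cdot> far (parallel_func c C u v) f"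
    using d comp_Id[OF u] comp_Id[OF v] Id_comp[OF u] Id_comp[OF v] comp_Id[OF I(1)] comp_Id[OF I(2)]
    by (simp add: s e)
qed

definition is_coprod :: "'i set \<Rightarrow> ('i \<Rightarrow> 'o) \<Rightarrow> 'o \<Rightarrow> ('i \<Rightarrow> 'a) \<Rightarrow> bool" where
  "is_coprod I X P \<iota> \<longleftrightarrow> P \<in> Ob C \<and> (\<forall>i\<in>I. \<iota> i \<in> hom C (X i) P) \<and>
     (\<forall>Y \<kappa>. Y \<in> Ob C \<longrightarrow> (\<forall>i\<in>I. \<kappa> i \<in> hom C (X i) Y) \<longrightarrow>
        (\<exists>!h. h \<in> hom C P Y \<and> (\<forall>i\<in>I. h \<cdot> \<iota> i = \<kappa> i)))"

lemma discrete_colimit_iff: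
  "is_colimit (discrete_cat I) C \<lparr>fob = X, far = (\<lambda>i. Id C (X i))\<rparr> P \<iota> \<longleftrightarrow> is_coprod I X P \<iota>"
  (is "?L \<longleftrightarrow> ?R")
proof -
  have cocone: "is_cocone (discrete_cat I) C \<lparr>fob = X, far = (\<lambda>i. Id C (X i))\<rparr> Y \<kappa> \<longleftrightarrow>
      Y \<in> Ob C \<and> (\<forall>i\<in>I. \<kappa> i \<in> hom C (X i) Y)" for Y \<kappa>
    unfolding is_cocone_def discrete_cat_def using comp_Id by auto
  then show ?thesis
    unfolding is_colimit_def is_coprod_def cocone
    by (simp add: discrete_cat_def imp_conjL conj_assoc)
qed

lemma discrete_functor:
  assumes "\<And>i. i \<in> I \<Longrightarrow> X i \<in> Ob C"
  shows "is_functor (discrete_cat I) C \<lparr>fob = X, far = (\<lambda>i. Id C (X i))\<rparr>"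
proof -
  have "category (discrete_cat I)" by (auto simp: category_def discrete_cat_def hom_def)
  then show ?thesis
    unfolding is_functor_def using category Id_hom assms comp_Id[OF Id_hom[OF assms]]
    by (simp add: discrete_cat_def)
qed

lemma coprod_hom: "is_coprod I X P \<iota> \<Longrightarrow> i \<in> I \<Longrightarrow> \<iota> i \<in> hom C (X i) P"
  by (simp add: is_coprod_def)

lemma coprod_ex1:
  assumes "is_coprod I X P \<iota>" "Y \<in> Ob C" "\<And>i. i \<in> I \<Longrightarrow> \<kappa> i \<in> hom C (X i) Y"
  shows "\<exists>!h. h \<in> hom C P Y \<and> (\<forall>i\<in>I. h \<cdot> \<iota> i = \<kappa> i)"
  using assms unfolding is_coprod_def by blast

lemma coprod_copair:
  assumes "is_coprod I X P \<iota>" "Y \<in> Ob C" "\<And>i. i \<in> I \<Longrightarrow> \<kappa> i \<in> hom C (X i) Y"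
  obtains h where "h \<in> hom C P Y" "\<And>i. i \<in> I \<Longrightarrow> h \<cdot> \<iota> i = \<kappa> i"
  using coprod_ex1[OF assms] that by blast

lemma coprod_eqI:
  assumes P: "is_coprod I X P \<iota>" and h: "h \<in> hom C P Y" "k \<in> hom C P Y"
    and e: "\<And>i. i \<in> I \<Longrightarrow> h \<cdot> \<iota> i = k \<cdot> \<iota> i"
  shows "h = k"
proof -
  have "\<exists>!h. h \<in> hom C P Y \<and> (\<forall>i\<in>I. h \<cdot> \<iota> i = k \<cdot> \<iota> i)"
    by (rule coprod_ex1[OF P hom_Ob(2)[OF h(1)] comp_hom[OF coprod_hom[OF P] h(2)]])
  then show ?thesis using h e by blast
qed

text \<open>The coequaliser of a family of parallel pairs with varying domains.\<close>

definition is_coeq :: "('a \<times> 'a) set \<Rightarrow> 'a \<Rightarrow> bool" where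
  "is_coeq R q \<longleftrightarrow> q \<in> Ar C \<and> (\<forall>(u, v)\<in>R. q \<cdot> u = q \<cdot> v) \<and>
     (\<forall>h\<in>Ar C. Dom C h = Dom C q \<longrightarrow> (\<forall>(u, v)\<in>R. h \<cdot> u = h \<cdot> v) \<longrightarrow>
        (\<exists>!k. k \<in> hom C (Cod C q) (Cod C h) \<and> k \<cdot> q = h))"

lemma coeq_factor:
  assumes "is_coeq R q" "q \<in> hom C X Q" "h \<in> hom C X Y" "\<And>u v. (u, v) \<in> R \<Longrightarrow> h \<cdot> u = h \<cdot> v"
  obtains k where "k \<in> hom C Q Y" "k \<cdot> q = h"
proof -
  have "\<forall>(u, v)\<in>R. h \<cdot> u = h \<cdot> v" using assms(4) by blast
  moreover have "h \<in> Ar C" "Dom C h = Dom C q" "Cod C q = Q" "Cod C h = Y"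
    using assms(2,3) by (simp_all add: hom_iff)
  ultimately have "\<exists>!k. k \<in> hom C Q Y \<and> k \<cdot> q = h"
    using assms(1) unfolding is_coeq_def by blast
  then show ?thesis using that by blast
qed

lemma coeq_epic:
  assumes q: "is_coeq R q" and R: "\<And>u v. (u, v) \<in> R \<Longrightarrow> \<exists>S. u \<in> hom C S (Dom C q) \<and> v \<in> hom C S (Dom C q)"
  shows "epic C q"
proof -
  have qh: "q \<in> hom C (Dom C q) (Cod C q)" using q unfolding is_coeq_def hom_iff by blast
  show ?thesis
  proof (rule epicI[OF qh])
    fix X f g assume f: "f \<in> hom C (Cod C q) X" and g: "g \<in> hom C (Cod C q) X" and e: "f \<cdot> q = g \<cdot> q"
    have "(f \<cdot> q) \<cdot> u = (f \<cdot> q) \<cdot> v" if uv: "(u, v) \<in> R" for u v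
    proof -
      obtain S where "u \<in> hom C S (Dom C q)" "v \<in> hom C S (Dom C q)" using R[OF uv] by blast
      moreover have "q \<cdot> u = q \<cdot> v" using q uv unfolding is_coeq_def by blast
      ultimately show ?thesis using assoc[OF _ qh f] by metis
    qed
    then have "\<forall>(u, v)\<in>R. (f \<cdot> q) \<cdot> u = (f \<cdot> q) \<cdot> v" by blast
    moreover have "f \<cdot> q \<in> Ar C" "Dom C (f \<cdot> q) = Dom C q" "Cod C (f \<cdot> q) = X"
      using comp_hom[OF qh f] by (simp_all add: hom_iff)
    ultimately have "\<exists>!k. k \<in> hom C (Cod C q) X \<and> k \<cdot> q = f \<cdot> q"
      using q unfolding is_coeq_def by blast
    then show "f = g" using f g e by metis
  qed
qed

text \<open>
  A monomorphism through which \<open>q\<close> factors can be cancelled, so that the other factor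
  coequalises the family as well; it therefore factors through \<open>q\<close>, and this splits the
  monomorphism.
\<close>

lemma coeq_extremal:
  assumes q: "is_coeq R q" and qh: "q \<in> hom C X Q"
    and R: "\<And>u v. (u, v) \<in> R \<Longrightarrow> \<exists>S. u \<in> hom C S X \<and> v \<in> hom C S X"
  shows "extremal_epi C q"
  unfolding extremal_epi_def
proof (intro conjI allI impI)
  show ep: "epic C q" by (rule coeq_epic[OF q]) (use R qh in \<open>simp add: hom_iff\<close>)
  fix m f assume m: "monic C m" and f: "f \<in> Ar C" and c: "Cod C f = Dom C m" and e: "q = m \<cdot> f"
  have mh: "m \<in> hom C (Dom C m) (Cod C m)" using m by (simp add: monic_def hom_iff)
  have fh: "f \<in> hom C (Dom C f) (Dom C m)" using f c by (simp add: hom_iff)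
  have "q \<in> hom C (Dom C f) (Cod C m)" using comp_hom[OF fh mh] e by simp
  then have d: "Dom C f = X" "Cod C m = Q" using qh by (simp_all add: hom_iff)
  note mh = mh[unfolded d] and fh = fh[unfolded d]
  have "f \<cdot> u = f \<cdot> v" if uv: "(u, v) \<in> R" for u v
  proof -
    obtain S where S: "u \<in> hom C S X" "v \<in> hom C S X" using R[OF uv] by blast
    have "q \<cdot> u = q \<cdot> v" using q uv unfolding is_coeq_def by blast
    then have "m \<cdot> f \<cdot> u = m \<cdot> f \<cdot> v" using e assoc[OF S(1) fh mh] assoc[OF S(2) fh mh] by simp
    then show ?thesis using monicD[OF m mh comp_hom[OF S(1) fh] comp_hom[OF S(2) fh]] by blast
  qed
  then obtain k where k: "k \<in> hom C Q (Dom C m)" "k \<cdot> q = f" using coeq_factor[OF q qh fh] by blast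
  have "(m \<cdot> k) \<cdot> q = Id C Q \<cdot> q" using assoc[OF qh k(1) mh] k(2) e Id_comp[OF qh] by simp
  then have "m \<cdot> k = Id C Q"
    using epicD[OF ep qh comp_hom[OF k(1) mh] Id_hom] hom_Ob(2)[OF qh] by blast
  then show "isomorphism C m" using split_epi_monic_iso[OF m mh k(1)] by blast
qed

end

locale cocomplete_cat = cat C for C :: "('o, 'u) cat" +
  assumes universe: "universe TYPE('u)"
    and locally_small: "locally_small C"
    and cocomplete: "cocomplete C"
begin

lemma small_hom: "A \<in> Ob C \<Longrightarrow> B \<in> Ob C \<Longrightarrow> small TYPE('u) (hom C A B)"
  using locally_small by (simp add: locally_small_def)

lemma coprod_exists:
  assumes I: "small TYPE('u) I" and X: "\<And>i. i \<in> I \<Longrightarrow> X i \<in> Ob C"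
  obtains P \<iota> where "is_coprod I X P \<iota>"
proof -
  obtain c :: "_ \<Rightarrow> 'u" where c: "inj_on c I" "small TYPE('u) (c ` I)" by (rule small_code[OF I])
  let ?X = "\<lambda>j. X (inv_into I c j)"
  have iv: "inv_into I c (c i) = i" if "i \<in> I" for i using inv_into_f_f[OF c(1) that] .
  have F: "is_functor (discrete_cat (c ` I)) C \<lparr>fob = ?X, far = (\<lambda>i. Id C (?X i))\<rparr>"
    by (rule discrete_functor) (auto simp: iv X)
  moreover have "small_category (discrete_cat (c ` I))"
    using F c(2) unfolding small_category_def is_functor_def by (simp add: discrete_cat_def)
  ultimately obtain P \<iota> where P: "is_coprod (c ` I) ?X P \<iota>"
    using cocomplete unfolding cocomplete_def discrete_colimit_iff[symmetric] by blast
  have "is_coprod I X P (\<lambda>i. \<iota> (c i))"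
    unfolding is_coprod_def
  proof (intro conjI ballI allI impI)
    show "P \<in> Ob C" using P by (simp add: is_coprod_def)
    show "\<iota> (c i) \<in> hom C (X i) P" if "i \<in> I" for i
      using coprod_hom[OF P, of "c i"] that iv by simp
    fix Y \<kappa> assume Y: "Y \<in> Ob C" and k: "\<forall>i\<in>I. \<kappa> i \<in> hom C (X i) Y"
    have "\<exists>!h. h \<in> hom C P Y \<and> (\<forall>j\<in>c ` I. h \<cdot> \<iota> j = \<kappa> (inv_into I c j))"
      by (rule coprod_ex1[OF P Y]) (use k iv in auto)
    moreover have "(\<forall>j\<in>c ` I. h \<cdot> \<iota> j = \<kappa> (inv_into I c j)) \<longleftrightarrow> (\<forall>i\<in>I. h \<cdot> \<iota> (c i) = \<kappa> i)" for h
      using iv by auto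
    ultimately show "\<exists>!h. h \<in> hom C P Y \<and> (\<forall>i\<in>I. h \<cdot> \<iota> (c i) = \<kappa> i)" by simp
  qed
  then show ?thesis by (rule that)
qed

lemma nat_code:
  obtains c :: "nat \<Rightarrow> 'u" where "inj c"
  using infinite_countable_subset[OF infinite_universe[OF universe]] by blast

lemma parallel_coeq:
  assumes u: "u \<in> hom C S X" and v: "v \<in> hom C S X"
  obtains q where "is_coeq {(u, v)} q" "Dom C q = X"
proof -
  obtain c :: "nat \<Rightarrow> 'u" where c: "inj c" by (rule nat_code)
  have d: "c 0 \<noteq> c 1" "c 0 \<noteq> c 2" "c 0 \<noteq> c 3" "c 1 \<noteq> c 2" "c 1 \<noteq> c 3" "c 2 \<noteq> c 3"
    using inj_eq[OF c] by simp_all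
  note d = d d[symmetric]
  have e: "Dom C u = S" "Cod C u = X" using u by (simp_all add: hom_iff)
  let ?J = "parallel_cat c" and ?F = "parallel_func c C u v"
  note s = parallel_cat_def parallel_func_def
  obtain Q \<iota> where Q: "is_colimit ?J C ?F Q \<iota>"
    using cocomplete parallel_cat_small[OF universe c] parallel_functor[OF universe c u v]
    unfolding cocomplete_def by blast
  have cocone: "is_cocone ?J C ?F Y \<kappa> \<longleftrightarrow> \<kappa> (c 0) = \<kappa> (c 1) \<cdot> u \<and> \<kappa> (c 1) \<cdot> u = \<kappa> (c 1) \<cdot> v \<and> \<kappa> (c 1) \<in> hom C X Y" for Y \<kappa>
  proof
    assume "is_cocone ?J C ?F Y \<kappa>"
    then show "\<kappa> (c 0) = \<kappa> (c 1) \<cdot> u \<and> \<kappa> (c 1) \<cdot> u = \<kappa> (c 1) \<cdot> v \<and> \<kappa> (c 1) \<in> hom C X Y"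
      using d unfolding is_cocone_def by (simp add: s e)
  next
    assume k: "\<kappa> (c 0) = \<kappa> (c 1) \<cdot> u \<and> \<kappa> (c 1) \<cdot> u = \<kappa> (c 1) \<cdot> v \<and> \<kappa> (c 1) \<in> hom C X Y"
    then have "\<kappa> (c 0) \<in> hom C S Y" using comp_hom[OF u] by metis
    then show "is_cocone ?J C ?F Y \<kappa>"
      using d k hom_Ob(2)[of "\<kappa> (c 1)" X Y] comp_Id[of "\<kappa> (c 0)" S Y] comp_Id[of "\<kappa> (c 1)" X Y]
      unfolding is_cocone_def by (simp add: s e)
  qed
  have Qc: "\<iota> (c 0) = \<iota> (c 1) \<cdot> u" "\<iota> (c 1) \<cdot> u = \<iota> (c 1) \<cdot> v" "\<iota> (c 1) \<in> hom C X Q"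
    using Q cocone unfolding is_colimit_def by blast+
  have "is_coeq {(u, v)} (\<iota> (c 1))"
    unfolding is_coeq_def
  proof (intro conjI ballI impI)
    show "\<iota> (c 1) \<in> Ar C" using Qc(3) by (simp add: hom_iff)
    show "case z of (u, v) \<Rightarrow> \<iota> (c 1) \<cdot> u = \<iota> (c 1) \<cdot> v" if "z \<in> {(u, v)}" for z using Qc that by simp
    fix h assume h: "h \<in> Ar C" "Dom C h = Dom C (\<iota> (c 1))" "\<forall>(u, v)\<in>{(u, v)}. h \<cdot> u = h \<cdot> v"
    let ?k = "\<lambda>x. if x = c 0 then h \<cdot> u else h"
    have hh: "h \<in> hom C X (Cod C h)" using h Qc(3) by (simp add: hom_iff)
    have "is_cocone ?J C ?F (Cod C h) ?k" using d h hh by (simp add: cocone)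
    then have "\<exists>!k. k \<in> hom C Q (Cod C h) \<and> (\<forall>j\<in>Ob ?J. k \<cdot> \<iota> j = ?k j)"
      using Q unfolding is_colimit_def by blast
    moreover have "k \<in> hom C Q (Cod C h) \<and> (\<forall>j\<in>Ob ?J. k \<cdot> \<iota> j = ?k j) \<longleftrightarrow>
        k \<in> hom C (Cod C (\<iota> (c 1))) (Cod C h) \<and> k \<cdot> \<iota> (c 1) = h" for k
    proof -
      have "Cod C (\<iota> (c 1)) = Q" using Qc(3) by (simp add: hom_iff)
      moreover have "k \<cdot> \<iota> (c 1) \<cdot> u = (k \<cdot> \<iota> (c 1)) \<cdot> u" if "k \<in> hom C Q (Cod C h)"
        using assoc[OF u Qc(3) that] by simp
      ultimately show ?thesis using d by (auto simp: s Qc(1))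
    qed
    ultimately show "\<exists>!k. k \<in> hom C (Cod C (\<iota> (c 1))) (Cod C h) \<and> k \<cdot> \<iota> (c 1) = h" by simp
  qed
  moreover have "Dom C (\<iota> (c 1)) = X" using Qc(3) by (simp add: hom_iff)
  ultimately show ?thesis by (rule that)
qed

text \<open>
  The domains of the pairs are collected in a coproduct, which turns the family into a single
  parallel pair.
\<close>

lemma coeq_exists:
  assumes X: "X \<in> Ob C" and R: "small TYPE('u) R"
    and p: "\<And>u v. (u, v) \<in> R \<Longrightarrow> \<exists>S. u \<in> hom C S X \<and> v \<in> hom C S X"
  obtains q Q where "is_coeq R q" "q \<in> hom C X Q"
proof -
  let ?S = "\<lambda>r. Dom C (fst r)"
  have R1: "fst r \<in> hom C (?S r) X" "snd r \<in> hom C (?S r) X" if "r \<in> R" for r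
    using p[of "fst r" "snd r"] that by (auto simp: hom_iff)
  obtain P \<iota> where P: "is_coprod R ?S P \<iota>"
    by (rule coprod_exists[OF R]) (use hom_Ob(1)[OF R1(1)] in auto)
  obtain a where a: "a \<in> hom C P X" "\<And>r. r \<in> R \<Longrightarrow> a \<cdot> \<iota> r = fst r"
    by (rule coprod_copair[OF P X, of fst]) (use R1 in auto)
  obtain b where b: "b \<in> hom C P X" "\<And>r. r \<in> R \<Longrightarrow> b \<cdot> \<iota> r = snd r"
    by (rule coprod_copair[OF P X, of snd]) (use R1 in auto)
  obtain q where q: "is_coeq {(a, b)} q" "Dom C q = X" by (rule parallel_coeq[OF a(1) b(1)])
  have iff: "h \<cdot> a = h \<cdot> b \<longleftrightarrow> (\<forall>(u, v)\<in>R. h \<cdot> u = h \<cdot> v)" if h: "h \<in> hom C X Y" for h Y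
  proof -
    have "h \<cdot> a = h \<cdot> b \<longleftrightarrow> (\<forall>r\<in>R. (h \<cdot> a) \<cdot> \<iota> r = (h \<cdot> b) \<cdot> \<iota> r)"
      using coprod_eqI[OF P comp_hom[OF a(1) h] comp_hom[OF b(1) h]] by auto
    also have "\<dots> \<longleftrightarrow> (\<forall>r\<in>R. h \<cdot> fst r = h \<cdot> snd r)"
      using assoc[OF coprod_hom[OF P] a(1) h] assoc[OF coprod_hom[OF P] b(1) h] a(2) b(2) by simp
    finally show ?thesis by auto
  qed
  have qh: "q \<in> hom C X (Cod C q)" using q by (simp add: is_coeq_def hom_iff)
  have "is_coeq R q"
    unfolding is_coeq_def
  proof (intro conjI ballI impI)
    show "q \<in> Ar C" using qh by (simp add: hom_iff)
    have "q \<cdot> a = q \<cdot> b" using q(1) by (simp add: is_coeq_def)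
    then show "case z of (u, v) \<Rightarrow> q \<cdot> u = q \<cdot> v" if "z \<in> R" for z using iff[OF qh] that by blast
    fix h assume h: "h \<in> Ar C" "Dom C h = Dom C q" "\<forall>(u, v)\<in>R. h \<cdot> u = h \<cdot> v"
    then have "h \<in> hom C X (Cod C h)" using q(2) by (simp add: hom_iff)
    then have "h \<cdot> a = h \<cdot> b" using iff h(3) by blast
    then show "\<exists>!k. k \<in> hom C (Cod C q) (Cod C h) \<and> k \<cdot> q = h"
      using q(1) h unfolding is_coeq_def by simp
  qed
  then show ?thesis using qh by (rule that)
qed

text \<open>
  The usual construction as a quotient of a coproduct. It is carried out for shapes on arbitrary
  types, since posets, as categories, have pairs for arrows.
\<close>

lemma colimit_exists:
  assumes F: "is_functor J C F" and J: "small TYPE('u) (Ob J)" "small TYPE('u) (Ar J)"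
  obtains L \<iota> where "is_colimit J C F L \<iota>"
proof -
  have FO: "\<And>j. j \<in> Ob J \<Longrightarrow> fob F j \<in> Ob C"
    and FA: "\<And>a. a \<in> Ar J \<Longrightarrow> far F a \<in> hom C (fob F (Dom J a)) (fob F (Cod J a))"
    and JA: "\<And>a. a \<in> Ar J \<Longrightarrow> Dom J a \<in> Ob J \<and> Cod J a \<in> Ob J"
    using functorD(2,3)[OF F] cat.Ar_Ob[OF cat.intro[OF functorD(1)[OF F]]] by simp_all
  obtain P p where P: "is_coprod (Ob J) (fob F) P p" by (rule coprod_exists[OF J(1) FO])
  define R where "R = (\<lambda>a. (p (Dom J a), p (Cod J a) \<cdot> far F a)) ` Ar J"
  have R: "\<exists>S. u \<in> hom C S P \<and> v \<in> hom C S P" if uv: "(u, v) \<in> R" for u v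
  proof -
    obtain a where a: "a \<in> Ar J" "u = p (Dom J a)" "v = p (Cod J a) \<cdot> far F a" using uv unfolding R_def by blast
    then show ?thesis using coprod_hom[OF P] comp_hom[OF FA] JA[OF a(1)] by blast
  qed
  have PO: "P \<in> Ob C" using P by (simp add: is_coprod_def)
  obtain q Q where q: "is_coeq R q" "q \<in> hom C P Q"
    by (rule coeq_exists[OF PO _ R]) (auto simp: R_def small_image[OF J(2)])
  have ep: "epic C q" by (rule coeq_epic[OF q(1)]) (use R q(2) in \<open>simp add: hom_iff\<close>)
  have comm: "h \<cdot> p (Dom J a) = (h \<cdot> p (Cod J a)) \<cdot> far F a \<longleftrightarrow> h \<cdot> p (Dom J a) = h \<cdot> p (Cod J a) \<cdot> far F a"
    if "h \<in> hom C P Y" "a \<in> Ar J" for h a Y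
    using assoc[OF FA[OF that(2)] coprod_hom[OF P] that(1)] JA[OF that(2)] by simp
  have "is_colimit J C F Q (\<lambda>j. q \<cdot> p j)"
    unfolding is_colimit_def
  proof (intro conjI allI impI)
    show "is_cocone J C F Q (\<lambda>j. q \<cdot> p j)"
      unfolding is_cocone_def
    proof (intro conjI ballI)
      show "Q \<in> Ob C" by (rule hom_Ob(2)[OF q(2)])
      show "q \<cdot> p j \<in> hom C (fob F j) Q" if "j \<in> Ob J" for j
        by (rule comp_hom[OF coprod_hom[OF P that] q(2)])
      show "(q \<cdot> p (Cod J a)) \<cdot> far F a = q \<cdot> p (Dom J a)" if "a \<in> Ar J" for a
        using q(1) comm[OF q(2) that] that unfolding is_coeq_def R_def by auto
    qed
    fix Y \<kappa> assume K: "is_cocone J C F Y \<kappa>"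
    have YO: "Y \<in> Ob C" and kh: "\<And>j. j \<in> Ob J \<Longrightarrow> \<kappa> j \<in> hom C (fob F j) Y"
      and kc: "\<And>a. a \<in> Ar J \<Longrightarrow> \<kappa> (Cod J a) \<cdot> far F a = \<kappa> (Dom J a)"
      using cocone_Ob[OF K] cocone_hom[OF K] cocone_comm[OF K] by simp_all
    obtain h where h: "h \<in> hom C P Y" "\<And>j. j \<in> Ob J \<Longrightarrow> h \<cdot> p j = \<kappa> j"
      using coprod_copair[OF P YO kh] by blast
    have "h \<cdot> u = h \<cdot> v" if "(u, v) \<in> R" for u v
      using that unfolding R_def using comm[OF h(1)] h(2) kc JA by auto
    then obtain k where k: "k \<in> hom C Q Y" "k \<cdot> q = h" by (rule coeq_factor[OF q h(1)])
    show "\<exists>!h. h \<in> hom C Q Y \<and> (\<forall>j\<in>Ob J. h \<cdot> q \<cdot> p j = \<kappa> j)"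
    proof (rule ex1I[of _ k])
      show "k \<in> hom C Q Y \<and> (\<forall>j\<in>Ob J. k \<cdot> q \<cdot> p j = \<kappa> j)"
        using k h(2) assoc[OF coprod_hom[OF P] q(2) k(1)] by simp
      fix k' assume k': "k' \<in> hom C Q Y \<and> (\<forall>j\<in>Ob J. k' \<cdot> q \<cdot> p j = \<kappa> j)"
      have "k' \<cdot> q = k \<cdot> q"
        by (rule coprod_eqI[OF P comp_hom[OF q(2)] comp_hom[OF q(2)]])
          (use k k' h(2) assoc[OF coprod_hom[OF P] q(2)] in auto)
      then show "k' = k" using epicD[OF ep q(2)] k(1) k' by blast
    qed
  qed
  then show ?thesis by (rule that)
qed

end

section \<open>Arrows in the category of sets\<close>

lemma set_cat_Ob: "A \<in> Ob (set_cat U) \<longleftrightarrow> small U A"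
  by (simp add: set_cat_def)

lemma set_cat_hom:
  "a \<in> hom (set_cat U) A B \<longleftrightarrow>
     src a = A \<and> trg a = B \<and> small U A \<and> small U B \<and> fn a \<in> A \<rightarrow>\<^sub>E B"
  by (auto simp: hom_def set_cat_def)

lemma set_cat_comp: "Comp (set_cat U) g f = SetArr (src f) (compose (src f) (fn g) (fn f)) (trg g)"
  by (simp add: set_cat_def)

lemma set_cat_category: "category (set_cat U)"
  unfolding category_def
proof (intro conjI ballI impI)
  let ?S = "set_cat U"
  fix f g h assume f: "f \<in> Ar ?S"
  show "Dom ?S f \<in> Ob ?S" "Cod ?S f \<in> Ob ?S" using f by (simp_all add: set_cat_def)
  show "Comp ?S f (Id ?S (Dom ?S f)) = f"
    using f by (cases f) (auto simp: set_cat_def compose_def restrict_def PiE_def extensional_def fun_eq_iff)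
  show "Comp ?S (Id ?S (Cod ?S f)) f = f"
    using f by (cases f) (auto simp: set_cat_def compose_def restrict_def PiE_def extensional_def fun_eq_iff Pi_def)
  assume g: "g \<in> Ar ?S" and fg: "Cod ?S f = Dom ?S g"
  show "Comp ?S g f \<in> hom ?S (Dom ?S f) (Cod ?S g)"
    using f g fg by (auto simp: set_cat_def hom_def compose_def)
  assume h: "h \<in> Ar ?S" and gh: "Cod ?S g = Dom ?S h"
  show "Comp ?S h (Comp ?S g f) = Comp ?S (Comp ?S h g) f"
    using f g h fg gh by (auto simp: set_cat_def compose_def restrict_def fun_eq_iff)
next
  fix A assume "A \<in> Ob (set_cat U)"
  then show "Id (set_cat U) A \<in> hom (set_cat U) A A" by (simp add: set_cat_def hom_def)
qed

lemma setarr_eqI: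
  assumes "f \<in> hom (set_cat U) A B" "g \<in> hom (set_cat U) A B" "\<And>x. x \<in> A \<Longrightarrow> fn f x = fn g x"
  shows "f = g"
proof -
  have "fn f = fn g" using assms by (intro PiE_ext[of _ A "\<lambda>_. B"]) (auto simp: set_cat_hom)
  then show ?thesis using assms(1,2) by (cases f; cases g) (simp add: set_cat_hom)
qed

lemma two_points:
  assumes "universe TYPE('u)"
  obtains a b :: 'u where "a \<noteq> b"
proof -
  have "\<exists>b. b \<notin> {undefined :: 'u}" by (rule ex_new_if_finite[OF infinite_universe[OF assms]]) simp
  then show ?thesis using that by blast
qed

text \<open>
  A point outside the image would be separated from it by two maps to a set with two elements.
\<close>

lemma set_epic_surj:
  fixes e :: "'u setarr"
  assumes U: "universe TYPE('u)" and e: "epic (set_cat TYPE('u)) e" and y: "y \<in> trg e"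
  shows "\<exists>x\<in>src e. fn e x = y"
proof (rule ccontr)
  assume n: "\<not> (\<exists>x\<in>src e. fn e x = y)"
  obtain a b :: 'u where ab: "a \<noteq> b" by (rule two_points[OF U])
  let ?f = "SetArr (trg e) (\<lambda>x\<in>trg e. a) {a, b}"
  let ?g = "SetArr (trg e) (\<lambda>x\<in>trg e. if x = y then b else a) {a, b}"
  have eA: "e \<in> Ar (set_cat TYPE('u))" using e by (simp add: epic_def)
  then have s: "small TYPE('u) (trg e)" "fn e \<in> src e \<rightarrow>\<^sub>E trg e" by (simp_all add: set_cat_def)
  have f: "?f \<in> Ar (set_cat TYPE('u))" and g: "?g \<in> Ar (set_cat TYPE('u))"
    using s small_finite[OF U, of "{a, b}"] by (auto simp: set_cat_def)
  have "compose (src e) (fn ?f) (fn e) = compose (src e) (fn ?g) (fn e)"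
    unfolding compose_def by (rule restrict_ext) (use n PiE_mem[OF s(2)] in auto)
  then have "Comp (set_cat TYPE('u)) ?f e = Comp (set_cat TYPE('u)) ?g e"
    by (simp add: set_cat_comp)
  moreover have "Cod (set_cat TYPE('u)) ?f = Cod (set_cat TYPE('u)) ?g"
    "Dom (set_cat TYPE('u)) ?f = Cod (set_cat TYPE('u)) e"
    "Dom (set_cat TYPE('u)) ?g = Cod (set_cat TYPE('u)) e"
    by (simp_all add: set_cat_def)
  ultimately have "?f = ?g" using e f g unfolding epic_def by blast
  then have "(\<lambda>x\<in>trg e. a) y = (\<lambda>x\<in>trg e. if x = y then b else a) y" by simp
  then show False using ab y by simp
qed

section \<open>Categories with an extremal projective generator\<close>

locale projectively_generated_cat = cocomplete_cat C for C :: "('o, 'u) cat" +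
  fixes G :: 'o
  assumes projective_generator: "extremal_projective_generator C G"
begin

lemma G_Ob: "G \<in> Ob C"
  using projective_generator
  by (simp add: extremal_projective_generator_def extremal_projective_def)

lemma hom_functor_hom:
  assumes X: "X \<in> Ob C" and f: "f \<in> hom C A B"
  shows "far (hom_functor C X) f \<in> hom (set_cat TYPE('u)) (hom C X A) (hom C X B)"
  using f small_hom[OF X] hom_Ob[OF f] comp_hom[OF _ f]
  by (auto simp: set_cat_hom hom_functor_def hom_iff[of f])

lemma extremal_lift:
  assumes e: "extremal_epi C e" "e \<in> hom C X Y" and y: "y \<in> hom C G Y"
  obtains x where "x \<in> hom C G X" "e \<cdot> x = y"
proof -
  let ?e = "far (hom_functor C G) e"
  have "epic (set_cat TYPE('u)) ?e"
    using projective_generator e(1)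
    by (simp add: extremal_projective_generator_def extremal_projective_def extremal_epi_def)
  then have "\<exists>x\<in>src ?e. fn ?e x = y"
    by (rule set_epic_surj[OF universe]) (use y e(2) in \<open>simp add: hom_functor_def hom_iff\<close>)
  then show ?thesis using that e(2) by (auto simp: hom_functor_def hom_iff)
qed

lemma canonical_cover:
  assumes X: "X \<in> Ob C"
  obtains P \<iota> p where "is_coprod (hom C G X) (\<lambda>_. G) P \<iota>" "p \<in> hom C P X"
    "\<And>x. x \<in> hom C G X \<Longrightarrow> p \<cdot> \<iota> x = x" "extremal_epi C p"
proof -
  obtain P \<iota> where P: "is_coprod (hom C G X) (\<lambda>_. G) P \<iota>"
    using coprod_exists[OF small_hom[OF G_Ob X], of "\<lambda>_. G"] G_Ob by blast
  obtain p where p: "p \<in> hom C P X" "\<And>x. x \<in> hom C G X \<Longrightarrow> p \<cdot> \<iota> x = x"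
    using coprod_copair[OF P X, of "\<lambda>x. x"] by blast
  have "is_copower C (hom C G X) G P \<iota>"
    unfolding is_copower_def using P discrete_colimit_iff[of "hom C G X" "\<lambda>_. G" P \<iota>] by simp
  then have "extremal_epi C p"
    using projective_generator X p
    unfolding extremal_projective_generator_def extremal_generator_def by blast
  with P p show ?thesis by (rule that)
qed

lemma separates:
  assumes f: "f \<in> hom C X Y" and g: "g \<in> hom C X Y"
    and e: "\<And>x. x \<in> hom C G X \<Longrightarrow> f \<cdot> x = g \<cdot> x"
  shows "f = g"
proof -
  obtain P \<iota> p where P: "is_coprod (hom C G X) (\<lambda>_. G) P \<iota>" and p: "p \<in> hom C P X"
    "\<And>x. x \<in> hom C G X \<Longrightarrow> p \<cdot> \<iota> x = x" "extremal_epi C p"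
    using canonical_cover[OF hom_Ob(1)[OF f]] by blast
  have "f \<cdot> p = g \<cdot> p"
    by (rule coprod_eqI[OF P comp_hom[OF p(1) f] comp_hom[OF p(1) g]])
      (simp add: assoc[OF coprod_hom[OF P] p(1)  f] assoc[OF coprod_hom[OF P] p(1) g] p(2) e)
  then show ?thesis by (rule epicD[OF extremal_epic[OF p(3)] p(1) f g])
qed

text \<open>
  Elements separate arrows, so it is enough to cancel on elements.
\<close>

lemma monic_elementwise:
  assumes m: "m \<in> hom C A B"
    and e: "\<And>x y. x \<in> hom C G A \<Longrightarrow> y \<in> hom C G A \<Longrightarrow> m \<cdot> x = m \<cdot> y \<Longrightarrow> x = y"
  shows "monic C m"
proof (rule monicI[OF m])
  fix X f g assume f: "f \<in> hom C X A" and g: "g \<in> hom C X A" and fg: "m \<cdot> f = m \<cdot> g"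
  show "f = g"
  proof (rule separates[OF f g])
    fix x assume x: "x \<in> hom C G X"
    show "f \<cdot> x = g \<cdot> x"
      by (rule e[OF comp_hom[OF x f] comp_hom[OF x g]])
        (use assoc[OF x f m] assoc[OF x g m] fg in simp)
  qed
qed

text \<open>
  A monomorphism through which \<open>e\<close> factors is surjective on elements, so the canonical cover of
  the codomain factors through it, and that cover is extremal.
\<close>

lemma extremal_elementwise:
  assumes e: "e \<in> hom C X Y"
    and s: "\<And>y. y \<in> hom C G Y \<Longrightarrow> \<exists>x\<in>hom C G X. e \<cdot> x = y"
  shows "extremal_epi C e"
  unfolding extremal_epi_def
proof (intro conjI allI impI)
  show "epic C e"
  proof (rule epicI[OF e])
    fix Z f g assume f: "f \<in> hom C Y Z" and g: "g \<in> hom C Y Z" and fg: "f \<cdot> e = g \<cdot> e"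
    show "f = g"
    proof (rule separates[OF f g])
      fix y assume "y \<in> hom C G Y"
      then obtain x where x: "x \<in> hom C G X" "e \<cdot> x = y" using s by blast
      show "f \<cdot> y = g \<cdot> y" using assoc[OF x(1) e f] assoc[OF x(1) e g] fg x(2) by simp
    qed
  qed
  fix m f assume m: "monic C m" and f: "f \<in> Ar C" and c: "Cod C f = Dom C m" and ef: "e = m \<cdot> f"
  have mh: "m \<in> hom C (Dom C m) (Cod C m)" using m by (simp add: monic_def hom_iff)
  have fh: "f \<in> hom C (Dom C f) (Dom C m)" using f c by (simp add: hom_iff)
  have "e \<in> hom C (Dom C f) (Cod C m)" using comp_hom[OF fh mh] ef by simp
  then have d: "Dom C f = X" "Cod C m = Y" using e by (simp_all add: hom_iff)
  note mh = mh[unfolded d] and fh = fh[unfolded d]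
  obtain P \<iota> p where P: "is_coprod (hom C G Y) (\<lambda>_. G) P \<iota>" and p: "p \<in> hom C P Y"
    "\<And>x. x \<in> hom C G Y \<Longrightarrow> p \<cdot> \<iota> x = x" "extremal_epi C p"
    using canonical_cover[OF hom_Ob(2)[OF e]] by blast
  have "\<exists>z\<in>hom C G (Dom C m). m \<cdot> z = y" if y: "y \<in> hom C G Y" for y
  proof -
    obtain x where x: "x \<in> hom C G X" "e \<cdot> x = y" using s y by blast
    then show ?thesis using assoc[OF x(1) fh mh] ef comp_hom[OF x(1) fh] by metis
  qed
  then obtain z where z: "\<And>y. y \<in> hom C G Y \<Longrightarrow> z y \<in> hom C G (Dom C m)"
    "\<And>y. y \<in> hom C G Y \<Longrightarrow> m \<cdot> z y = y" by metis
  obtain k where k: "k \<in> hom C P (Dom C m)" "\<And>y. y \<in> hom C G Y \<Longrightarrow> k \<cdot> \<iota> y = z y"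
    using coprod_copair[OF P hom_Ob(1)[OF mh], of z] z(1) by blast
  have "m \<cdot> k = p"
    by (rule coprod_eqI[OF P comp_hom[OF k(1) mh] p(1)])
      (simp add: assoc[OF coprod_hom[OF P] k(1) mh] k(2) p(2) z(2))
  then show "isomorphism C m" using extremalD[OF _ m mh k(1)] p(3) by simp
qed

definition kernel :: "'u \<Rightarrow> 'o \<Rightarrow> ('u \<times> 'u) set" where
  "kernel f X = {(u, v). u \<in> hom C G X \<and> v \<in> hom C G X \<and> f \<cdot> u = f \<cdot> v}"

lemma kernel_iff: "(u, v) \<in> kernel f X \<longleftrightarrow> u \<in> hom C G X \<and> v \<in> hom C G X \<and> f \<cdot> u = f \<cdot> v"
  by (simp add: kernel_def)

lemma kernel_subset: "kernel f X \<subseteq> hom C G X \<times> hom C G X"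
  by (auto simp: kernel_def)

lemma small_pairs: "X \<in> Ob C \<Longrightarrow> R \<subseteq> hom C G X \<times> hom C G X \<Longrightarrow> small TYPE('u) R"
  using small_subset small_Times[OF universe small_hom[OF G_Ob] small_hom[OF G_Ob]] by blast

lemma quotient_exists:
  assumes X: "X \<in> Ob C" and R: "R \<subseteq> hom C G X \<times> hom C G X"
  obtains q Q where "is_coeq R q" "q \<in> hom C X Q" "extremal_epi C q"
proof -
  have p: "\<exists>S. u \<in> hom C S X \<and> v \<in> hom C S X" if "(u, v) \<in> R" for u v using that R by blast
  obtain q Q where q: "is_coeq R q" "q \<in> hom C X Q"
    using coeq_exists[OF X small_pairs[OF X R] p] by blast
  show ?thesis by (rule that[OF q coeq_extremal[OF q p]])
qed

text \<open>
  One quotient is enough: two elements of \<open>M\<close> with the same image in \<open>Y\<close> lift to elements of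
  \<open>X\<close>, because \<open>G\<close> is extremal projective, and those form one of the pairs that have been
  identified.
\<close>

lemma image_factorisation_coeq:
  assumes f: "f \<in> hom C X Y"
  obtains M q m where "q \<in> hom C X M" "m \<in> hom C M Y" "m \<cdot> q = f" "is_coeq (kernel f X) q"
    "extremal_epi C q" "monic C m"
proof -
  obtain q M where q: "is_coeq (kernel f X) q" "q \<in> hom C X M" "extremal_epi C q"
    using quotient_exists[OF hom_Ob(1)[OF f] kernel_subset] by blast
  obtain m where m: "m \<in> hom C M Y" "m \<cdot> q = f"
    using coeq_factor[OF q(1,2) f] unfolding kernel_def by blast
  have "monic C m"
  proof (rule monic_elementwise[OF m(1)])
    fix x y assume x: "x \<in> hom C G M" and y: "y \<in> hom C G M" and e: "m \<cdot> x = m \<cdot> y"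
    obtain u where u: "u \<in> hom C G X" "q \<cdot> u = x" by (rule extremal_lift[OF q(3,2) x])
    obtain v where v: "v \<in> hom C G X" "q \<cdot> v = y" by (rule extremal_lift[OF q(3,2) y])
    have "(u, v) \<in> kernel f X"
      unfolding kernel_def using u v e m(2) assoc[OF u(1) q(2) m(1)] assoc[OF v(1) q(2) m(1)] by simp
    then show "x = y" using q(1) u(2) v(2) unfolding is_coeq_def by blast
  qed
  with q m show ?thesis using that by blast
qed

lemma image_factorisation:
  assumes f: "f \<in> hom C X Y"
  obtains M q m where "q \<in> hom C X M" "m \<in> hom C M Y" "m \<cdot> q = f" "extremal_epi C q" "monic C m"
  using image_factorisation_coeq[OF f] by blast

text \<open>
  An extremal epimorphism is the quotient by its own kernel, since the monomorphism of its image
  factorisation is invertible.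
\<close>

lemma extremal_descent:
  assumes e: "extremal_epi C e" "e \<in> hom C X Y" and a: "a \<in> hom C X Z"
    and k: "\<And>u v. u \<in> hom C G X \<Longrightarrow> v \<in> hom C G X \<Longrightarrow> e \<cdot> u = e \<cdot> v \<Longrightarrow> a \<cdot> u = a \<cdot> v"
  obtains d where "d \<in> hom C Y Z" "d \<cdot> e = a"
proof -
  obtain M q m where q: "q \<in> hom C X M" and m: "m \<in> hom C M Y" "m \<cdot> q = e"
    and qc: "is_coeq (kernel e X) q" and mm: "monic C m"
    using image_factorisation_coeq[OF e(2)] by blast
  have "isomorphism C m" using extremalD[OF _ mm m(1) q] e(1) m(2) by simp
  then obtain n where n: "n \<in> hom C Y M" "n \<cdot> m = Id C M" using isomorphismE m(1) by blast
  obtain b where b: "b \<in> hom C M Z" "b \<cdot> q = a"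
    using coeq_factor[OF qc q a] k unfolding kernel_def by blast
  have "n \<cdot> e = q" using assoc[OF q m(1) n(1)] n(2) m(2) Id_comp[OF q] by simp
  then have "(b \<cdot> n) \<cdot> e = a" using assoc[OF e(2) n(1) b(1)] b(2) by simp
  then show ?thesis using that comp_hom[OF n(1) b(1)] by blast
qed

text \<open>
  The arrow \<open>a\<close> identifies the elements that \<open>e\<close> identifies, because \<open>m\<close> can be cancelled.
\<close>

lemma fill_in:
  assumes e: "extremal_epi C e" "e \<in> hom C X Y" and m: "monic C m" "m \<in> hom C A B"
    and a: "a \<in> hom C X A" and b: "b \<in> hom C Y B" and c: "m \<cdot> a = b \<cdot> e"
  obtains d where "d \<in> hom C Y A" "d \<cdot> e = a" "m \<cdot> d = b"
proof -
  have "a \<cdot> u = a \<cdot> v" if u: "u \<in> hom C G X" and v: "v \<in> hom C G X" and uv: "e \<cdot> u = e \<cdot> v" for u v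
  proof (rule monicD[OF m comp_hom[OF u a] comp_hom[OF v a]])
    have "(m \<cdot> a) \<cdot> u = (m \<cdot> a) \<cdot> v" using assoc[OF u e(2) b] assoc[OF v e(2) b] uv c by simp
    then show "m \<cdot> a \<cdot> u = m \<cdot> a \<cdot> v" using assoc[OF u a m(2)] assoc[OF v a m(2)] by simp
  qed
  then obtain d where d: "d \<in> hom C Y A" "d \<cdot> e = a" using extremal_descent[OF e a] by blast
  have "(m \<cdot> d) \<cdot> e = b \<cdot> e" using assoc[OF e(2) d(1) m(2)] d(2) c by simp
  then have "m \<cdot> d = b" by (rule epicD[OF extremal_epic[OF e(1)] e(2) comp_hom[OF d(1) m(2)] b])
  with d show ?thesis by (rule that)
qed

text \<open>
  Binary coproducts here, and cokernel pairs below, are specified by the existence and the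
  uniqueness of induced arrows, the only form in which they are used.
\<close>

definition is_sum :: "'o \<Rightarrow> 'o \<Rightarrow> 'o \<Rightarrow> 'u \<Rightarrow> 'u \<Rightarrow> bool" where
  "is_sum A B S i j \<longleftrightarrow> i \<in> hom C A S \<and> j \<in> hom C B S \<and>
     (\<forall>Y a b. a \<in> hom C A Y \<longrightarrow> b \<in> hom C B Y \<longrightarrow> (\<exists>h\<in>hom C S Y. h \<cdot> i = a \<and> h \<cdot> j = b)) \<and>
     (\<forall>Y h k. h \<in> hom C S Y \<longrightarrow> k \<in> hom C S Y \<longrightarrow> h \<cdot> i = k \<cdot> i \<longrightarrow> h \<cdot> j = k \<cdot> j \<longrightarrow> h = k)"

lemma sum_hom: "is_sum A B S i j \<Longrightarrow> i \<in> hom C A S" "is_sum A B S i j \<Longrightarrow> j \<in> hom C B S"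
  by (simp_all add: is_sum_def)

lemma sum_copair:
  assumes "is_sum A B S i j" "a \<in> hom C A Y" "b \<in> hom C B Y"
  obtains h where "h \<in> hom C S Y" "h \<cdot> i = a" "h \<cdot> j = b"
  using assms unfolding is_sum_def by meson

lemma sum_eqI:
  assumes "is_sum A B S i j" "h \<in> hom C S Y" "k \<in> hom C S Y" "h \<cdot> i = k \<cdot> i" "h \<cdot> j = k \<cdot> j"
  shows "h = k"
  using assms unfolding is_sum_def by meson

lemma sum_exists:
  assumes A: "A \<in> Ob C" and B: "B \<in> Ob C"
  obtains S i j where "is_sum A B S i j"
proof -
  have "(if t then A else B) \<in> Ob C" for t using A B by simp
  then obtain S \<iota> where S: "is_coprod (UNIV :: bool set) (\<lambda>t. if t then A else B) S \<iota>"
    using coprod_exists[OF small_finite[OF universe finite[of "UNIV :: bool set"]], of "\<lambda>t. if t then A else B"] by blast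
  have "is_sum A B S (\<iota> True) (\<iota> False)"
    unfolding is_sum_def
  proof (intro conjI allI impI)
    show "\<iota> True \<in> hom C A S" "\<iota> False \<in> hom C B S"
      using coprod_hom[OF S, of True] coprod_hom[OF S, of False] by simp_all
    show "\<exists>h\<in>hom C S Y. h \<cdot> \<iota> True = a \<and> h \<cdot> \<iota> False = b"
      if a: "a \<in> hom C A Y" and b: "b \<in> hom C B Y" for Y a b
    proof -
      have "\<exists>!h. h \<in> hom C S Y \<and> (\<forall>t\<in>UNIV. h \<cdot> \<iota> t = (if t then a else b))"
        by (rule coprod_ex1[OF S hom_Ob(2)[OF a]]) (use a b in simp)
      then obtain h where h: "h \<in> hom C S Y" "\<forall>t\<in>UNIV. h \<cdot> \<iota> t = (if t then a else b)" by blast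
      have "h \<cdot> \<iota> True = a \<and> h \<cdot> \<iota> False = b"
        using bspec[OF h(2), of True] bspec[OF h(2), of False] by simp
      then show ?thesis using h(1) by blast
    qed
    show "h = k" if "h \<in> hom C S Y" "k \<in> hom C S Y" "h \<cdot> \<iota> True = k \<cdot> \<iota> True" "h \<cdot> \<iota> False = k \<cdot> \<iota> False" for Y h k
    proof (rule coprod_eqI[OF S that(1,2)])
      show "h \<cdot> \<iota> t = k \<cdot> \<iota> t" for t using that(3,4) by (cases t) simp_all
    qed
  qed
  then show ?thesis by (rule that)
qed

text \<open>
  The arrows \<open>a\<close> and \<open>h\<close> are jointly extremal epic; \<open>M\<close> plays the role of the subobject
  generated by the images of \<open>X\<close> and \<open>K\<close>.
\<close>

definition joint_cover :: "'o \<Rightarrow> 'o \<Rightarrow> 'o \<Rightarrow> 'u \<Rightarrow> 'u \<Rightarrow> bool" where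
  "joint_cover X K M a h \<longleftrightarrow> a \<in> hom C X M \<and> h \<in> hom C K M \<and>
     (\<exists>S i j c. is_sum X K S i j \<and> c \<in> hom C S M \<and> extremal_epi C c \<and> c \<cdot> i = a \<and> c \<cdot> j = h)"

lemma joint_cover_hom: "joint_cover X K M a h \<Longrightarrow> a \<in> hom C X M" "joint_cover X K M a h \<Longrightarrow> h \<in> hom C K M"
  by (simp_all add: joint_cover_def)

lemma joint_cover_epic:
  assumes M: "joint_cover X K M a h" and x: "x \<in> hom C M Z" and y: "y \<in> hom C M Z"
    and e: "x \<cdot> a = y \<cdot> a" "x \<cdot> h = y \<cdot> h"
  shows "x = y"
proof -
  obtain S i j c where S: "is_sum X K S i j" and c: "c \<in> hom C S M" "extremal_epi C c" "c \<cdot> i = a" "c \<cdot> j = h"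
    using M unfolding joint_cover_def by blast
  note ij = sum_hom[OF S]
  have "x \<cdot> c = y \<cdot> c"
    by (rule sum_eqI[OF S comp_hom[OF c(1) x] comp_hom[OF c(1) y]])
      (use e c(3,4) assoc[OF ij(1) c(1) x] assoc[OF ij(1) c(1) y] assoc[OF ij(2) c(1) x] assoc[OF ij(2) c(1) y] in simp_all)
  then show ?thesis by (rule epicD[OF extremal_epic[OF c(2)] c(1) x y])
qed

lemma joint_cover_fill_in:
  assumes M: "joint_cover X K M a h" and n: "monic C n" "n \<in> hom C M' B" and g: "g \<in> hom C M B"
    and x: "x \<in> hom C X M'" and k: "k \<in> hom C K M'" and e: "n \<cdot> x = g \<cdot> a" "n \<cdot> k = g \<cdot> h"
  shows "\<exists>d\<in>hom C M M'. n \<cdot> d = g"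
proof -
  obtain S i j c where S: "is_sum X K S i j" and c: "c \<in> hom C S M" "extremal_epi C c" "c \<cdot> i = a" "c \<cdot> j = h"
    using M unfolding joint_cover_def by blast
  note ij = sum_hom[OF S]
  obtain t where t: "t \<in> hom C S M'" "t \<cdot> i = x" "t \<cdot> j = k" by (rule sum_copair[OF S x k])
  have "n \<cdot> t = g \<cdot> c"
    by (rule sum_eqI[OF S comp_hom[OF t(1) n(2)] comp_hom[OF c(1) g]])
      (use e c(3,4) t(2,3) assoc[OF ij(1) t(1) n(2)] assoc[OF ij(1) c(1) g] assoc[OF ij(2) t(1) n(2)] assoc[OF ij(2) c(1) g] in simp_all)
  then show ?thesis using fill_in[OF c(2,1) n t(1) g] by blast
qed

lemma joint_image:
  assumes x: "x \<in> hom C X B" and k: "k \<in> hom C K B"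
  shows "\<exists>M n a h. joint_cover X K M a h \<and> n \<in> hom C M B \<and> monic C n \<and> n \<cdot> a = x \<and> n \<cdot> h = k"
proof -
  obtain S i j where S: "is_sum X K S i j" by (rule sum_exists[OF hom_Ob(1)[OF x] hom_Ob(1)[OF k]])
  note ij = sum_hom[OF S]
  obtain t where t: "t \<in> hom C S B" "t \<cdot> i = x" "t \<cdot> j = k" by (rule sum_copair[OF S x k])
  obtain M c n where c: "c \<in> hom C S M" and n: "n \<in> hom C M B" "n \<cdot> c = t" and m: "extremal_epi C c" "monic C n"
    by (rule image_factorisation[OF t(1)])
  have "joint_cover X K M (c \<cdot> i) (c \<cdot> j)"
    unfolding joint_cover_def using comp_hom[OF ij(1) c] comp_hom[OF ij(2) c] S c m(1) by blast
  moreover have "n \<cdot> c \<cdot> i = x" "n \<cdot> c \<cdot> j = k" using assoc[OF ij(1) c n(1)] assoc[OF ij(2) c n(1)] n(2) t(2,3) by simp_all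
  ultimately show ?thesis using n(1) m(2) by blast
qed

definition is_cokernel_pair :: "'u \<Rightarrow> 'o \<Rightarrow> 'u \<Rightarrow> 'u \<Rightarrow> bool" where
  "is_cokernel_pair f P i j \<longleftrightarrow> i \<in> hom C (Cod C f) P \<and> j \<in> hom C (Cod C f) P \<and> i \<cdot> f = j \<cdot> f \<and>
     (\<forall>Z s t. s \<in> hom C (Cod C f) Z \<longrightarrow> t \<in> hom C (Cod C f) Z \<longrightarrow> s \<cdot> f = t \<cdot> f \<longrightarrow>
        (\<exists>h\<in>hom C P Z. h \<cdot> i = s \<and> h \<cdot> j = t)) \<and>
     (\<forall>Z h k. h \<in> hom C P Z \<longrightarrow> k \<in> hom C P Z \<longrightarrow> h \<cdot> i = k \<cdot> i \<longrightarrow> h \<cdot> j = k \<cdot> j \<longrightarrow> h = k)"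

lemma cokernel_pair_hom:
  assumes "is_cokernel_pair f P i j" "f \<in> hom C A B"
  shows "i \<in> hom C B P" "j \<in> hom C B P" "i \<cdot> f = j \<cdot> f"
  using assms by (simp_all add: is_cokernel_pair_def hom_iff)

lemma cokernel_pair_copair:
  assumes "is_cokernel_pair f P i j" "f \<in> hom C A B" "s \<in> hom C B Z" "t \<in> hom C B Z" "s \<cdot> f = t \<cdot> f"
  obtains h where "h \<in> hom C P Z" "h \<cdot> i = s" "h \<cdot> j = t"
proof -
  have "Cod C f = B" using assms(2) by (simp add: hom_iff)
  then show ?thesis using assms(1,3-5) that unfolding is_cokernel_pair_def by meson
qed

lemma cokernel_pair_eqI:
  assumes "is_cokernel_pair f P i j" "h \<in> hom C P Z" "k \<in> hom C P Z" "h \<cdot> i = k \<cdot> i" "h \<cdot> j = k \<cdot> j"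
  shows "h = k"
  using assms unfolding is_cokernel_pair_def by meson

text \<open>
  Both coprojections are split by the codiagonal.
\<close>

lemma cokernel_pair_monic:
  assumes P: "is_cokernel_pair f P i j" and f: "f \<in> hom C A B"
  shows "monic C i" "monic C j"
proof -
  have I: "Id C B \<in> hom C B B" by (rule Id_hom[OF hom_Ob(2)[OF f]])
  obtain d where d: "d \<in> hom C P B" "d \<cdot> i = Id C B" "d \<cdot> j = Id C B"
    using cokernel_pair_copair[OF P f I I] by blast
  show "monic C i" "monic C j"
    using split_monic[OF _ d(1,2)] split_monic[OF _ d(1,3)] cokernel_pair_hom[OF P f] by simp_all
qed

lemma cokernel_pair_exists:
  assumes f: "f \<in> hom C A B"
  obtains P i j where "is_cokernel_pair f P i j"
proof -
  have B: "B \<in> Ob C" by (rule hom_Ob(2)[OF f])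
  obtain S i j where S: "is_sum B B S i j" by (rule sum_exists[OF B B])
  note i = sum_hom(1)[OF S] and j = sum_hom(2)[OF S]
  have fi: "i \<cdot> f \<in> hom C A S" and fj: "j \<cdot> f \<in> hom C A S" using comp_hom[OF f] i j by blast+
  let ?R = "{(i \<cdot> f, j \<cdot> f)}"
  obtain q P where q: "is_coeq ?R q" "q \<in> hom C S P"
    using coeq_exists[OF hom_Ob(2)[OF i] small_finite[OF universe, of ?R]] fi fj by blast
  have ep: "epic C q" by (rule coeq_epic[OF q(1)]) (use fi fj q(2) in \<open>auto simp: hom_iff[of q]\<close>)
  have qi: "q \<cdot> i \<in> hom C B P" and qj: "q \<cdot> j \<in> hom C B P" using comp_hom q(2) i j by blast+
  have qf: "(q \<cdot> i) \<cdot> f = (q \<cdot> j) \<cdot> f"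
    using q(1) assoc[OF f i q(2)] assoc[OF f j q(2)] by (simp add: is_coeq_def)
  have ex': "\<exists>h\<in>hom C P Z. h \<cdot> q \<cdot> i = s \<and> h \<cdot> q \<cdot> j = t"
    if s: "s \<in> hom C B Z" and t: "t \<in> hom C B Z" and st: "s \<cdot> f = t \<cdot> f" for Z s t
  proof -
    obtain h where h: "h \<in> hom C S Z" "h \<cdot> i = s" "h \<cdot> j = t" by (rule sum_copair[OF S s t])
    have "h \<cdot> i \<cdot> f = h \<cdot> j \<cdot> f" using assoc[OF f i h(1)] assoc[OF f j h(1)] h st by simp
    then obtain k where k: "k \<in> hom C P Z" "k \<cdot> q = h" using coeq_factor[OF q h(1)] by blast
    then show ?thesis using assoc[OF i q(2) k(1)] assoc[OF j q(2) k(1)] h by auto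
  qed
  have un': "h = k" if h: "h \<in> hom C P Z" and k: "k \<in> hom C P Z"
    and e: "h \<cdot> q \<cdot> i = k \<cdot> q \<cdot> i" "h \<cdot> q \<cdot> j = k \<cdot> q \<cdot> j" for Z h k
  proof -
    have "h \<cdot> q = k \<cdot> q"
      by (rule sum_eqI[OF S comp_hom[OF q(2) h] comp_hom[OF q(2) k]])
        (use e assoc[OF i q(2) h] assoc[OF j q(2) h] assoc[OF i q(2) k] assoc[OF j q(2) k] in simp_all)
    then show ?thesis by (rule epicD[OF ep q(2) h k])
  qed
  have "Cod C f = B" using f by (simp add: hom_iff)
  then have "is_cokernel_pair f P (q \<cdot> i) (q \<cdot> j)"
    unfolding is_cokernel_pair_def using qi qj qf ex' un' by simp
  then show ?thesis by (rule that)
qed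

end

section \<open>Amalgamation and epimorphisms\<close>

context projectively_generated_cat
begin

text \<open>
  Two uses of amalgamation: \<open>e\<close> is first amalgamated with \<open>i\<close>, and then with the arrow that \<open>j\<close>
  becomes in the resulting object.
\<close>

lemma amalgamate_pair:
  assumes AP: "amalgamation_property C" and e: "monic C e" "e \<in> hom C E B"
    and i: "monic C i" "i \<in> hom C E P" and j: "monic C j" "j \<in> hom C E P"
  obtains Z s t c where "s \<in> hom C B Z" "t \<in> hom C B Z" "c \<in> hom C P Z" "monic C c"
    "s \<cdot> e = c \<cdot> i" "t \<cdot> e = c \<cdot> j"
proof -
  have am: "\<exists>Y g d. monic C g \<and> d \<in> hom C B Y \<and> g \<in> hom C Q Y \<and> d \<cdot> e = g \<cdot> b"
    if b: "monic C b" "b \<in> hom C E Q" for b Q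
  proof -
    have "Dom C e = Dom C b" using e b by (simp add: hom_iff)
    then obtain g d where gd: "monic C g" "monic C d" "Dom C d = Cod C e" "Dom C g = Cod C b"
      "Cod C d = Cod C g" "d \<cdot> e = g \<cdot> b"
      using AP e b unfolding amalgamation_property_def by blast
    have "d \<in> hom C B (Cod C g)" "g \<in> hom C Q (Cod C g)"
      using gd e b by (simp_all add: hom_iff monic_def)
    with gd show ?thesis by blast
  qed
  obtain Y g d where Y: "monic C g" "d \<in> hom C B Y" "g \<in> hom C P Y" "d \<cdot> e = g \<cdot> i" using am[OF i] by blast
  obtain Z g' d' where Z: "monic C g'" "d' \<in> hom C B Z" "g' \<in> hom C Y Z" "d' \<cdot> e = g' \<cdot> g \<cdot> j"
    using am[OF comp_monic[OF j Y(1,3)] comp_hom[OF j(2) Y(3)]] by blast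
  show ?thesis
  proof (rule that[OF comp_hom[OF Y(2) Z(3)] Z(2) comp_hom[OF Y(3) Z(3)] comp_monic[OF Y(1,3) Z(1,3)]])
    show "(g' \<cdot> d) \<cdot> e = (g' \<cdot> g) \<cdot> i" using assoc[OF e(2) Y(2) Z(3)] assoc[OF i(2) Y(3) Z(3)] Y(4) by simp
    show "d' \<cdot> e = (g' \<cdot> g) \<cdot> j" using Z(4) assoc[OF j(2) Y(3) Z(3)] by simp
  qed
qed

text \<open>
  Dominions do not depend on the ambient object. Let \<open>E\<close> be generated by \<open>A\<close> and \<open>T\<close>, where \<open>T\<close>
  lies in the dominion of \<open>A\<close> in the larger object \<open>B\<close>. The coprojections \<open>i\<close> and \<open>j\<close> of the
  cokernel pair of \<open>A \<rightarrow> E\<close> extend to \<open>B\<close> by amalgamation; the extensions agree on \<open>A\<close>, hence on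
  \<open>T\<close>, and so \<open>i = j\<close>.
\<close>

lemma epic_into_dominion:
  assumes AP: "amalgamation_property C" and e: "monic C e" "e \<in> hom C E B"
    and a: "a \<in> hom C A E" and h: "h \<in> hom C T E"
    and joint: "\<And>Z x y. x \<in> hom C E Z \<Longrightarrow> y \<in> hom C E Z \<Longrightarrow> x \<cdot> a = y \<cdot> a \<Longrightarrow> x \<cdot> h = y \<cdot> h \<Longrightarrow> x = y"
    and dom: "\<And>Z s t. s \<in> hom C B Z \<Longrightarrow> t \<in> hom C B Z \<Longrightarrow> s \<cdot> e \<cdot> a = t \<cdot> e \<cdot> a \<Longrightarrow> s \<cdot> e \<cdot> h = t \<cdot> e \<cdot> h"
  shows "epic C a"
proof -
  obtain P i j where P: "is_cokernel_pair a P i j" by (rule cokernel_pair_exists[OF a])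
  note ij = cokernel_pair_hom[OF P a]
  obtain Z s t c where Z: "s \<in> hom C B Z" "t \<in> hom C B Z" "c \<in> hom C P Z" "monic C c"
    and st: "s \<cdot> e = c \<cdot> i" "t \<cdot> e = c \<cdot> j"
    by (rule amalgamate_pair[OF AP e cokernel_pair_monic(1)[OF P a] ij(1) cokernel_pair_monic(2)[OF P a] ij(2)])
  have s: "s \<cdot> e \<cdot> x = c \<cdot> i \<cdot> x" and t: "t \<cdot> e \<cdot> x = c \<cdot> j \<cdot> x" if x: "x \<in> hom C X E" for x X
    using assoc[OF x e(2) Z(1)] assoc[OF x e(2) Z(2)] assoc[OF x ij(1) Z(3)] assoc[OF x ij(2) Z(3)] st
    by simp_all
  have "c \<cdot> i \<cdot> h = c \<cdot> j \<cdot> h" using dom[OF Z(1,2)] s[OF a] t[OF a] s[OF h] t[OF h] ij(3) by simp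
  then have "i \<cdot> h = j \<cdot> h" by (rule monicD[OF Z(4,3) comp_hom[OF h ij(1)] comp_hom[OF h ij(2)]])
  then have eq: "i = j" by (rule joint[OF ij])
  show ?thesis
  proof (rule epicI[OF a])
    fix X f g assume f: "f \<in> hom C E X" and g: "g \<in> hom C E X" and fg: "f \<cdot> a = g \<cdot> a"
    show "f = g" by (rule cokernel_pair_copair[OF P a f g fg]) (simp add: eq)
  qed
qed

text \<open>
  A monomorphism \<open>m\<close> is the equaliser of its own cokernel pair. If \<open>h\<close> equalises that pair then
  it lies in the dominion of \<open>m\<close>, so \<open>m\<close> is epic in the subobject generated by \<open>m\<close> and \<open>h\<close>; by
  ES it is all of that subobject, and \<open>h\<close> factors through it.
\<close>

lemma ES_imp_SES:
  assumes AP: "amalgamation_property C" and ES: "ES C"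
  shows "SES C"
  unfolding SES_def
proof (intro allI impI)
  fix m assume m: "monic C m"
  then have mh: "m \<in> hom C (Dom C m) (Cod C m)" by (simp add: monic_def hom_iff)
  obtain P p q where P: "is_cokernel_pair m P p q" by (rule cokernel_pair_exists[OF mh])
  note pq = cokernel_pair_hom[OF P mh]
  have "is_equaliser C m p q"
    unfolding is_equaliser_def
  proof (intro conjI ballI impI)
    show "m \<in> Ar C" "p \<in> Ar C" "q \<in> Ar C" "Dom C p = Cod C m" "Dom C q = Cod C m" "Cod C p = Cod C q"
      "p \<cdot> m = q \<cdot> m" using mh pq by (simp_all add: hom_iff)
    fix h assume "h \<in> Ar C" "Cod C h = Cod C m" and ph: "p \<cdot> h = q \<cdot> h"
    then have h: "h \<in> hom C (Dom C h) (Cod C m)" by (simp add: hom_iff)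
    obtain E e a t where E: "joint_cover (Dom C m) (Dom C h) E a t" and e: "e \<in> hom C E (Cod C m)" "monic C e"
      and ea: "e \<cdot> a = m" and et: "e \<cdot> t = h" using joint_image[OF mh h] by blast
    note a = joint_cover_hom(1)[OF E] and t = joint_cover_hom(2)[OF E]
    have "epic C a"
    proof (rule epic_into_dominion[OF AP e(2,1) a t joint_cover_epic[OF E]])
      fix Z x y assume x: "x \<in> hom C (Cod C m) Z" and y: "y \<in> hom C (Cod C m) Z" and "x \<cdot> e \<cdot> a = y \<cdot> e \<cdot> a"
      then have "x \<cdot> m = y \<cdot> m" by (simp add: ea)
      then obtain k where k: "k \<in> hom C P Z" "k \<cdot> p = x" "k \<cdot> q = y" using cokernel_pair_copair[OF P mh x y] by blast
      have "x \<cdot> h = y \<cdot> h" using assoc[OF h pq(1) k(1)] assoc[OF h pq(2) k(1)] k(2,3) ph by simp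
      then show "x \<cdot> e \<cdot> t = y \<cdot> e \<cdot> t" by (simp add: et)
    qed
    then have "extremal_epi C a" using ES by (simp add: ES_def)
    moreover have "monic C a" by (rule monic_cancel[OF a e(1)]) (simp add: ea m)
    ultimately have "isomorphism C a" by (rule extremal_monic_iso)
    then obtain n where n: "n \<in> hom C E (Dom C m)" "a \<cdot> n = Id C E" using isomorphismE a by blast
    have k: "n \<cdot> t \<in> hom C (Dom C h) (Dom C m)" by (rule comp_hom[OF t n(1)])
    have "m \<cdot> n \<cdot> t = e \<cdot> a \<cdot> n \<cdot> t" using assoc[OF k a e(1)] ea by simp
    also have "a \<cdot> n \<cdot> t = t" using assoc[OF t n(1) a] n(2) Id_comp[OF t] by simp
    finally have "m \<cdot> n \<cdot> t = h" using et by simp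
    then show "\<exists>!k. k \<in> hom C (Dom C h) (Dom C m) \<and> m \<cdot> k = h"
      using k monicD[OF m mh] by metis
  qed
  then show "regular_mono C m" unfolding regular_mono_def by blast
qed

text \<open>
  An epic equaliser equalises two equal arrows.
\<close>

lemma SES_imp_ES:
  assumes SES: "SES C"
  shows "ES C"
proof (rule ES_I)
  fix m A B assume mh: "m \<in> hom C A B" and m: "monic C m" and e: "epic C m"
  obtain p q where pq: "is_equaliser C m p q" using SES m unfolding SES_def regular_mono_def by blast
  have d: "Dom C m = A" "Cod C m = B" using mh by (simp_all add: hom_iff)
  have p: "p \<in> hom C B (Cod C p)" and q: "q \<in> hom C B (Cod C p)" and pm: "p \<cdot> m = q \<cdot> m"
    using pq d unfolding is_equaliser_def by (simp_all add: hom_iff)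
  have "p = q" by (rule epicD[OF e mh p q pm])
  have "\<forall>h\<in>Ar C. Cod C h = B \<longrightarrow> p \<cdot> h = q \<cdot> h \<longrightarrow> (\<exists>!k. k \<in> hom C (Dom C h) A \<and> m \<cdot> k = h)"
    using pq unfolding is_equaliser_def d by (elim conjE)
  moreover have "Id C B \<in> Ar C" "Cod C (Id C B) = B" "Dom C (Id C B) = B"
    using Id_hom[OF hom_Ob(2)[OF mh]] by (simp_all add: hom_iff)
  ultimately have "\<exists>!k. k \<in> hom C B A \<and> m \<cdot> k = Id C B" using \<open>p = q\<close> by metis
  then show "isomorphism C m" using split_epi_monic_iso[OF m mh] by blast
qed

lemma ES_imp_WES: "ES C \<Longrightarrow> WES C"
  unfolding ES_def WES_def by blast

end

section \<open>Directed colimits and finitely generated objects\<close>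

lemma poset_cat_simps [simp]:
  "Ob (poset_cat I r) = I" "Ar (poset_cat I r) = r" "Dom (poset_cat I r) = fst" "Cod (poset_cat I r) = snd"
  by (simp_all add: poset_cat_def)

lemma poset_category:
  assumes "partial_order_on I r"
  shows "category (poset_cat I r)"
proof -
  have r: "refl_on I r" "trans r" "r \<subseteq> I \<times> I" using partial_order_onD[OF assms] by blast+
  show ?thesis
    unfolding category_def hom_def using r by (auto simp: poset_cat_def refl_on_def dest: transD)
qed

context cat
begin

lemma colimit_hom:
  "is_colimit J C F L \<iota> \<Longrightarrow> j \<in> Ob J \<Longrightarrow> \<iota> j \<in> hom C (fob F j) L"
  unfolding is_colimit_def is_cocone_def by blast

lemma colimit_comm:
  "is_colimit J C F L \<iota> \<Longrightarrow> u \<in> Ar J \<Longrightarrow> \<iota> (Cod J u) \<cdot> far F u = \<iota> (Dom J u)"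
  unfolding is_colimit_def is_cocone_def by blast

lemma colimit_eqI:
  assumes F: "is_functor J C F" and L: "is_colimit J C F L \<iota>" and f: "f \<in> hom C L Y" and g: "g \<in> hom C L Y"
    and e: "\<And>j. j \<in> Ob J \<Longrightarrow> f \<cdot> \<iota> j = g \<cdot> \<iota> j"
  shows "f = g"
proof -
  have "is_cocone J C F Y (\<lambda>j. f \<cdot> \<iota> j)"
    unfolding is_cocone_def
  proof (intro conjI ballI)
    show "Y \<in> Ob C" by (rule hom_Ob(2)[OF f])
    show "f \<cdot> \<iota> j \<in> hom C (fob F j) Y" if "j \<in> Ob J" for j by (rule comp_hom[OF colimit_hom[OF L that] f])
    fix u assume u: "u \<in> Ar J"
    have J: "category J" by (rule functorD(1)[OF F])
    have "Cod J u \<in> Ob J" using cat.Ar_Ob(2)[OF cat.intro[OF J] u] .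
    then show "(f \<cdot> \<iota> (Cod J u)) \<cdot> far F u = f \<cdot> \<iota> (Dom J u)"
      using assoc[OF functorD(3)[OF F u] colimit_hom[OF L] f] colimit_comm[OF L u] by simp
  qed
  then have "\<exists>!h. h \<in> hom C L Y \<and> (\<forall>j\<in>Ob J. h \<cdot> \<iota> j = f \<cdot> \<iota> j)" using L unfolding is_colimit_def by blast
  then show ?thesis using f g e by metis
qed

lemma poset_functorI:
  assumes r: "partial_order_on I r" and M: "\<And>i. i \<in> I \<Longrightarrow> M i \<in> Ob C"
    and f: "\<And>i j. (i, j) \<in> r \<Longrightarrow> f (i, j) \<in> hom C (M i) (M j)"
    and Id: "\<And>i. i \<in> I \<Longrightarrow> f (i, i) = Id C (M i)"
    and comp: "\<And>i j k. (i, j) \<in> r \<Longrightarrow> (j, k) \<in> r \<Longrightarrow> f (i, k) = f (j, k) \<cdot> f (i, j)"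
  shows "is_functor (poset_cat I r) C \<lparr>fob = M, far = f\<rparr>"
  unfolding is_functor_def
proof (intro conjI ballI impI)
  let ?J = "poset_cat I r" and ?F = "\<lparr>fob = M, far = f\<rparr>"
  show "category ?J" by (rule poset_category[OF r])
  show "category C" by (rule category)
  show "fob ?F i \<in> Ob C" if "i \<in> Ob ?J" for i using M that by simp
  show "far ?F u \<in> hom C (fob ?F (Dom ?J u)) (fob ?F (Cod ?J u))" if "u \<in> Ar ?J" for u
    using f[of "fst u" "snd u"] that by simp
  show "far ?F (Id ?J i) = Id C (fob ?F i)" if "i \<in> Ob ?J" for i using Id that by (simp add: poset_cat_def)
  fix u v assume t: "u \<in> Ar ?J" "v \<in> Ar ?J" "Cod ?J u = Dom ?J v"
  obtain i j k where uv: "u = (i, j)" "v = (j, k)" using t(3) by (cases u; cases v) auto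
  show "far ?F (Comp ?J v u) = far ?F v \<cdot> far ?F u"
    using comp[of i j k] t uv by (simp add: poset_cat_def)
qed

lemma poset_colimit_desc:
  assumes L: "is_colimit (poset_cat I r) C F L \<iota>" and K: "is_cocone (poset_cat I r) C F Y \<kappa>"
  shows "\<exists>h\<in>hom C L Y. \<forall>i\<in>I. h \<cdot> \<iota> i = \<kappa> i"
  using L K unfolding is_colimit_def poset_cat_simps by blast

lemma poset_colimit_hom: "is_colimit (poset_cat I r) C F L \<iota> \<Longrightarrow> i \<in> I \<Longrightarrow> \<iota> i \<in> hom C (fob F i) L"
  using colimit_hom[of "poset_cat I r"] by simp

lemma poset_colimit_comm: "is_colimit (poset_cat I r) C F L \<iota> \<Longrightarrow> (i, j) \<in> r \<Longrightarrow> \<iota> j \<cdot> far F (i, j) = \<iota> i"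
  using colimit_comm[of "poset_cat I r" F L \<iota> "(i, j)"] by simp

lemma poset_coconeI:
  assumes "Y \<in> Ob C" "\<And>i. i \<in> I \<Longrightarrow> \<kappa> i \<in> hom C (fob F i) Y" "\<And>i j. (i, j) \<in> r \<Longrightarrow> \<kappa> j \<cdot> far F (i, j) = \<kappa> i"
  shows "is_cocone (poset_cat I r) C F Y \<kappa>"
proof -
  have "\<kappa> (snd u) \<cdot> far F u = \<kappa> (fst u)" if "u \<in> r" for u using assms(3)[of "fst u" "snd u"] that by simp
  then show ?thesis using assms(1,2) by (simp add: is_cocone_def)
qed

lemma diagram_hom:
  assumes "is_functor (poset_cat I r) C F" "(i, j) \<in> r"
  shows "far F (i, j) \<in> hom C (fob F i) (fob F j)"
  using functorD(3)[OF assms(1), of "(i, j)"] assms(2) by simp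

lemma diagram_comp:
  assumes "is_functor (poset_cat I r) C F" "(i, j) \<in> r" "(j, k) \<in> r"
  shows "far F (i, k) = far F (j, k) \<cdot> far F (i, j)"
  using functorD(5)[OF assms(1), of "(i, j)" "(j, k)"] assms(2,3) by (simp add: poset_cat_def)

end

lemma directed_diagramD:
  fixes C :: "('o, 'u) cat"
  assumes "directed_diagram C I r F"
  shows "is_functor (poset_cat I r) C F" "\<And>i. i \<in> I \<Longrightarrow> (i, i) \<in> r" "r \<subseteq> I \<times> I"
    "\<And>i j k. (i, j) \<in> r \<Longrightarrow> (j, k) \<in> r \<Longrightarrow> (i, k) \<in> r"
    "\<And>i j. i \<in> I \<Longrightarrow> j \<in> I \<Longrightarrow> \<exists>k\<in>I. (i, k) \<in> r \<and> (j, k) \<in> r" "I \<noteq> {}" "small TYPE('u) I"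
proof -
  have r: "is_functor (poset_cat I r) C F" "small TYPE('u) I" "partial_order_on I r" "I \<noteq> {}"
    "\<forall>x\<in>I. \<forall>y\<in>I. \<exists>z\<in>I. (x, z) \<in> r \<and> (y, z) \<in> r"
    using assms unfolding directed_diagram_def directed_poset_def by simp_all
  note p = partial_order_onD[OF r(3)]
  show "is_functor (poset_cat I r) C F" "small TYPE('u) I" "I \<noteq> {}" "r \<subseteq> I \<times> I" using r p by simp_all
  show "(i, i) \<in> r" if "i \<in> I" for i using refl_onD[OF p(1) that] .
  show "(i, k) \<in> r" if "(i, j) \<in> r" "(j, k) \<in> r" for i j k using transD[OF p(2) that] .
  show "\<exists>k\<in>I. (i, k) \<in> r \<and> (j, k) \<in> r" if "i \<in> I" "j \<in> I" for i j using r(5) that by blast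
qed

context projectively_generated_cat
begin

lemma hom_functor_fn: "f \<in> hom C A B \<Longrightarrow> y \<in> hom C X A \<Longrightarrow> fn (far (hom_functor C X) f) y = f \<cdot> y"
  by (simp add: hom_functor_def hom_iff)

text \<open>
  Maps from a colimit of sets to a set with two elements are the same as compatible families of
  predicates. This is all that is needed to describe a directed colimit of sets: the next two
  lemmas choose suitable predicates instead of comparing with a constructed colimit.
\<close>

lemma colimit_predicate:
  assumes X: "X \<in> Ob C" and F: "is_functor (poset_cat I r) C F" and r: "r \<subseteq> I \<times> I"
    and pres: "preserves_colimits_of (poset_cat I r) F C (set_cat TYPE('u)) (hom_functor C X)"
    and L: "is_colimit (poset_cat I r) C F L \<iota>"
    and p: "\<And>i j y. (i, j) \<in> r \<Longrightarrow> y \<in> hom C X (fob F i) \<Longrightarrow> p j (far F (i, j) \<cdot> y) \<longleftrightarrow> p i y"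
  shows "\<exists>t. \<forall>i\<in>I. \<forall>y\<in>hom C X (fob F i). t (\<iota> i \<cdot> y) \<longleftrightarrow> p i y" (is ?ex)
    and "\<And>t t'. (\<forall>i\<in>I. \<forall>y\<in>hom C X (fob F i). t (\<iota> i \<cdot> y) \<longleftrightarrow> p i y) \<Longrightarrow>
      (\<forall>i\<in>I. \<forall>y\<in>hom C X (fob F i). t' (\<iota> i \<cdot> y) \<longleftrightarrow> p i y) \<Longrightarrow> x \<in> hom C X L \<Longrightarrow> t x \<longleftrightarrow> t' x"
proof -
  let ?S = "set_cat TYPE('u) :: ('u set, 'u setarr) cat" and ?H = "hom_functor C X"
  obtain a b :: 'u where ab: "a \<noteq> b" by (rule two_points[OF universe])
  have two: "small TYPE('u) {a, b}" by (rule small_finite[OF universe]) simp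
  have LO: "L \<in> Ob C" using L unfolding is_colimit_def is_cocone_def by blast
  have FO: "fob F i \<in> Ob C" if "i \<in> I" for i using functorD(2)[OF F] that by simp
  note i = poset_colimit_hom[OF L]
  define \<chi> where "\<chi> A t = SetArr A (\<lambda>x\<in>A. if t x then a else b) {a, b}" for A and t :: "'u \<Rightarrow> bool"
  have chi: "\<chi> (hom C X A) t \<in> hom ?S (hom C X A) {a, b}" if "A \<in> Ob C" for A t
    using small_hom[OF X that] two by (auto simp: \<chi>_def set_cat_hom)
  have chi_comp: "Comp ?S (\<chi> (hom C X B) t) (far ?H f) = \<chi> (hom C X A) (\<lambda>x. t (f \<cdot> x))"
    if f: "f \<in> hom C A B" for A B f t
    using f comp_hom[OF _ f] by (auto simp: \<chi>_def set_cat_comp hom_functor_def hom_iff[of f] compose_def restrict_def fun_eq_iff)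
  have chi_eq: "\<chi> (hom C X A) t = \<chi> (hom C X A) t' \<longleftrightarrow> (\<forall>y\<in>hom C X A. t y \<longleftrightarrow> t' y)" for A t t'
  proof
    assume "\<chi> (hom C X A) t = \<chi> (hom C X A) t'"
    then have e: "fn (\<chi> (hom C X A) t) y = fn (\<chi> (hom C X A) t') y" for y by simp
    show "\<forall>y\<in>hom C X A. t y \<longleftrightarrow> t' y"
    proof
      fix y assume "y \<in> hom C X A"
      then show "t y \<longleftrightarrow> t' y" using e[of y] ab by (simp add: \<chi>_def split: if_splits)
    qed
  next
    assume "\<forall>y\<in>hom C X A. t y \<longleftrightarrow> t' y"
    then show "\<chi> (hom C X A) t = \<chi> (hom C X A) t'" unfolding \<chi>_def by (auto intro!: restrict_ext)
  qed
  have col: "is_colimit (poset_cat I r) ?S (comp_func ?H F) (hom C X L) (\<lambda>j. far ?H (\<iota> j))"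
    using pres L unfolding preserves_colimits_of_def by (simp add: hom_functor_def)
  have "is_cocone (poset_cat I r) ?S (comp_func ?H F) {a, b} (\<lambda>i. \<chi> (hom C X (fob F i)) (p i))"
    unfolding is_cocone_def
  proof (intro conjI ballI)
    show "{a, b} \<in> Ob ?S" using two by (simp add: set_cat_def)
    show "\<chi> (hom C X (fob F j)) (p j) \<in> hom ?S (fob (comp_func ?H F) j) {a, b}" if "j \<in> Ob (poset_cat I r)" for j
      using chi FO that by (simp add: comp_func_def hom_functor_def)
    fix u assume u: "u \<in> Ar (poset_cat I r)"
    then have "far F u \<in> hom C (fob F (fst u)) (fob F (snd u))" using functorD(3)[OF F u] by simp
    then have "Comp ?S (\<chi> (hom C X (fob F (snd u))) (p (snd u))) (far ?H (far F u)) =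
      \<chi> (hom C X (fob F (fst u))) (\<lambda>x. p (snd u) (far F u \<cdot> x))" by (rule chi_comp)
    also have "\<dots> = \<chi> (hom C X (fob F (fst u))) (p (fst u))"
      using p[of "fst u" "snd u"] u by (simp add: chi_eq)
    finally show "Comp ?S (\<chi> (hom C X (fob F (Cod (poset_cat I r) u))) (p (Cod (poset_cat I r) u))) (far (comp_func ?H F) u) =
      \<chi> (hom C X (fob F (Dom (poset_cat I r) u))) (p (Dom (poset_cat I r) u))" by (simp add: comp_func_def)
  qed
  then have un: "\<exists>!h. h \<in> hom ?S (hom C X L) {a, b} \<and>
      (\<forall>j\<in>I. Comp ?S h (far ?H (\<iota> j)) = \<chi> (hom C X (fob F j)) (p j))"
    using col unfolding is_colimit_def by simp
  then obtain h where h: "h \<in> hom ?S (hom C X L) {a, b}"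
    "\<And>j. j \<in> I \<Longrightarrow> Comp ?S h (far ?H (\<iota> j)) = \<chi> (hom C X (fob F j)) (p j)" by blast
  have "h = \<chi> (hom C X L) (\<lambda>x. fn h x = a)"
  proof (rule setarr_eqI[OF h(1) chi[OF LO]])
    fix x assume x: "x \<in> hom C X L"
    have "fn h x \<in> {a, b}" using h(1) x unfolding set_cat_hom by blast
    then show "fn h x = fn (\<chi> (hom C X L) (\<lambda>x. fn h x = a)) x" using x by (auto simp: \<chi>_def)
  qed
  then have "\<chi> (hom C X (fob F j)) (\<lambda>x. fn h (\<iota> j \<cdot> x) = a) = \<chi> (hom C X (fob F j)) (p j)" if "j \<in> I" for j
    using h(2)[OF that] chi_comp[OF i[OF that], of "\<lambda>x. fn h x = a"] by simp
  then show ?ex unfolding chi_eq by (intro exI[of _ "\<lambda>x. fn h x = a"]) blast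
  fix t t' x
  assume t: "\<forall>i\<in>I. \<forall>y\<in>hom C X (fob F i). t (\<iota> i \<cdot> y) \<longleftrightarrow> p i y"
    and t': "\<forall>i\<in>I. \<forall>y\<in>hom C X (fob F i). t' (\<iota> i \<cdot> y) \<longleftrightarrow> p i y" and x: "x \<in> hom C X L"
  have "Comp ?S (\<chi> (hom C X L) s) (far ?H (\<iota> j)) = \<chi> (hom C X (fob F j)) (p j)"
    if "\<forall>i\<in>I. \<forall>y\<in>hom C X (fob F i). s (\<iota> i \<cdot> y) \<longleftrightarrow> p i y" "j \<in> I" for s j
    using chi_comp[OF i[OF that(2)], of s] that chi_eq by simp
  then have "\<chi> (hom C X L) t = \<chi> (hom C X L) t'" using un chi[OF LO] t t' by metis
  then show "t x \<longleftrightarrow> t' x" using x by (simp add: chi_eq)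
qed

text \<open>
  Coming from some stage is a predicate that holds throughout every stage, so it is the
  predicate that is always true.
\<close>

lemma directed_factor:
  assumes X: "X \<in> Ob C" and D: "directed_diagram C I r F"
    and pres: "preserves_colimits_of (poset_cat I r) F C (set_cat TYPE('u)) (hom_functor C X)"
    and L: "is_colimit (poset_cat I r) C F L \<iota>" and x: "x \<in> hom C X L"
  obtains i y where "i \<in> I" "y \<in> hom C X (fob F i)" "\<iota> i \<cdot> y = x"
proof -
  have "(\<lambda>_. True) x \<longleftrightarrow> (\<lambda>x. \<exists>i\<in>I. \<exists>y\<in>hom C X (fob F i). \<iota> i \<cdot> y = x) x"
    by (rule colimit_predicate(2)[OF X directed_diagramD(1,3)[OF D] pres L, of "\<lambda>_ _. True"]) (use x in auto)
  then show ?thesis using that by blast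
qed

text \<open>
  The predicate is: becoming equal to the given \<open>y\<close> at some later stage. Directedness makes it
  compatible, so it only depends on the image in the colimit.
\<close>

lemma directed_eventually_equal:
  assumes X: "X \<in> Ob C" and D: "directed_diagram C I r F"
    and pres: "preserves_colimits_of (poset_cat I r) F C (set_cat TYPE('u)) (hom_functor C X)"
    and L: "is_colimit (poset_cat I r) C F L \<iota>"
    and i: "i \<in> I" "y \<in> hom C X (fob F i)" and j: "j \<in> I" "z \<in> hom C X (fob F j)" and e: "\<iota> i \<cdot> y = \<iota> j \<cdot> z"
  obtains k where "k \<in> I" "(i, k) \<in> r" "(j, k) \<in> r" "far F (i, k) \<cdot> y = far F (j, k) \<cdot> z"
proof -
  note d = directed_diagramD[OF D]
  define p where "p l w \<longleftrightarrow> (\<exists>k. (i, k) \<in> r \<and> (l, k) \<in> r \<and> far F (i, k) \<cdot> y = far F (l, k) \<cdot> w)" for l w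
  have p: "p l' (far F (l, l') \<cdot> w) \<longleftrightarrow> p l w" if l: "(l, l') \<in> r" and w: "w \<in> hom C X (fob F l)" for l l' w
  proof
    assume "p l' (far F (l, l') \<cdot> w)"
    then obtain k where k: "(i, k) \<in> r" "(l', k) \<in> r" "far F (i, k) \<cdot> y = far F (l', k) \<cdot> far F (l, l') \<cdot> w"
      unfolding p_def by blast
    have "far F (l', k) \<cdot> far F (l, l') \<cdot> w = far F (l, k) \<cdot> w"
      using diagram_comp[OF d(1) l k(2)] assoc[OF w diagram_hom[OF d(1) l] diagram_hom[OF d(1) k(2)]] by simp
    then show "p l w" unfolding p_def using k d(4)[OF l k(2)] by auto
  next
    assume "p l w"
    then obtain k where k: "(i, k) \<in> r" "(l, k) \<in> r" "far F (i, k) \<cdot> y = far F (l, k) \<cdot> w" unfolding p_def by blast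
    obtain n where n: "(k, n) \<in> r" "(l', n) \<in> r" using d(5)[of k l'] d(3) k l by blast
    have "far F (i, n) \<cdot> y = far F (k, n) \<cdot> far F (i, k) \<cdot> y"
      using diagram_comp[OF d(1) k(1) n(1)] assoc[OF i(2) diagram_hom[OF d(1) k(1)] diagram_hom[OF d(1) n(1)]] by simp
    also have "\<dots> = far F (l, n) \<cdot> w"
      using diagram_comp[OF d(1) k(2) n(1)] assoc[OF w diagram_hom[OF d(1) k(2)] diagram_hom[OF d(1) n(1)]] k(3) by simp
    also have "\<dots> = far F (l', n) \<cdot> far F (l, l') \<cdot> w"
      using diagram_comp[OF d(1) l n(2)] assoc[OF w diagram_hom[OF d(1) l] diagram_hom[OF d(1) n(2)]] by simp
    finally show "p l' (far F (l, l') \<cdot> w)" unfolding p_def using d(4)[OF k(1) n(1)] n(2) by blast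
  qed
  obtain t where t: "\<forall>l\<in>I. \<forall>w\<in>hom C X (fob F l). t (\<iota> l \<cdot> w) \<longleftrightarrow> p l w"
    using colimit_predicate(1)[OF X d(1,3) pres L, of p, OF p] by blast
  have "p i y" unfolding p_def using d(2)[OF i(1)] by blast
  then have "p j z" using t i j e by metis
  then show ?thesis using that d(3) unfolding p_def by blast
qed

text \<open>
  When the injections into the colimit are monic, arrows that become equal in it are equal at
  every common stage, so that factoring through a stage is the only condition.
\<close>

lemma hom_preserves_monic_colimit:
  assumes X: "X \<in> Ob C" and D: "directed_diagram C I r F" and L: "is_colimit (poset_cat I r) C F L \<iota>"
    and m: "\<And>i. i \<in> I \<Longrightarrow> monic C (\<iota> i)"
    and s: "\<And>x. x \<in> hom C X L \<Longrightarrow> \<exists>i\<in>I. \<exists>y\<in>hom C X (fob F i). \<iota> i \<cdot> y = x"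
  shows "is_colimit (poset_cat I r) (set_cat TYPE('u)) (comp_func (hom_functor C X) F)
    (fob (hom_functor C X) L) (\<lambda>j. far (hom_functor C X) (\<iota> j))"
  unfolding is_colimit_def
proof (intro conjI allI impI)
  let ?S = "set_cat TYPE('u) :: ('u set, 'u setarr) cat" and ?H = "hom_functor C X"
  note d = directed_diagramD[OF D]
  have LO: "L \<in> Ob C" using L unfolding is_colimit_def is_cocone_def by blast
  note i = poset_colimit_hom[OF L]
  have ic: "\<iota> j \<cdot> far F (i, j) = \<iota> i" if "(i, j) \<in> r" for i j using colimit_comm[OF L, of "(i, j)"] that by simp
  have H: "fob ?H A = hom C X A" for A by (simp add: hom_functor_def)
  have cf: "fob (comp_func ?H F) j = hom C X (fob F j)" "far (comp_func ?H F) u = far ?H (far F u)" for j u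
    by (simp_all add: comp_func_def H)
  have Hi: "far ?H (\<iota> j) \<in> hom ?S (hom C X (fob F j)) (hom C X L)" if "j \<in> I" for j
    by (rule hom_functor_hom[OF X i[OF that]])
  show "is_cocone (poset_cat I r) ?S (comp_func ?H F) (fob ?H L) (\<lambda>j. far ?H (\<iota> j))"
    unfolding is_cocone_def
  proof (intro conjI ballI)
    show "fob ?H L \<in> Ob ?S" using small_hom[OF X LO] by (simp add: H set_cat_def)
    show "far ?H (\<iota> j) \<in> hom ?S (fob (comp_func ?H F) j) (fob ?H L)" if "j \<in> Ob (poset_cat I r)" for j
      using Hi that by (simp add: H cf)
    fix u assume u: "u \<in> Ar (poset_cat I r)"
    obtain j k where jk: "u = (j, k)" by (cases u)
    then have r: "(j, k) \<in> r" "j \<in> I" "k \<in> I" using u d(3) by auto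
    note f = diagram_hom[OF d(1) r(1)]
    have "Comp ?S (far ?H (\<iota> k)) (far ?H (far F (j, k))) = far ?H (\<iota> j)"
    proof (rule setarr_eqI)
      show "Comp ?S (far ?H (\<iota> k)) (far ?H (far F (j, k))) \<in> hom ?S (hom C X (fob F j)) (hom C X L)"
        using hom_functor_hom[OF X f] Hi[OF r(3)] unfolding set_cat_comp set_cat_hom by (auto simp: compose_def)
      show "far ?H (\<iota> j) \<in> hom ?S (hom C X (fob F j)) (hom C X L)" by (rule Hi[OF r(2)])
      fix y assume y: "y \<in> hom C X (fob F j)"
      have "src (far ?H (far F (j, k))) = hom C X (fob F j)" using hom_functor_hom[OF X f] by (simp add: set_cat_hom)
      then have "fn (Comp ?S (far ?H (\<iota> k)) (far ?H (far F (j, k)))) y = \<iota> k \<cdot> far F (j, k) \<cdot> y"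
        using y hom_functor_fn[OF f y] hom_functor_fn[OF i[OF r(3)] comp_hom[OF y f]] by (simp add: set_cat_comp compose_def)
      also have "\<dots> = \<iota> j \<cdot> y" using assoc[OF y f i[OF r(3)]] ic[OF r(1)] by simp
      finally show "fn (Comp ?S (far ?H (\<iota> k)) (far ?H (far F (j, k)))) y = fn (far ?H (\<iota> j)) y"
        using hom_functor_fn[OF i[OF r(2)] y] by simp
    qed
    then show "Comp ?S (far ?H (\<iota> (Cod (poset_cat I r) u))) (far (comp_func ?H F) u) = far ?H (\<iota> (Dom (poset_cat I r) u))"
      by (simp add: jk cf)
  qed
  fix Y \<kappa> assume K: "is_cocone (poset_cat I r) ?S (comp_func ?H F) Y \<kappa>"
  have YO: "small TYPE('u) Y" using cocone_Ob[OF K] by (simp add: set_cat_def)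
  have k: "\<kappa> j \<in> hom ?S (hom C X (fob F j)) Y" if "j \<in> I" for j using cocone_hom[OF K, of j] that by (simp add: cf)
  have kc: "fn (\<kappa> j) (far F (i, j) \<cdot> y) = fn (\<kappa> i) y" if r: "(i, j) \<in> r" and y: "y \<in> hom C X (fob F i)" for i j y
  proof -
    note f = diagram_hom[OF d(1) r]
    have "Comp ?S (\<kappa> j) (far ?H (far F (i, j))) = \<kappa> i" using cocone_comm[OF K, of "(i, j)"] r by (simp add: cf)
    then have "fn (Comp ?S (\<kappa> j) (far ?H (far F (i, j)))) y = fn (\<kappa> i) y" by simp
    moreover have "src (far ?H (far F (i, j))) = hom C X (fob F i)" using hom_functor_hom[OF X f] by (simp add: set_cat_hom)
    ultimately show ?thesis using y hom_functor_fn[OF f y] by (simp add: set_cat_comp compose_def)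
  qed
  have wd: "fn (\<kappa> i) y = fn (\<kappa> j) z"
    if a: "i \<in> I" "y \<in> hom C X (fob F i)" "j \<in> I" "z \<in> hom C X (fob F j)" "\<iota> i \<cdot> y = \<iota> j \<cdot> z" for i j y z
  proof -
    obtain n where n: "(i, n) \<in> r" "(j, n) \<in> r" "n \<in> I" using d(5)[OF a(1,3)] by blast
    note fi = diagram_hom[OF d(1) n(1)] and fj = diagram_hom[OF d(1) n(2)]
    have "\<iota> n \<cdot> far F (i, n) \<cdot> y = \<iota> n \<cdot> far F (j, n) \<cdot> z"
      using assoc[OF a(2) fi i[OF n(3)]] assoc[OF a(4) fj i[OF n(3)]] ic[OF n(1)] ic[OF n(2)] a(5) by simp
    then have "far F (i, n) \<cdot> y = far F (j, n) \<cdot> z"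
      using monicD[OF m[OF n(3)] i[OF n(3)] comp_hom[OF a(2) fi] comp_hom[OF a(4) fj]] by blast
    then show ?thesis using kc[OF n(1) a(2)] kc[OF n(2) a(4)] by simp
  qed
  have "\<exists>v. \<forall>i\<in>I. \<forall>y\<in>hom C X (fob F i). \<iota> i \<cdot> y = x \<longrightarrow> fn (\<kappa> i) y = v" if "x \<in> hom C X L" for x
    using s[OF that] wd by metis
  then obtain h where h: "\<And>x i y. x \<in> hom C X L \<Longrightarrow> i \<in> I \<Longrightarrow> y \<in> hom C X (fob F i) \<Longrightarrow> \<iota> i \<cdot> y = x \<Longrightarrow> fn (\<kappa> i) y = h x"
    by metis
  have hi: "h (\<iota> i \<cdot> y) = fn (\<kappa> i) y" if "i \<in> I" "y \<in> hom C X (fob F i)" for i y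
    using h[OF comp_hom[OF that(2) i[OF that(1)]] that] by simp
  have hY: "h x \<in> Y" if x: "x \<in> hom C X L" for x
  proof -
    obtain i y where y: "i \<in> I" "y \<in> hom C X (fob F i)" "\<iota> i \<cdot> y = x" using s[OF x] by blast
    then have "fn (\<kappa> i) y \<in> Y" using k[OF y(1)] unfolding set_cat_hom by blast
    then show ?thesis using hi[OF y(1,2)] y(3) by simp
  qed
  have comp: "Comp ?S g (far ?H (\<iota> j)) = \<kappa> j \<longleftrightarrow> (\<forall>y\<in>hom C X (fob F j). fn g (\<iota> j \<cdot> y) = fn (\<kappa> j) y)"
    if g: "g \<in> hom ?S (hom C X L) Y" and j: "j \<in> I" for g j
  proof -
    have src: "src (far ?H (\<iota> j)) = hom C X (fob F j)" using Hi[OF j] by (simp add: set_cat_hom)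
    have c: "Comp ?S g (far ?H (\<iota> j)) \<in> hom ?S (hom C X (fob F j)) Y"
      using g Hi[OF j] unfolding set_cat_comp set_cat_hom by (auto simp: compose_def)
    have v: "fn (Comp ?S g (far ?H (\<iota> j))) y = fn g (\<iota> j \<cdot> y)" if "y \<in> hom C X (fob F j)" for y
      using that src hom_functor_fn[OF i[OF j] that] by (simp add: set_cat_comp compose_def)
    show ?thesis using setarr_eqI[OF c k[OF j]] v by auto
  qed
  let ?h = "SetArr (hom C X L) (\<lambda>x\<in>hom C X L. h x) Y"
  have hh: "?h \<in> hom ?S (hom C X L) Y" using hY YO small_hom[OF X LO] by (auto simp: set_cat_hom)
  show "\<exists>!g. g \<in> hom ?S (fob ?H L) Y \<and> (\<forall>j\<in>Ob (poset_cat I r). Comp ?S g (far ?H (\<iota> j)) = \<kappa> j)"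
    unfolding H
  proof (rule ex1I[of _ ?h])
    show "?h \<in> hom ?S (hom C X L) Y \<and> (\<forall>j\<in>Ob (poset_cat I r). Comp ?S ?h (far ?H (\<iota> j)) = \<kappa> j)"
      using hh comp[OF hh] hi comp_hom[OF _ i] by simp
    fix g assume g: "g \<in> hom ?S (hom C X L) Y \<and> (\<forall>j\<in>Ob (poset_cat I r). Comp ?S g (far ?H (\<iota> j)) = \<kappa> j)"
    show "g = ?h"
    proof (rule setarr_eqI[OF _ hh])
      show "g \<in> hom ?S (hom C X L) Y" using g by blast
      fix x assume x: "x \<in> hom C X L"
      obtain i y where y: "i \<in> I" "y \<in> hom C X (fob F i)" "\<iota> i \<cdot> y = x" using s[OF x] by blast
      have "fn g x = fn (\<kappa> i) y" using comp g y by auto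
      then show "fn g x = fn ?h x" using hi[OF y(1,2)] y(3) x by simp
    qed
  qed
qed

end

locale lfp_cat = projectively_generated_cat C G for C :: "('o, 'u) cat" and G :: 'o +
  assumes lfp: "locally_finitely_presentable C"
begin

lemma fp_diagram:
  assumes "X \<in> Ob C"
  obtains I r F \<iota> where "directed_diagram C I r F" "\<forall>i\<in>I. finitely_presentable C (fob F i)"
    "is_colimit (poset_cat I r) C F X \<iota>"
proof -
  obtain \<G> where "\<forall>X\<in>\<G>. finitely_presentable C X"
    "\<forall>X\<in>Ob C. \<exists>I r F \<iota>. directed_diagram C I r F \<and> (\<forall>i\<in>I. fob F i \<in> \<G>) \<and> is_colimit (poset_cat I r) C F X \<iota>"
    using lfp unfolding locally_finitely_presentable_def by blast
  with assms show ?thesis using that by meson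
qed

lemma fp_Ob: "finitely_presentable C X \<Longrightarrow> X \<in> Ob C"
  by (simp add: finitely_presentable_def)

lemma fp_fg: "finitely_presentable C X \<Longrightarrow> finitely_generated C X"
  by (simp add: finitely_presentable_def finitely_generated_def)

lemma fp_separates:
  assumes f: "f \<in> hom C X Y" and g: "g \<in> hom C X Y"
    and e: "\<And>K x. finitely_presentable C K \<Longrightarrow> x \<in> hom C K X \<Longrightarrow> f \<cdot> x = g \<cdot> x"
  shows "f = g"
proof -
  obtain I r F \<iota> where D: "directed_diagram C I r F" "\<forall>i\<in>I. finitely_presentable C (fob F i)"
    and L: "is_colimit (poset_cat I r) C F X \<iota>" by (rule fp_diagram[OF hom_Ob(1)[OF f]])
  show ?thesis
  proof (rule colimit_eqI[OF directed_diagramD(1)[OF D(1)] L f g])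
    fix i assume i: "i \<in> Ob (poset_cat I r)"
    show "f \<cdot> \<iota> i = g \<cdot> \<iota> i" by (rule e[OF _ colimit_hom[OF L i]]) (use D(2) i in simp)
  qed
qed

lemma fp_factor:
  assumes K: "finitely_presentable C K" and D: "directed_diagram C I r F"
    and L: "is_colimit (poset_cat I r) C F L \<iota>" and x: "x \<in> hom C K L"
  obtains i y where "i \<in> I" "y \<in> hom C K (fob F i)" "\<iota> i \<cdot> y = x"
proof -
  have "preserves_colimits_of (poset_cat I r) F C (set_cat TYPE('u)) (hom_functor C K)"
    using K D unfolding finitely_presentable_def by blast
  then show ?thesis using directed_factor[OF fp_Ob[OF K] D _ L x] that by blast
qed

lemma fp_eventually_equal:
  assumes K: "finitely_presentable C K" and D: "directed_diagram C I r F"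
    and L: "is_colimit (poset_cat I r) C F L \<iota>"
    and i: "i \<in> I" "y \<in> hom C K (fob F i)" and j: "j \<in> I" "z \<in> hom C K (fob F j)" and e: "\<iota> i \<cdot> y = \<iota> j \<cdot> z"
  obtains k where "k \<in> I" "(i, k) \<in> r" "(j, k) \<in> r" "far F (i, k) \<cdot> y = far F (j, k) \<cdot> z"
proof -
  have "preserves_colimits_of (poset_cat I r) F C (set_cat TYPE('u)) (hom_functor C K)"
    using K D unfolding finitely_presentable_def by blast
  then show ?thesis using directed_eventually_equal[OF fp_Ob[OF K] D _ L i j e] that by blast
qed

lemma fg_factor:
  assumes K: "finitely_generated C K" and D: "directed_diagram C I r F"
    and m: "\<forall>u\<in>r. monic C (far F u)"
    and L: "is_colimit (poset_cat I r) C F L \<iota>" and x: "x \<in> hom C K L"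
  obtains i y where "i \<in> I" "y \<in> hom C K (fob F i)" "\<iota> i \<cdot> y = x"
proof -
  have "preserves_colimits_of (poset_cat I r) F C (set_cat TYPE('u)) (hom_functor C K)" "K \<in> Ob C"
    using K D m unfolding finitely_generated_def by blast+
  then show ?thesis using directed_factor[OF _ D _ L x] that by blast
qed

text \<open>
  Arrows with finitely presentable domain that become equal in the colimit become equal at a
  later stage, and the connecting arrows are monic.
\<close>

lemma colimit_injection_monic:
  assumes D: "directed_diagram C I r F" and m: "\<forall>u\<in>r. monic C (far F u)"
    and L: "is_colimit (poset_cat I r) C F L \<iota>" and i: "i \<in> I"
  shows "monic C (\<iota> i)"
proof -
  note d = directed_diagramD[OF D]
  have h: "\<iota> i \<in> hom C (fob F i) L" using colimit_hom[OF L] i by simp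
  show ?thesis
  proof (rule monicI[OF h])
    fix X f g assume f: "f \<in> hom C X (fob F i)" and g: "g \<in> hom C X (fob F i)" and e: "\<iota> i \<cdot> f = \<iota> i \<cdot> g"
    show "f = g"
    proof (rule fp_separates[OF f g])
      fix K x assume K: "finitely_presentable C K" and x: "x \<in> hom C K X"
      have "\<iota> i \<cdot> f \<cdot> x = \<iota> i \<cdot> g \<cdot> x" using assoc[OF x f h] assoc[OF x g h] e by simp
      then obtain k where k: "(i, k) \<in> r" "far F (i, k) \<cdot> f \<cdot> x = far F (i, k) \<cdot> g \<cdot> x"
        using fp_eventually_equal[OF K D L i comp_hom[OF x f] i comp_hom[OF x g]] by blast
      show "f \<cdot> x = g \<cdot> x"
        using monicD[OF _ diagram_hom[OF d(1) k(1)] comp_hom[OF x f] comp_hom[OF x g] k(2)] m k(1) by blast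
    qed
  qed
qed

text \<open>
  Two arrows with finitely presentable domain into the colimit come from a common stage, and
  that stage embeds.
\<close>

lemma directed_union_monic:
  assumes D: "directed_diagram C I r F" and L: "is_colimit (poset_cat I r) C F L \<iota>"
    and n: "n \<in> hom C L B" and m: "\<And>i. i \<in> I \<Longrightarrow> monic C (n \<cdot> \<iota> i)"
  shows "monic C n"
proof (rule monicI[OF n])
  note d = directed_diagramD[OF D]
  note h = poset_colimit_hom[OF L]
  fix X f g assume f: "f \<in> hom C X L" and g: "g \<in> hom C X L" and e: "n \<cdot> f = n \<cdot> g"
  show "f = g"
  proof (rule fp_separates[OF f g])
    fix K x assume K: "finitely_presentable C K" and x: "x \<in> hom C K X"
    obtain i y where y: "i \<in> I" "y \<in> hom C K (fob F i)" "\<iota> i \<cdot> y = f \<cdot> x"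
      by (rule fp_factor[OF K D L comp_hom[OF x f]])
    obtain j z where z: "j \<in> I" "z \<in> hom C K (fob F j)" "\<iota> j \<cdot> z = g \<cdot> x"
      by (rule fp_factor[OF K D L comp_hom[OF x g]])
    obtain k where k: "k \<in> I" "(i, k) \<in> r" "(j, k) \<in> r" using d(5)[OF y(1) z(1)] by blast
    note fi = diagram_hom[OF d(1) k(2)] and fj = diagram_hom[OF d(1) k(3)]
    have yk: "\<iota> k \<cdot> far F (i, k) \<cdot> y = f \<cdot> x"
      using assoc[OF y(2) fi h[OF k(1)]] poset_colimit_comm[OF L k(2)] y(3) by simp
    have zk: "\<iota> k \<cdot> far F (j, k) \<cdot> z = g \<cdot> x"
      using assoc[OF z(2) fj h[OF k(1)]] poset_colimit_comm[OF L k(3)] z(3) by simp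
    have "(n \<cdot> \<iota> k) \<cdot> far F (i, k) \<cdot> y = n \<cdot> f \<cdot> x"
      using assoc[OF comp_hom[OF y(2) fi] h[OF k(1)] n] yk by simp
    also have "\<dots> = n \<cdot> g \<cdot> x" using assoc[OF x f n] assoc[OF x g n] e by simp
    also have "\<dots> = (n \<cdot> \<iota> k) \<cdot> far F (j, k) \<cdot> z"
      using assoc[OF comp_hom[OF z(2) fj] h[OF k(1)] n] zk by simp
    finally have "far F (i, k) \<cdot> y = far F (j, k) \<cdot> z"
      by (rule monicD[OF m[OF k(1)] comp_hom[OF h[OF k(1)] n] comp_hom[OF y(2) fi] comp_hom[OF z(2) fj]])
    then show "f \<cdot> x = g \<cdot> x" using yk zk by simp
  qed
qed

lemma directed_colimit_exists:
  assumes D: "directed_diagram C I r F"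
  obtains L \<iota> where "is_colimit (poset_cat I r) C F L \<iota>"
proof -
  note d = directed_diagramD[OF D]
  have "small TYPE('u) r" by (rule small_subset[OF d(3) small_Times[OF universe d(7) d(7)]])
  then obtain L \<iota> where "is_colimit (poset_cat I r) C F L \<iota>"
    using colimit_exists[OF d(1), unfolded poset_cat_simps, OF d(7)] by blast
  then show ?thesis by (rule that)
qed

text \<open>
  A directed family of subobjects of \<open>B\<close>, given without connecting arrows: these are determined
  by the inclusions, which also makes them functorial. The colimit is again a subobject.
\<close>

lemma directed_union:
  assumes I: "small TYPE('u) (I :: 'u set)" "directed_poset I r"
    and n: "\<And>i. i \<in> I \<Longrightarrow> n i \<in> hom C (M i) B" "\<And>i. i \<in> I \<Longrightarrow> monic C (n i)"
    and w: "\<And>i j. (i, j) \<in> r \<Longrightarrow> \<exists>w\<in>hom C (M i) (M j). n j \<cdot> w = n i"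
  obtains F L \<iota> h where "directed_diagram C I r F" "\<And>i. fob F i = M i" "\<forall>u\<in>r. monic C (far F u)"
    "\<And>i j. (i, j) \<in> r \<Longrightarrow> n j \<cdot> far F (i, j) = n i"
    "is_colimit (poset_cat I r) C F L \<iota>" "h \<in> hom C L B" "monic C h" "\<And>i. i \<in> I \<Longrightarrow> h \<cdot> \<iota> i = n i"
proof -
  have po: "partial_order_on I r" "I \<noteq> {}" using I(2) unfolding directed_poset_def by blast+
  have r: "r \<subseteq> I \<times> I" "refl_on I r" "trans r" using partial_order_onD[OF po(1)] by blast+
  obtain f where f: "\<And>i j. (i, j) \<in> r \<Longrightarrow> f (i, j) \<in> hom C (M i) (M j) \<and> n j \<cdot> f (i, j) = n i"
  proof -
    have "\<forall>u. \<exists>x. u \<in> r \<longrightarrow> x \<in> hom C (M (fst u)) (M (snd u)) \<and> n (snd u) \<cdot> x = n (fst u)"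
      using w by (metis prod.collapse)
    then obtain f where "\<And>u. u \<in> r \<Longrightarrow> f u \<in> hom C (M (fst u)) (M (snd u)) \<and> n (snd u) \<cdot> f u = n (fst u)"
      by metis
    then show ?thesis using that[of f] by (metis fst_conv snd_conv)
  qed
  have un: "x = y" if "(i, j) \<in> r" "x \<in> hom C (M i) (M j)" "y \<in> hom C (M i) (M j)" "n j \<cdot> x = n j \<cdot> y" for i j x y
    using monicD[OF n(2) n(1) that(2-4)] that(1) r(1) by blast
  define F where "F = \<lparr>fob = M, far = f\<rparr>"
  have F: "is_functor (poset_cat I r) C F"
    unfolding F_def
  proof (rule poset_functorI[OF po(1)])
    show "M i \<in> Ob C" if "i \<in> I" for i by (rule hom_Ob(1)[OF n(1)[OF that]])
    show "f (i, j) \<in> hom C (M i) (M j)" if "(i, j) \<in> r" for i j using f[OF that] by blast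
    show "f (i, i) = Id C (M i)" if "i \<in> I" for i
    proof -
      have i: "(i, i) \<in> r" by (rule refl_onD[OF r(2) that])
      show ?thesis
        using un[OF i] f[OF i] Id_hom[OF hom_Ob(1)[OF n(1)[OF that]]] comp_Id[OF n(1)[OF that]] by metis
    qed
    fix i j k assume ij: "(i, j) \<in> r" and jk: "(j, k) \<in> r"
    have ik: "(i, k) \<in> r" using transD[OF r(3) ij jk] .
    have k: "k \<in> I" using jk r(1) by blast
    have fij: "f (i, j) \<in> hom C (M i) (M j)" and fjk: "f (j, k) \<in> hom C (M j) (M k)"
      using f[OF ij] f[OF jk] by blast+
    show "f (i, k) = f (j, k) \<cdot> f (i, j)"
      by (rule un[OF ik _ comp_hom[OF fij fjk]])
        (use f[OF ij] f[OF jk] f[OF ik] assoc[OF fij fjk n(1)[OF k]] in auto)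
  qed
  have D: "directed_diagram C I r F" unfolding directed_diagram_def using I F by blast
  have m: "monic C (far F u)" if "u \<in> r" for u
  proof -
    obtain i j where u: "u = (i, j)" by (cases u)
    have ij: "(i, j) \<in> r" "i \<in> I" "j \<in> I" using that u r(1) by auto
    have "monic C (f (i, j))" by (rule monic_cancel[OF _ n(1)[OF ij(3)]]) (use f[OF ij(1)] n(2)[OF ij(2)] in auto)
    then show ?thesis by (simp add: F_def u)
  qed
  obtain L \<iota> where L: "is_colimit (poset_cat I r) C F L \<iota>" by (rule directed_colimit_exists[OF D])
  have "is_cocone (poset_cat I r) C F B n"
    proof (rule poset_coconeI)
    show "B \<in> Ob C" using po(2) hom_Ob(2)[OF n(1)] by blast
    show "n i \<in> hom C (fob F i) B" if "i \<in> I" for i using n(1) that by (simp add: F_def)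
    show "n j \<cdot> far F (i, j) = n i" if "(i, j) \<in> r" for i j using f[OF that] by (simp add: F_def)
  qed
  then obtain h where h: "h \<in> hom C L B" "\<And>i. i \<in> I \<Longrightarrow> h \<cdot> \<iota> i = n i" using poset_colimit_desc[OF L] by blast
  have hm: "monic C h" by (rule directed_union_monic[OF D L h(1)]) (simp add: h(2) n(2))
  have c: "n j \<cdot> far F (i, j) = n i" if "(i, j) \<in> r" for i j using f[OF that] by (simp add: F_def)
  show ?thesis by (rule that[of F, OF D _ _ c L h(1) hm h(2)]) (use m in \<open>auto simp: F_def\<close>)
qed

text \<open>
  An arrow \<open>y\<close> from \<open>M\<close> to a directed union restricts to \<open>X\<close> and to \<open>K\<close>, and both restrictions
  factor through a common stage; the stage being a subobject, \<open>y\<close> does too.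
\<close>

lemma joint_cover_fg:
  assumes M: "joint_cover X K M a h" and X: "finitely_generated C X" and K: "finitely_generated C K"
  shows "finitely_generated C M"
  unfolding finitely_generated_def preserves_colimits_of_def
proof (intro conjI allI impI)
  note ah = joint_cover_hom[OF M]
  show Y: "M \<in> Ob C" by (rule hom_Ob(2)[OF ah(1)])
  fix I r F L \<iota> assume D: "directed_diagram C I r F" and m: "\<forall>u\<in>r. monic C (far F u)"
    and L: "is_colimit (poset_cat I r) C F L \<iota>"
  note d = directed_diagramD[OF D]
  note h = poset_colimit_hom[OF L]
  have im: "monic C (\<iota> l)" if "l \<in> I" for l by (rule colimit_injection_monic[OF D m L that])
  show "is_colimit (poset_cat I r) (set_cat TYPE('u)) (comp_func (hom_functor C M) F)
    (fob (hom_functor C M) L) (\<lambda>j. far (hom_functor C M) (\<iota> j))"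
  proof (rule hom_preserves_monic_colimit[OF Y D L im])
    fix y assume y: "y \<in> hom C M L"
    obtain i x where x: "i \<in> I" "x \<in> hom C X (fob F i)" "\<iota> i \<cdot> x = y \<cdot> a"
      by (rule fg_factor[OF X D m L comp_hom[OF ah(1) y]])
    obtain j k where k: "j \<in> I" "k \<in> hom C K (fob F j)" "\<iota> j \<cdot> k = y \<cdot> h"
      by (rule fg_factor[OF K D m L comp_hom[OF ah(2) y]])
    obtain l where l: "l \<in> I" "(i, l) \<in> r" "(j, l) \<in> r" using d(5)[OF x(1) k(1)] by blast
    note fi = diagram_hom[OF d(1) l(2)] and fj = diagram_hom[OF d(1) l(3)]
    have "\<iota> l \<cdot> far F (i, l) \<cdot> x = y \<cdot> a"
      using assoc[OF x(2) fi h[OF l(1)]] x(3) poset_colimit_comm[OF L l(2)] by simp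
    moreover have "\<iota> l \<cdot> far F (j, l) \<cdot> k = y \<cdot> h"
      using assoc[OF k(2) fj h[OF l(1)]] k(3) poset_colimit_comm[OF L l(3)] by simp
    ultimately have "\<exists>w\<in>hom C M (fob F l). \<iota> l \<cdot> w = y"
      by (rule joint_cover_fill_in[OF M im[OF l(1)] h[OF l(1)] y comp_hom[OF x(2) fi] comp_hom[OF k(2) fj]])
    then show "\<exists>i\<in>I. \<exists>z\<in>hom C M (fob F i). \<iota> i \<cdot> z = y" using l(1) by blast
  qed
qed

text \<open>
  The finite subsets of \<open>A\<close> are represented by codes \<open>d\<close>, as directed diagrams are indexed by
  elements of the universe.
\<close>

lemma finite_subset_union_poset:
  assumes d: "inj_on d (Fpow A)"
  shows "directed_poset (d ` Fpow A) {(d S, d T) | S T. S \<in> Fpow A \<and> T \<in> Fpow A \<and> S \<subseteq> T}"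
  (is "directed_poset ?I ?r")
  unfolding directed_poset_def
proof (intro conjI ballI)
  have dd: "d S = d T \<longleftrightarrow> S = T" if "S \<in> Fpow A" "T \<in> Fpow A" for S T
    using inj_on_eq_iff[OF d that] .
  show "partial_order_on ?I ?r"
    unfolding partial_order_on_def preorder_on_def refl_on_def trans_def antisym_def
    using dd by (auto; metis order_trans)
  show "?I \<noteq> {}" using empty_in_Fpow by blast
  fix x y assume "x \<in> ?I" "y \<in> ?I"
  then obtain S T where ST: "S \<in> Fpow A" "T \<in> Fpow A" "x = d S" "y = d T" by blast
  have "S \<union> T \<in> Fpow A" using ST(1,2) by (auto simp: Fpow_def)
  then show "\<exists>z\<in>?I. (x, z) \<in> ?r \<and> (y, z) \<in> ?r" using ST by (intro bexI[of _ "d (S \<union> T)"]) auto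
qed

text \<open>
  The images of the finite copowers of \<open>G\<close> form a directed family of subobjects of \<open>A\<close> whose
  union contains all elements, so it is \<open>A\<close>. The identity of a finitely generated object factors
  through one of them.
\<close>

lemma fg_finite_cover:
  assumes A: "finitely_generated C A"
  obtains S P \<iota> q where "finite S" "S \<subseteq> hom C G A" "is_coprod S (\<lambda>_. G) P \<iota>" "q \<in> hom C P A" "extremal_epi C q"
proof -
  let ?E = "hom C G A" and ?T = "\<lambda>S :: 'u set. S \<in> Fpow (hom C G A)"
  have AO: "A \<in> Ob C" using A by (simp add: finitely_generated_def)
  have ex: "\<exists>P \<iota> M q m. is_coprod S (\<lambda>_. G) P \<iota> \<and> q \<in> hom C P M \<and> m \<in> hom C M A \<and> extremal_epi C q \<and> monic C m \<and>
      (\<forall>s\<in>S. m \<cdot> q \<cdot> \<iota> s = s)" if S: "?T S" for S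
  proof -
    have fS: "finite S" "S \<subseteq> ?E" using S by (simp_all add: Fpow_def)
    obtain P \<iota> where P: "is_coprod S (\<lambda>_. G) P \<iota>"
      using coprod_exists[OF small_finite[OF universe fS(1)], of "\<lambda>_. G"] G_Ob by blast
    obtain p where p: "p \<in> hom C P A" "\<And>s. s \<in> S \<Longrightarrow> p \<cdot> \<iota> s = s"
      using coprod_copair[OF P AO, of "\<lambda>s. s"] fS(2) by blast
    obtain M q m where q: "q \<in> hom C P M" and m: "m \<in> hom C M A" "m \<cdot> q = p" and qm: "extremal_epi C q" "monic C m"
      by (rule image_factorisation[OF p(1)])
    have "m \<cdot> q \<cdot> \<iota> s = s" if "s \<in> S" for s using assoc[OF coprod_hom[OF P that] q m(1)] m(2) p(2)[OF that] by simp
    then show ?thesis using P q m(1) qm by blast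
  qed
  then have "\<exists>P \<iota> M q m. \<forall>S. ?T S \<longrightarrow> is_coprod S (\<lambda>_. G) (P S) (\<iota> S) \<and> q S \<in> hom C (P S) (M S) \<and> m S \<in> hom C (M S) A \<and>
      extremal_epi C (q S) \<and> monic C (m S) \<and> (\<forall>s\<in>S. m S \<cdot> q S \<cdot> \<iota> S s = s)" by metis
  then obtain P \<iota> M q m where all: "\<forall>S. ?T S \<longrightarrow> is_coprod S (\<lambda>_. G) (P S) (\<iota> S) \<and> q S \<in> hom C (P S) (M S) \<and>
      m S \<in> hom C (M S) A \<and> extremal_epi C (q S) \<and> monic C (m S) \<and> (\<forall>s\<in>S. m S \<cdot> q S \<cdot> \<iota> S s = s)"
    by (elim exE)
  have P: "\<And>S. ?T S \<Longrightarrow> is_coprod S (\<lambda>_. G) (P S) (\<iota> S)"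
    and q: "\<And>S. ?T S \<Longrightarrow> q S \<in> hom C (P S) (M S)" "\<And>S. ?T S \<Longrightarrow> extremal_epi C (q S)"
    and m: "\<And>S. ?T S \<Longrightarrow> m S \<in> hom C (M S) A" "\<And>S. ?T S \<Longrightarrow> monic C (m S)"
    and s: "\<And>S s. ?T S \<Longrightarrow> s \<in> S \<Longrightarrow> m S \<cdot> q S \<cdot> \<iota> S s = s"
    by (simp_all add: all)
  \<comment> \<open>The images increase with the set of generators.\<close>
  have w: "\<exists>w\<in>hom C (M S) (M T). m T \<cdot> w = m S" if S: "?T S" and T: "?T T" and ST: "S \<subseteq> T" for S T
  proof -
    have g: "q T \<cdot> \<iota> T s \<in> hom C G (M T)" if "s \<in> S" for s
      using comp_hom[OF coprod_hom[OF P[OF T]] q(1)[OF T]] that ST by blast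
    obtain k where k: "k \<in> hom C (P S) (M T)" "\<And>s. s \<in> S \<Longrightarrow> k \<cdot> \<iota> S s = q T \<cdot> \<iota> T s"
      using coprod_copair[OF P[OF S] hom_Ob(1)[OF m(1)[OF T]], of "\<lambda>s. q T \<cdot> \<iota> T s"] g by blast
    have "m T \<cdot> k = m S \<cdot> q S"
    proof (rule coprod_eqI[OF P[OF S] comp_hom[OF k(1) m(1)[OF T]] comp_hom[OF q(1)[OF S] m(1)[OF S]]])
      fix x assume x: "x \<in> S"
      have "(m T \<cdot> k) \<cdot> \<iota> S x = x"
        using assoc[OF coprod_hom[OF P[OF S] x] k(1) m(1)[OF T]] k(2)[OF x] s[OF T] x ST by auto
      moreover have "(m S \<cdot> q S) \<cdot> \<iota> S x = x"
        using assoc[OF coprod_hom[OF P[OF S] x] q(1)[OF S] m(1)[OF S]] s[OF S x] by simp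
      ultimately show "(m T \<cdot> k) \<cdot> \<iota> S x = (m S \<cdot> q S) \<cdot> \<iota> S x" by simp
    qed
    then show ?thesis using fill_in[OF q(2)[OF S] q(1)[OF S] m(2)[OF T] m(1)[OF T] k(1) m(1)[OF S]] by blast
  qed
  have sF: "small TYPE('u) (Fpow ?E)"
    by (rule small_subset[OF _ small_Pow[OF universe small_hom[OF G_Ob AO]]]) (auto simp: Fpow_def)
  obtain d :: "'u set \<Rightarrow> 'u" where d: "inj_on d (Fpow ?E)" "small TYPE('u) (d ` Fpow ?E)" by (rule small_code[OF sF])
  let ?I = "d ` Fpow ?E" and ?r = "{(d S, d T) | S T. S \<in> Fpow ?E \<and> T \<in> Fpow ?E \<and> S \<subseteq> T}"
  define u where "u = inv_into (Fpow ?E) d"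
  have ud: "u (d S) = S" if "?T S" for S unfolding u_def by (rule inv_into_f_f[OF d(1) that])
  have uT: "?T (u x)" if "x \<in> ?I" for x unfolding u_def by (rule inv_into_into[OF that])
  obtain F L \<kappa> h where D: "directed_diagram C ?I ?r F" "\<And>i. fob F i = M (u i)" "\<forall>u\<in>?r. monic C (far F u)"
    and L: "is_colimit (poset_cat ?I ?r) C F L \<kappa>" and h: "h \<in> hom C L A" "monic C h" "\<And>i. i \<in> ?I \<Longrightarrow> h \<cdot> \<kappa> i = m (u i)"
  proof (rule directed_union[OF d(2) finite_subset_union_poset[OF d(1)], of "\<lambda>i. m (u i)" "\<lambda>i. M (u i)" A])
    show "m (u i) \<in> hom C (M (u i)) A" "monic C (m (u i))" if "i \<in> ?I" for i using m uT[OF that] by blast+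
    show "\<exists>w\<in>hom C (M (u i)) (M (u j)). m (u j) \<cdot> w = m (u i)" if "(i, j) \<in> ?r" for i j
      using that w ud by auto
  qed blast
  have kh: "\<kappa> i \<in> hom C (M (u i)) L" if "i \<in> ?I" for i using colimit_hom[OF L] D(2) that by simp
  \<comment> \<open>The element \<open>a\<close> already lies in the image of the copower over \<open>{a}\<close>.\<close>
  have "extremal_epi C h"
  proof (rule extremal_elementwise[OF h(1)])
    fix a assume a: "a \<in> hom C G A"
    then have S: "?T {a}" by (simp add: Fpow_def)
    then have i: "d {a} \<in> ?I" by blast
    have g: "q {a} \<cdot> \<iota> {a} a \<in> hom C G (M {a})" using comp_hom[OF coprod_hom[OF P[OF S]] q(1)[OF S]] by simp
    have k: "\<kappa> (d {a}) \<in> hom C (M {a}) L" using kh[OF i] ud[OF S] by simp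
    have "h \<cdot> \<kappa> (d {a}) \<cdot> q {a} \<cdot> \<iota> {a} a = a"
      using assoc[OF g k h(1)] h(3)[OF i] ud[OF S] s[OF S] by simp
    then show "\<exists>x\<in>hom C G L. h \<cdot> x = a" using comp_hom[OF g k] by blast
  qed
  then have "isomorphism C h" using extremal_monic_iso h(2) by blast
  then obtain z where z: "z \<in> hom C A L" "h \<cdot> z = Id C A" using isomorphismE h(1) by blast
  obtain i y where y: "i \<in> ?I" "y \<in> hom C A (M (u i))" "\<kappa> i \<cdot> y = z"
    using fg_factor[OF A D(1,3) L z(1)] D(2) by metis
  note S = uT[OF y(1)]
  have my: "m (u i) \<cdot> y = Id C A" using assoc[OF y(2) kh[OF y(1)] h(1)] y(3) h(3)[OF y(1)] z(2) by simp
  show ?thesis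
  proof (rule that[OF _ _ P[OF S] comp_hom[OF q(1)[OF S] m(1)[OF S]]])
    show "finite (u i)" "u i \<subseteq> ?E" using S by (simp_all add: Fpow_def)
    show "extremal_epi C (m (u i) \<cdot> q (u i))"
    proof (rule extremal_elementwise[OF comp_hom[OF q(1)[OF S] m(1)[OF S]]])
      fix a assume a: "a \<in> hom C G A"
      obtain x where x: "x \<in> hom C G (P (u i))" "q (u i) \<cdot> x = y \<cdot> a"
        by (rule extremal_lift[OF q(2)[OF S] q(1)[OF S] comp_hom[OF a y(2)]])
      have "(m (u i) \<cdot> q (u i)) \<cdot> x = a"
        using assoc[OF x(1) q(1)[OF S] m(1)[OF S]] x(2) assoc[OF a y(2) m(1)[OF S]] my Id_comp[OF a] by simp
      then show "\<exists>x\<in>hom C G (P (u i)). (m (u i) \<cdot> q (u i)) \<cdot> x = a" using x(1) by blast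
    qed
  qed
qed

end

section \<open>From epimorphisms of finitely generated objects to all epimorphisms\<close>

context lfp_cat
begin

text \<open>
  The monomorphism is approximated by epimorphisms between finitely generated objects. The index
  \<open>i\<close> always refers to a presentation of \<open>A\<close> as a directed colimit of finitely presentable
  objects \<open>F i\<close>, and \<open>M i\<close> is the subobject of \<open>B\<close> generated by \<open>F i\<close> and \<open>b\<close>. The arrow
  \<open>F i \<rightarrow> M i\<close> need not be epic for a given \<open>i\<close>; it is for some \<open>i\<close>, because \<open>b\<close> lies in the
  dominion of \<open>A\<close> and this has a finite reason.
\<close>

lemma WES_lift:
  assumes AP: "amalgamation_property C" and WES: "WES C"
    and m: "monic C m" "epic C m" "m \<in> hom C A B"
    and K: "finitely_presentable C K" and b: "b \<in> hom C K B"
  shows "\<exists>d\<in>hom C K A. m \<cdot> d = b"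
proof -
  obtain I r F \<alpha> where D: "directed_diagram C I r F" and Ffp: "\<forall>i\<in>I. finitely_presentable C (fob F i)"
    and A: "is_colimit (poset_cat I r) C F A \<alpha>" by (rule fp_diagram[OF hom_Ob(1)[OF m(3)]])
  note d = directed_diagramD[OF D]
  have po: "partial_order_on I r" and dp: "directed_poset I r"
    using D unfolding directed_diagram_def directed_poset_def by blast+
  note \<alpha> = poset_colimit_hom[OF A]
  have \<alpha>c: "\<alpha> j \<cdot> far F (i, j) = \<alpha> i" if "(i, j) \<in> r" for i j using colimit_comm[OF A, of "(i, j)"] that by simp
  have rI: "i \<in> I" "j \<in> I" if "(i, j) \<in> r" for i j using that d(3) by blast+
  have "\<exists>M n a h. joint_cover (fob F i) K M a h \<and> n \<in> hom C M B \<and> monic C n \<and> n \<cdot> a = m \<cdot> \<alpha> i \<and> n \<cdot> h = b"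
    if "i \<in> I" for i by (rule joint_image[OF comp_hom[OF \<alpha>[OF that] m(3)] b])
  then have "\<exists>M n a h. \<forall>i. i \<in> I \<longrightarrow> joint_cover (fob F i) K (M i) (a i) (h i) \<and> n i \<in> hom C (M i) B \<and> monic C (n i) \<and>
      n i \<cdot> a i = m \<cdot> \<alpha> i \<and> n i \<cdot> h i = b" by metis
  then obtain M n a h where all: "\<forall>i. i \<in> I \<longrightarrow> joint_cover (fob F i) K (M i) (a i) (h i) \<and> n i \<in> hom C (M i) B \<and>
      monic C (n i) \<and> n i \<cdot> a i = m \<cdot> \<alpha> i \<and> n i \<cdot> h i = b" by (elim exE)
  have M: "joint_cover (fob F i) K (M i) (a i) (h i)" and n: "n i \<in> hom C (M i) B" "monic C (n i)"
    and na: "n i \<cdot> a i = m \<cdot> \<alpha> i" and nh: "n i \<cdot> h i = b" if "i \<in> I" for i using all that by simp_all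
  note a = joint_cover_hom(1)[OF M] and h = joint_cover_hom(2)[OF M]
  have naF: "n j \<cdot> a j \<cdot> far F (i, j) = n i \<cdot> a i" if r: "(i, j) \<in> r" for i j
  proof -
    note f = diagram_hom[OF d(1) r]
    have "n j \<cdot> a j \<cdot> far F (i, j) = (m \<cdot> \<alpha> j) \<cdot> far F (i, j)"
      using assoc[OF f a[OF rI(2)[OF r]] n(1)[OF rI(2)[OF r]]] na[OF rI(2)[OF r]] by simp
    also have "\<dots> = m \<cdot> \<alpha> i" using assoc[OF f \<alpha>[OF rI(2)[OF r]] m(3)] \<alpha>c[OF r] by simp
    finally show ?thesis using na[OF rI(1)[OF r]] by simp
  qed
  have w: "\<exists>w\<in>hom C (M i) (M j). n j \<cdot> w = n i" if r: "(i, j) \<in> r" for i j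
  proof (rule joint_cover_fill_in[OF M[OF rI(1)[OF r]] n(2,1)[OF rI(2)[OF r]] n(1)[OF rI(1)[OF r]]])
    show "a j \<cdot> far F (i, j) \<in> hom C (fob F i) (M j)" by (rule comp_hom[OF diagram_hom[OF d(1) r] a[OF rI(2)[OF r]]])
    show "h j \<in> hom C K (M j)" by (rule h[OF rI(2)[OF r]])
    show "n j \<cdot> a j \<cdot> far F (i, j) = n i \<cdot> a i" by (rule naF[OF r])
    show "n j \<cdot> h j = n i \<cdot> h i" using nh rI[OF r] by simp
  qed
  \<comment> \<open>The union \<open>L\<close> is the subobject of \<open>B\<close> generated by \<open>A\<close> and \<open>b\<close>.\<close>
  obtain E L \<beta> v where E: "directed_diagram C I r E" "\<And>i. fob E i = M i"
    and nE: "\<And>i j. (i, j) \<in> r \<Longrightarrow> n j \<cdot> far E (i, j) = n i"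
    and L: "is_colimit (poset_cat I r) C E L \<beta>" and v: "v \<in> hom C L B" "monic C v" "\<And>i. i \<in> I \<Longrightarrow> v \<cdot> \<beta> i = n i"
    by (rule directed_union[OF d(7) dp n w]) blast+
  have \<beta>: "\<beta> i \<in> hom C (M i) L" if "i \<in> I" for i using colimit_hom[OF L] that E(2) by simp
  have Eh: "far E (i, j) \<in> hom C (M i) (M j)" if "(i, j) \<in> r" for i j
    using diagram_hom[OF directed_diagramD(1)[OF E(1)] that] E(2) by simp
  have \<beta>c: "\<beta> j \<cdot> far E (i, j) = \<beta> i" if "(i, j) \<in> r" for i j using colimit_comm[OF L, of "(i, j)"] that by simp
  have aE: "a j \<cdot> far F (i, j) = far E (i, j) \<cdot> a i" if r: "(i, j) \<in> r" for i j
  proof (rule monicD[OF n(2,1)[OF rI(2)[OF r]]])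
    show "a j \<cdot> far F (i, j) \<in> hom C (fob F i) (M j)" by (rule comp_hom[OF diagram_hom[OF d(1) r] a[OF rI(2)[OF r]]])
    show "far E (i, j) \<cdot> a i \<in> hom C (fob F i) (M j)" by (rule comp_hom[OF a[OF rI(1)[OF r]] Eh[OF r]])
    show "n j \<cdot> a j \<cdot> far F (i, j) = n j \<cdot> far E (i, j) \<cdot> a i"
      using naF[OF r] assoc[OF a[OF rI(1)[OF r]] Eh[OF r] n(1)[OF rI(2)[OF r]]] nE[OF r] by simp
  qed
  have hE: "far E (i, j) \<cdot> h i = h j" if r: "(i, j) \<in> r" for i j
  proof (rule monicD[OF n(2,1)[OF rI(2)[OF r]] comp_hom[OF h[OF rI(1)[OF r]] Eh[OF r]] h[OF rI(2)[OF r]]])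
    show "n j \<cdot> far E (i, j) \<cdot> h i = n j \<cdot> h j"
      using assoc[OF h[OF rI(1)[OF r]] Eh[OF r] n(1)[OF rI(2)[OF r]]] nE[OF r] nh rI[OF r] by simp
  qed
  have "is_cocone (poset_cat I r) C F L (\<lambda>i. \<beta> i \<cdot> a i)"
    proof (rule poset_coconeI)
    show "L \<in> Ob C" by (rule hom_Ob(1)[OF v(1)])
    show "\<beta> i \<cdot> a i \<in> hom C (fob F i) L" if "i \<in> I" for i using comp_hom[OF a \<beta>] that by simp
    fix i j assume r: "(i, j) \<in> r"
    have "(\<beta> j \<cdot> a j) \<cdot> far F (i, j) = \<beta> j \<cdot> far E (i, j) \<cdot> a i"
      using assoc[OF diagram_hom[OF d(1) r] a[OF rI(2)[OF r]] \<beta>[OF rI(2)[OF r]]] aE[OF r] by simp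
    also have "\<dots> = \<beta> i \<cdot> a i" using assoc[OF a[OF rI(1)[OF r]] Eh[OF r] \<beta>[OF rI(2)[OF r]]] \<beta>c[OF r] by simp
    finally show "(\<beta> j \<cdot> a j) \<cdot> far F (i, j) = \<beta> i \<cdot> a i" .
  qed
  then obtain z where z: "z \<in> hom C A L" "\<And>i. i \<in> I \<Longrightarrow> z \<cdot> \<alpha> i = \<beta> i \<cdot> a i"
    using poset_colimit_desc[OF A] by blast
  have vz: "v \<cdot> z = m"
  proof (rule colimit_eqI[OF d(1) A comp_hom[OF z(1) v(1)] m(3)])
    fix i assume "i \<in> Ob (poset_cat I r)"
    then have i: "i \<in> I" by simp
    show "(v \<cdot> z) \<cdot> \<alpha> i = m \<cdot> \<alpha> i"
      using assoc[OF \<alpha>[OF i] z(1) v(1)] z(2)[OF i] assoc[OF a[OF i] \<beta>[OF i] v(1)] v(3)[OF i] na[OF i] by simp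
  qed
  have LO: "L \<in> Ob C" by (rule hom_Ob(1)[OF v(1)])
  \<comment> \<open>All of \<open>B\<close> is the dominion of \<open>A\<close>, so amalgamation makes \<open>A\<close> epic in \<open>L\<close>.\<close>
  have ze: "epic C z"
  proof (rule epic_into_dominion[OF AP v(2,1) z(1) Id_hom[OF LO]])
    show "x = y" if "x \<in> hom C L Z" "y \<in> hom C L Z" "x \<cdot> Id C L = y \<cdot> Id C L" for Z x y
      using that comp_Id by simp
    show "s \<cdot> v \<cdot> Id C L = t \<cdot> v \<cdot> Id C L" if "s \<in> hom C B Z" "t \<in> hom C B Z" "s \<cdot> v \<cdot> z = t \<cdot> v \<cdot> z" for Z s t
      using epicD[OF m(2,3) that(1,2)] that(3) vz by simp
  qed
  \<comment> \<open>The cokernel pairs of the arrows \<open>a i : F i \<rightarrow> M i\<close> form a directed diagram \<open>H\<close>.\<close>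
  have "\<forall>i. \<exists>P p q. i \<in> I \<longrightarrow> is_cokernel_pair (a i) P p q" using cokernel_pair_exists[OF a] by metis
  then obtain P p q where P: "\<And>i. i \<in> I \<Longrightarrow> is_cokernel_pair (a i) (P i) (p i) (q i)" by metis
  have pq: "p i \<in> hom C (M i) (P i)" "q i \<in> hom C (M i) (P i)" "p i \<cdot> a i = q i \<cdot> a i" if "i \<in> I" for i
    using cokernel_pair_hom[OF P[OF that] a[OF that]] by blast+
  have "\<exists>g. g \<in> hom C (P i) (P j) \<and> g \<cdot> p i = p j \<cdot> far E (i, j) \<and> g \<cdot> q i = q j \<cdot> far E (i, j)"
    if r: "(i, j) \<in> r" for i j
  proof -
    note pj = pq[OF rI(2)[OF r]] and ai = a[OF rI(1)[OF r]] and aj = a[OF rI(2)[OF r]]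
    note f = diagram_hom[OF d(1) r]
    have "(p j \<cdot> far E (i, j)) \<cdot> a i = (p j \<cdot> a j) \<cdot> far F (i, j)"
      using assoc[OF ai Eh[OF r] pj(1)] assoc[OF f aj pj(1)] aE[OF r] by simp
    moreover have "(q j \<cdot> far E (i, j)) \<cdot> a i = (q j \<cdot> a j) \<cdot> far F (i, j)"
      using assoc[OF ai Eh[OF r] pj(2)] assoc[OF f aj pj(2)] aE[OF r] by simp
    ultimately show ?thesis
      using cokernel_pair_copair[OF P[OF rI(1)[OF r]] ai comp_hom[OF Eh[OF r] pj(1)] comp_hom[OF Eh[OF r] pj(2)]] pj(3)
      by metis
  qed
  then have "\<forall>u. \<exists>g. u \<in> r \<longrightarrow> g \<in> hom C (P (fst u)) (P (snd u)) \<and> g \<cdot> p (fst u) = p (snd u) \<cdot> far E u \<and>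
      g \<cdot> q (fst u) = q (snd u) \<cdot> far E u" by (metis prod.collapse)
  then obtain g where g_all: "\<And>u. u \<in> r \<Longrightarrow> g u \<in> hom C (P (fst u)) (P (snd u)) \<and> g u \<cdot> p (fst u) = p (snd u) \<cdot> far E u \<and>
      g u \<cdot> q (fst u) = q (snd u) \<cdot> far E u" by metis
  have g: "g (i, j) \<in> hom C (P i) (P j)" "g (i, j) \<cdot> p i = p j \<cdot> far E (i, j)" "g (i, j) \<cdot> q i = q j \<cdot> far E (i, j)"
    if "(i, j) \<in> r" for i j using g_all[OF that] by simp_all
  define H where "H = \<lparr>fob = P, far = g\<rparr>"
  note dE = directed_diagramD[OF E(1)]
  have "is_functor (poset_cat I r) C H"
    unfolding H_def
  proof (rule poset_functorI[OF po])
    show PO: "P i \<in> Ob C" if "i \<in> I" for i by (rule hom_Ob(2)[OF pq(1)[OF that]])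
    show "g (i, j) \<in> hom C (P i) (P j)" if "(i, j) \<in> r" for i j by (rule g(1)[OF that])
    show "g (i, i) = Id C (P i)" if i: "i \<in> I" for i
    proof -
      have Ei: "far E (i, i) = Id C (M i)" using functorD(4)[OF dE(1), of i] i E(2) by (simp add: poset_cat_def)
      show ?thesis
        by (rule cokernel_pair_eqI[OF P[OF i] g(1)[OF d(2)[OF i]] Id_hom[OF PO[OF i]]])
          (use g(2,3)[OF d(2)[OF i]] Ei comp_Id[OF pq(1)[OF i]] comp_Id[OF pq(2)[OF i]] Id_comp[OF pq(1)[OF i]] Id_comp[OF pq(2)[OF i]] in simp_all)
    qed
    fix i j k assume ij: "(i, j) \<in> r" and jk: "(j, k) \<in> r"
    note ik = d(4)[OF ij jk]
    note i = rI(1)[OF ij] and j = rI(2)[OF ij] and k = rI(2)[OF jk]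
    have Ec: "far E (i, k) = far E (j, k) \<cdot> far E (i, j)" by (rule diagram_comp[OF dE(1) ij jk])
    \<comment> \<open>Used for both coprojections: \<open>s\<close> stands for \<open>p\<close> or \<open>q\<close>.\<close>
    have *: "g (i, k) \<cdot> s i = (g (j, k) \<cdot> g (i, j)) \<cdot> s i"
      if s: "\<And>i. i \<in> I \<Longrightarrow> s i \<in> hom C (M i) (P i)" "\<And>i j. (i, j) \<in> r \<Longrightarrow> g (i, j) \<cdot> s i = s j \<cdot> far E (i, j)" for s
    proof -
      have "(g (j, k) \<cdot> g (i, j)) \<cdot> s i = g (j, k) \<cdot> s j \<cdot> far E (i, j)"
        using assoc[OF s(1)[OF i] g(1)[OF ij] g(1)[OF jk]] s(2)[OF ij] by simp
      also have "\<dots> = s k \<cdot> far E (j, k) \<cdot> far E (i, j)"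
        using assoc[OF Eh[OF ij] s(1)[OF j] g(1)[OF jk]] s(2)[OF jk] assoc[OF Eh[OF ij] Eh[OF jk] s(1)[OF k]] by simp
      finally show ?thesis using s(2)[OF ik] Ec by simp
    qed
    show "g (i, k) = g (j, k) \<cdot> g (i, j)"
      by (rule cokernel_pair_eqI[OF P[OF i] g(1)[OF ik] comp_hom[OF g(1)[OF ij] g(1)[OF jk]] *[of p] *[of q]])
        (use pq g in auto)
  qed
  then have DH: "directed_diagram C I r H" using D unfolding directed_diagram_def by blast
  obtain Q \<pi> where Q: "is_colimit (poset_cat I r) C H Q \<pi>" by (rule directed_colimit_exists[OF DH])
  have \<pi>: "\<pi> i \<in> hom C (P i) Q" if "i \<in> I" for i using colimit_hom[OF Q] that by (simp add: H_def)
  have \<pi>c: "\<pi> j \<cdot> g (i, j) = \<pi> i" if "(i, j) \<in> r" for i j using colimit_comm[OF Q, of "(i, j)"] that by (simp add: H_def)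
  have ex: "\<exists>x\<in>hom C L Q. \<forall>i\<in>I. x \<cdot> \<beta> i = \<pi> i \<cdot> s i"
    if s: "\<And>i. i \<in> I \<Longrightarrow> s i \<in> hom C (M i) (P i)" "\<And>i j. (i, j) \<in> r \<Longrightarrow> g (i, j) \<cdot> s i = s j \<cdot> far E (i, j)" for s
  proof -
    have "is_cocone (poset_cat I r) C E Q (\<lambda>i. \<pi> i \<cdot> s i)"
      proof (rule poset_coconeI)
      show "Q \<in> Ob C" using d(6) hom_Ob(2)[OF \<pi>] by blast
      show "\<pi> i \<cdot> s i \<in> hom C (fob E i) Q" if "i \<in> I" for i
        using comp_hom[OF s(1) \<pi>] that E(2) by simp
      fix i j assume r: "(i, j) \<in> r"
      have "(\<pi> j \<cdot> s j) \<cdot> far E (i, j) = \<pi> j \<cdot> g (i, j) \<cdot> s i"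
        using assoc[OF Eh[OF r] s(1)[OF rI(2)[OF r]] \<pi>[OF rI(2)[OF r]]] s(2)[OF r] by simp
      also have "\<dots> = \<pi> i \<cdot> s i" using assoc[OF s(1)[OF rI(1)[OF r]] g(1)[OF r] \<pi>[OF rI(2)[OF r]]] \<pi>c[OF r] by simp
      finally show "(\<pi> j \<cdot> s j) \<cdot> far E (i, j) = \<pi> i \<cdot> s i" .
    qed
    then show ?thesis by (rule poset_colimit_desc[OF L])
  qed
  \<comment> \<open>In the colimit the coprojections induce arrows out of \<open>L\<close> that agree on \<open>A\<close>, hence agree.\<close>
  obtain x where x: "x \<in> hom C L Q" "\<And>i. i \<in> I \<Longrightarrow> x \<cdot> \<beta> i = \<pi> i \<cdot> p i" using ex[of p] pq(1) g(2) by blast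
  obtain y where y: "y \<in> hom C L Q" "\<And>i. i \<in> I \<Longrightarrow> y \<cdot> \<beta> i = \<pi> i \<cdot> q i" using ex[of q] pq(2) g(3) by blast
  have "x \<cdot> z = y \<cdot> z"
  proof (rule colimit_eqI[OF d(1) A comp_hom[OF z(1) x(1)] comp_hom[OF z(1) y(1)]])
    fix i assume "i \<in> Ob (poset_cat I r)"
    then have i: "i \<in> I" by simp
    have "(x \<cdot> z) \<cdot> \<alpha> i = \<pi> i \<cdot> p i \<cdot> a i"
      using assoc[OF \<alpha>[OF i] z(1) x(1)] z(2)[OF i] assoc[OF a[OF i] \<beta>[OF i] x(1)] x(2)[OF i]
        assoc[OF a[OF i] pq(1)[OF i] \<pi>[OF i]] by simp
    also have "\<dots> = (y \<cdot> z) \<cdot> \<alpha> i"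
      using assoc[OF \<alpha>[OF i] z(1) y(1)] z(2)[OF i] assoc[OF a[OF i] \<beta>[OF i] y(1)] y(2)[OF i]
        assoc[OF a[OF i] pq(2)[OF i] \<pi>[OF i]] pq(3)[OF i] by simp
    finally show "(x \<cdot> z) \<cdot> \<alpha> i = (y \<cdot> z) \<cdot> \<alpha> i" .
  qed
  then have xy: "x = y" by (rule epicD[OF ze z(1) x(1) y(1)])
  \<comment> \<open>In particular they agree on \<open>b\<close>, and since \<open>K\<close> is finitely presentable they do so at a stage \<open>k\<close>.\<close>
  obtain i where i: "i \<in> I" using d(6) by blast
  have "\<pi> i \<cdot> p i \<cdot> h i = \<pi> i \<cdot> q i \<cdot> h i"
    using assoc[OF h[OF i] pq(1)[OF i] \<pi>[OF i]] assoc[OF h[OF i] pq(2)[OF i] \<pi>[OF i]] x(2)[OF i] y(2)[OF i] xy by simp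
  then obtain k where k: "k \<in> I" "(i, k) \<in> r" "g (i, k) \<cdot> p i \<cdot> h i = g (i, k) \<cdot> q i \<cdot> h i"
    using fp_eventually_equal[OF K DH Q i _ i] comp_hom[OF h[OF i] pq(1)[OF i]] comp_hom[OF h[OF i] pq(2)[OF i]]
    unfolding H_def by auto
  have *: "g (i, k) \<cdot> s i \<cdot> h i = s k \<cdot> h k"
    if s: "\<And>i. i \<in> I \<Longrightarrow> s i \<in> hom C (M i) (P i)" "\<And>i j. (i, j) \<in> r \<Longrightarrow> g (i, j) \<cdot> s i = s j \<cdot> far E (i, j)" for s
    using assoc[OF h[OF i] s(1)[OF i] g(1)[OF k(2)]] s(2)[OF k(2)] assoc[OF h[OF i] Eh[OF k(2)] s(1)[OF k(1)]] hE[OF k(2)] by simp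
  have "p k \<cdot> h k = q k \<cdot> h k" using k(3) *[of p] *[of q] pq g by simp
  then have pqk: "p k = q k" using joint_cover_epic[OF M[OF k(1)] pq(1,2)[OF k(1)] pq(3)[OF k(1)]] by blast
  have "epic C (a k)"
  proof (rule epicI[OF a[OF k(1)]])
    fix X s t assume s: "s \<in> hom C (M k) X" and t: "t \<in> hom C (M k) X" and st: "s \<cdot> a k = t \<cdot> a k"
    show "s = t" by (rule cokernel_pair_copair[OF P[OF k(1)] a[OF k(1)] s t st]) (simp add: pqk)
  qed
  moreover have "finitely_generated C (fob F k)" using Ffp k(1) fp_fg by blast
  moreover have "finitely_generated C (M k)"
    by (rule joint_cover_fg[OF M[OF k(1)] _ fp_fg[OF K]]) (use Ffp k(1) fp_fg in blast)
  ultimately have "extremal_epi C (a k)" using WES a[OF k(1)] unfolding WES_def by (simp add: hom_iff)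
  then obtain w where w: "w \<in> hom C (M k) A" "m \<cdot> w = n k"
    using fill_in[OF _ a[OF k(1)] m(1,3) \<alpha>[OF k(1)] n(1)[OF k(1)]] na[OF k(1)] by metis
  have "m \<cdot> w \<cdot> h k = b" using assoc[OF h[OF k(1)] w(1) m(3)] w(2) nh[OF k(1)] by simp
  then show ?thesis using comp_hom[OF h[OF k(1)] w(1)] by blast
qed

text \<open>
  The lifts of the injections of a presentation of \<open>B\<close> are compatible, as \<open>m\<close> is monic, and they
  induce a section of \<open>m\<close>.
\<close>

lemma fp_lift_iso:
  assumes m: "monic C m" "m \<in> hom C A B"
    and l: "\<And>K b. finitely_presentable C K \<Longrightarrow> b \<in> hom C K B \<Longrightarrow> \<exists>d\<in>hom C K A. m \<cdot> d = b"
  shows "isomorphism C m"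
proof -
  obtain I r F \<iota> where D: "directed_diagram C I r F" and Ffp: "\<forall>i\<in>I. finitely_presentable C (fob F i)"
    and B: "is_colimit (poset_cat I r) C F B \<iota>" by (rule fp_diagram[OF hom_Ob(2)[OF m(2)]])
  note d = directed_diagramD[OF D]
  note i = poset_colimit_hom[OF B]
  have "\<forall>i. \<exists>k. i \<in> I \<longrightarrow> k \<in> hom C (fob F i) A \<and> m \<cdot> k = \<iota> i" using l i Ffp by blast
  then obtain k where k: "\<And>i. i \<in> I \<Longrightarrow> k i \<in> hom C (fob F i) A" "\<And>i. i \<in> I \<Longrightarrow> m \<cdot> k i = \<iota> i" by metis
  have "is_cocone (poset_cat I r) C F A k"
    proof (rule poset_coconeI)
    show "A \<in> Ob C" by (rule hom_Ob(1)[OF m(2)])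
    show "k i \<in> hom C (fob F i) A" if "i \<in> I" for i using k(1) that by simp
    fix i j assume r: "(i, j) \<in> r"
    then have I: "i \<in> I" "j \<in> I" using d(3) by blast+
    note f = diagram_hom[OF d(1) r]
    have "m \<cdot> k j \<cdot> far F (i, j) = m \<cdot> k i"
      using assoc[OF f k(1)[OF I(2)] m(2)] k(2) I poset_colimit_comm[OF B r] by simp
    then have "k j \<cdot> far F (i, j) = k i" by (rule monicD[OF m comp_hom[OF f k(1)[OF I(2)]] k(1)[OF I(1)]])
    then show "k j \<cdot> far F (i, j) = k i" .
  qed
  then obtain s where s: "s \<in> hom C B A" "\<And>i. i \<in> I \<Longrightarrow> s \<cdot> \<iota> i = k i"
    using poset_colimit_desc[OF B] by blast
  have "m \<cdot> s = Id C B"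
  proof (rule colimit_eqI[OF d(1) B comp_hom[OF s(1) m(2)] Id_hom[OF hom_Ob(2)[OF m(2)]]])
    fix j assume "j \<in> Ob (poset_cat I r)"
    then have j: "j \<in> I" by simp
    show "(m \<cdot> s) \<cdot> \<iota> j = Id C B \<cdot> \<iota> j" using assoc[OF i[OF j] s(1) m(2)] s(2)[OF j] k(2)[OF j] Id_comp[OF i[OF j]] by simp
  qed
  then show ?thesis by (rule split_epi_monic_iso[OF m s(1)])
qed

lemma WES_imp_ES:
  assumes AP: "amalgamation_property C" and WES: "WES C"
  shows "ES C"
  by (rule ES_I) (rule fp_lift_iso, assumption, assumption, rule WES_lift[OF AP WES])

end

section \<open>Products, equalisers and continuous functors\<close>

text \<open>
  A compatible family of points is a cone whose vertex is a singleton.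
\<close>

lemma set_limit_point:
  fixes H :: "('j, 'k, 'x set, 'x setarr) func"
  assumes U: "universe TYPE('u)" and H: "is_functor J (set_cat TYPE('u)) H" and L: "is_limit J (set_cat TYPE('u)) H X \<pi>"
    and x: "\<And>j. j \<in> Ob J \<Longrightarrow> x j \<in> fob H j"
    and c: "\<And>u. u \<in> Ar J \<Longrightarrow> fn (far H u) (x (Dom J u)) = x (Cod J u)"
  obtains y where "y \<in> X" "\<And>j. j \<in> Ob J \<Longrightarrow> fn (\<pi> j) y = x j"
proof -
  let ?S = "set_cat TYPE('u) :: ('x set, 'x setarr) cat" and ?Z = "{undefined :: 'x}"
  let ?k = "\<lambda>j. SetArr ?Z (\<lambda>_\<in>?Z. x j) (fob H j)"
  have Z: "small TYPE('u) ?Z" by (rule small_finite[OF U]) simp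
  have J: "Dom J u \<in> Ob J" "Cod J u \<in> Ob J" if "u \<in> Ar J" for u
    using cat.Ar_Ob[OF cat.intro[OF functorD(1)[OF H]] that] by blast+
  have k: "?k j \<in> hom ?S ?Z (fob H j)" if "j \<in> Ob J" for j
    using x[OF that] functorD(2)[OF H that] Z by (auto simp: set_cat_hom set_cat_Ob)
  have "is_cone J ?S H ?Z ?k"
    unfolding is_cone_def
  proof (intro conjI ballI)
    show "?Z \<in> Ob ?S" using Z by (simp add: set_cat_def)
    show "?k j \<in> hom ?S ?Z (fob H j)" if "j \<in> Ob J" for j by (rule k[OF that])
    fix u assume u: "u \<in> Ar J"
    have "trg (far H u) = fob H (Cod J u)" using functorD(3)[OF H u] by (simp add: set_cat_hom)
    then show "Comp ?S (far H u) (?k (Dom J u)) = ?k (Cod J u)"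
      using c[OF u] by (auto simp: set_cat_comp compose_def)
  qed
  then obtain h where h: "h \<in> hom ?S ?Z X" "\<forall>j\<in>Ob J. Comp ?S (\<pi> j) h = ?k j"
    using L unfolding is_limit_def by blast
  have "fn (\<pi> j) (fn h undefined) = x j" if "j \<in> Ob J" for j
  proof -
    have "fn (Comp ?S (\<pi> j) h) undefined = fn (?k j) undefined" using h(2) that by simp
    then show ?thesis using h(1) by (simp add: set_cat_comp set_cat_hom compose_def)
  qed
  moreover have "fn h undefined \<in> X" using h(1) by (auto simp: set_cat_hom)
  ultimately show ?thesis using that by blast
qed

lemma comp_functor:
  assumes F: "is_functor J C F" and H: "is_functor C D H"
  shows "is_functor J D (comp_func H F)"
proof -
  have O: "fob F (Dom J u) \<in> Ob C" "fob F (Cod J u) \<in> Ob C" if "u \<in> Ar J" for u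
    using functorD(2)[OF F] cat.Ar_Ob[OF cat.intro[OF functorD(1)[OF F]] that] by blast+
  have A: "far F u \<in> Ar C" "Dom C (far F u) = fob F (Dom J u)" "Cod C (far F u) = fob F (Cod J u)" if "u \<in> Ar J" for u
    using functorD(3)[OF F that] by (simp_all add: hom_def)
  show ?thesis
    unfolding is_functor_def
    using functorD(1,2,4,5)[OF F] functorD(1)[OF F] functorD(2,4,5)[OF H] H functorD(3)[OF H A(1)] A
    by (simp add: comp_func_def is_functor_def)
qed

context projectively_generated_cat
begin

text \<open>
  The elements of a product must be the families of elements of the factors. So the product is
  built as the quotient of the copower of \<open>G\<close> over the set \<open>?S\<close> of all these families by the
  pairs that no projection distinguishes. It has enough elements by construction, and since
  elements of the quotient lift, the projections are jointly injective on elements.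
\<close>

lemma product_exists:
  assumes R: "small TYPE('u) R" and A: "\<And>r. r \<in> R \<Longrightarrow> A r \<in> Ob C"
  obtains N \<pi> where "N \<in> Ob C" "\<And>r. r \<in> R \<Longrightarrow> \<pi> r \<in> hom C N (A r)"
    "\<And>Y \<kappa>. Y \<in> Ob C \<Longrightarrow> (\<And>r. r \<in> R \<Longrightarrow> \<kappa> r \<in> hom C Y (A r)) \<Longrightarrow> \<exists>!h. h \<in> hom C Y N \<and> (\<forall>r\<in>R. \<pi> r \<cdot> h = \<kappa> r)"
proof -
  let ?S = "\<Pi>\<^sub>E r\<in>R. hom C G (A r)"
  have small: "small TYPE('u) ?S" by (rule small_PiE[OF universe R small_hom[OF G_Ob A]])
  obtain P \<iota> where P: "is_coprod ?S (\<lambda>_. G) P \<iota>" by (rule coprod_exists[OF small, of "\<lambda>_. G", OF G_Ob])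
  have "\<exists>p\<in>hom C P (A r). \<forall>s\<in>?S. p \<cdot> \<iota> s = s r" if r: "r \<in> R" for r
  proof -
    have "s r \<in> hom C G (A r)" if "s \<in> ?S" for s using that r by (rule PiE_mem)
    then have "\<exists>!h. h \<in> hom C P (A r) \<and> (\<forall>s\<in>?S. h \<cdot> \<iota> s = s r)" by (rule coprod_ex1[OF P A[OF r]])
    then show ?thesis by blast
  qed
  then obtain p where p: "\<And>r. r \<in> R \<Longrightarrow> p r \<in> hom C P (A r)" "\<And>r s. r \<in> R \<Longrightarrow> s \<in> ?S \<Longrightarrow> p r \<cdot> \<iota> s = s r" by metis
  let ?K = "{(u, v). u \<in> hom C G P \<and> v \<in> hom C G P \<and> (\<forall>r\<in>R. p r \<cdot> u = p r \<cdot> v)}"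
  have PO: "P \<in> Ob C" using P by (simp add: is_coprod_def)
  obtain c N where c: "is_coeq ?K c" "c \<in> hom C P N" "extremal_epi C c" using quotient_exists[OF PO, of ?K] by blast
  have NO: "N \<in> Ob C" by (rule hom_Ob(2)[OF c(2)])
  have "\<exists>k\<in>hom C N (A r). k \<cdot> c = p r" if r: "r \<in> R" for r
    using coeq_factor[OF c(1,2) p(1)[OF r]] r by blast
  then obtain \<pi> where \<pi>: "\<And>r. r \<in> R \<Longrightarrow> \<pi> r \<in> hom C N (A r)" "\<And>r. r \<in> R \<Longrightarrow> \<pi> r \<cdot> c = p r" by metis
  have joint: "x = y" if x: "x \<in> hom C G N" and y: "y \<in> hom C G N" and e: "\<And>r. r \<in> R \<Longrightarrow> \<pi> r \<cdot> x = \<pi> r \<cdot> y" for x y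
  proof -
    obtain u where u: "u \<in> hom C G P" "c \<cdot> u = x" by (rule extremal_lift[OF c(3,2) x])
    obtain v where v: "v \<in> hom C G P" "c \<cdot> v = y" by (rule extremal_lift[OF c(3,2) y])
    have "p r \<cdot> u = p r \<cdot> v" if r: "r \<in> R" for r
      using assoc[OF u(1) c(2) \<pi>(1)[OF r]] assoc[OF v(1) c(2) \<pi>(1)[OF r]] \<pi>(2)[OF r] u(2) v(2) e[OF r] by simp
    then have "(u, v) \<in> ?K" using u(1) v(1) by blast
    then show ?thesis using c(1) u(2) v(2) unfolding is_coeq_def by blast
  qed
  have univ: "\<exists>!h. h \<in> hom C Y N \<and> (\<forall>r\<in>R. \<pi> r \<cdot> h = \<kappa> r)"
    if Y: "Y \<in> Ob C" and k: "\<And>r. r \<in> R \<Longrightarrow> \<kappa> r \<in> hom C Y (A r)" for Y \<kappa>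
  proof -
    obtain Q \<iota>' e where Q: "is_coprod (hom C G Y) (\<lambda>_. G) Q \<iota>'" and e: "e \<in> hom C Q Y"
      "\<And>x. x \<in> hom C G Y \<Longrightarrow> e \<cdot> \<iota>' x = x" "extremal_epi C e" using canonical_cover[OF Y] by blast
    define s where "s y = (\<lambda>r\<in>R. \<kappa> r \<cdot> y)" for y
    have s: "s y \<in> ?S" if y: "y \<in> hom C G Y" for y unfolding s_def using comp_hom[OF y k] by auto
    obtain t where t: "t \<in> hom C Q N" "\<And>y. y \<in> hom C G Y \<Longrightarrow> t \<cdot> \<iota>' y = c \<cdot> \<iota> (s y)"
      using coprod_copair[OF Q NO, of "\<lambda>y. c \<cdot> \<iota> (s y)"] comp_hom[OF coprod_hom[OF P s] c(2)] by blast
    have \<pi>t: "\<pi> r \<cdot> t = \<kappa> r \<cdot> e" if r: "r \<in> R" for r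
    proof (rule coprod_eqI[OF Q comp_hom[OF t(1) \<pi>(1)[OF r]] comp_hom[OF e(1) k[OF r]]])
      fix y assume y: "y \<in> hom C G Y"
      have "(\<pi> r \<cdot> t) \<cdot> \<iota>' y = s y r"
        using assoc[OF coprod_hom[OF Q y] t(1) \<pi>(1)[OF r]] t(2)[OF y]
          assoc[OF coprod_hom[OF P s[OF y]] c(2) \<pi>(1)[OF r]] \<pi>(2)[OF r] p(2)[OF r s[OF y]] by simp
      then show "(\<pi> r \<cdot> t) \<cdot> \<iota>' y = (\<kappa> r \<cdot> e) \<cdot> \<iota>' y"
        using assoc[OF coprod_hom[OF Q y] e(1) k[OF r]] e(2)[OF y] r by (simp add: s_def)
    qed
    have "t \<cdot> u = t \<cdot> v" if u: "u \<in> hom C G Q" and v: "v \<in> hom C G Q" and uv: "e \<cdot> u = e \<cdot> v" for u v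
    proof (rule joint[OF comp_hom[OF u t(1)] comp_hom[OF v t(1)]])
      fix r assume r: "r \<in> R"
      show "\<pi> r \<cdot> t \<cdot> u = \<pi> r \<cdot> t \<cdot> v"
        using assoc[OF u t(1) \<pi>(1)[OF r]] assoc[OF v t(1) \<pi>(1)[OF r]] \<pi>t[OF r] assoc[OF u e(1) k[OF r]]
          assoc[OF v e(1) k[OF r]] uv by simp
    qed
    then obtain h where h: "h \<in> hom C Y N" "h \<cdot> e = t" using extremal_descent[OF e(3,1) t(1)] by blast
    have \<pi>h: "\<pi> r \<cdot> h = \<kappa> r" if r: "r \<in> R" for r
    proof (rule epicD[OF extremal_epic[OF e(3)] e(1) comp_hom[OF h(1) \<pi>(1)[OF r]] k[OF r]])
      show "(\<pi> r \<cdot> h) \<cdot> e = \<kappa> r \<cdot> e" using assoc[OF e(1) h(1) \<pi>(1)[OF r]] h(2) \<pi>t[OF r] by simp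
    qed
    show ?thesis
    proof (rule ex1I[of _ h])
      show "h \<in> hom C Y N \<and> (\<forall>r\<in>R. \<pi> r \<cdot> h = \<kappa> r)" using h(1) \<pi>h by blast
      fix h' assume h': "h' \<in> hom C Y N \<and> (\<forall>r\<in>R. \<pi> r \<cdot> h' = \<kappa> r)"
      then have h'h: "h' \<in> hom C Y N" by blast
      show "h' = h"
      proof (rule separates[OF h'h h(1)])
        fix x assume x: "x \<in> hom C G Y"
        show "h' \<cdot> x = h \<cdot> x"
          by (rule joint[OF comp_hom[OF x h'h] comp_hom[OF x h(1)]])
            (use assoc[OF x h'h \<pi>(1)] assoc[OF x h(1) \<pi>(1)] h' \<pi>h in metis)
      qed
    qed
  qed
  show ?thesis by (rule that[OF NO \<pi>(1) univ])
qed

lemma continuous_product_point: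
  fixes D :: "('o, 'u, 'x set, 'x setarr) func" and R :: "'u set"
  assumes D: "is_functor C (set_cat TYPE('u)) D" "continuous_domain C D" and R: "small TYPE('u) R"
    and A: "\<And>r. r \<in> R \<Longrightarrow> A r \<in> Ob C" and x: "\<And>r. r \<in> R \<Longrightarrow> x r \<in> fob D (A r)"
  obtains N \<pi> y where "\<And>r. r \<in> R \<Longrightarrow> \<pi> r \<in> hom C N (A r)" "N \<in> Ob C" "y \<in> fob D N"
    "\<And>r. r \<in> R \<Longrightarrow> fn (far D (\<pi> r)) y = x r"
proof -
  obtain N \<pi> where N: "N \<in> Ob C" "\<And>r. r \<in> R \<Longrightarrow> \<pi> r \<in> hom C N (A r)"
    and univ: "\<And>Y \<kappa>. Y \<in> Ob C \<Longrightarrow> (\<And>r. r \<in> R \<Longrightarrow> \<kappa> r \<in> hom C Y (A r)) \<Longrightarrow> \<exists>!h. h \<in> hom C Y N \<and> (\<forall>r\<in>R. \<pi> r \<cdot> h = \<kappa> r)"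
    using product_exists[OF R, of A] A by blast
  let ?J = "discrete_cat R" and ?F = "\<lparr>fob = A, far = (\<lambda>r. Id C (A r))\<rparr>"
  have F: "is_functor ?J C ?F" by (rule discrete_functor[OF A])
  have J: "small_category ?J" using functorD(1)[OF F] R by (simp add: small_category_def discrete_cat_def)
  have cone: "is_cone ?J C ?F Y \<kappa> \<longleftrightarrow> Y \<in> Ob C \<and> (\<forall>r\<in>R. \<kappa> r \<in> hom C Y (A r))" for Y \<kappa>
    unfolding is_cone_def discrete_cat_def using Id_comp by auto
  have "is_limit ?J C ?F N \<pi>"
    unfolding is_limit_def cone using N univ by (simp add: discrete_cat_def)
  then have L: "is_limit ?J (set_cat TYPE('u)) (comp_func D ?F) (fob D N) (\<lambda>j. far D (\<pi> j))"
    using D(2) J F unfolding continuous_domain_def preserves_small_limits_def by blast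
  have "fn (Id (set_cat TYPE('u)) X) y = y" if "y \<in> X" for y :: 'x and X using that by (simp add: set_cat_def)
  then have c: "fn (far (comp_func D ?F) u) (x (Dom ?J u)) = x (Cod ?J u)" if "u \<in> Ar ?J" for u
    using functorD(4)[OF D(1) A] x that by (simp add: comp_func_def discrete_cat_def)
  have OJ: "Ob ?J = R" by (simp add: discrete_cat_def)
  have x': "x j \<in> fob (comp_func D ?F) j" if "j \<in> Ob ?J" for j using x that by (simp add: comp_func_def OJ)
  obtain y where y: "y \<in> fob D N" "\<And>r. r \<in> Ob ?J \<Longrightarrow> fn (far D (\<pi> r)) y = x r"
    using set_limit_point[OF universe comp_functor[OF F D(1)] L, of x, OF x' c] by blast
  show ?thesis by (rule that[OF N(2,1) y[unfolded OJ]])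
qed

lemma continuous_equaliser_point:
  fixes D :: "('o, 'u, 'x set, 'x setarr) func"
  assumes D: "is_functor C (set_cat TYPE('u)) D" "continuous_domain C D" and m: "is_equaliser C m p q"
    and x: "x \<in> fob D (Cod C m)" "fn (far D p) x = fn (far D q) x"
  obtains y where "y \<in> fob D (Dom C m)" "fn (far D m) y = x"
proof -
  obtain c :: "nat \<Rightarrow> 'u" where c: "inj c" by (rule nat_code)
  have d: "c 0 \<noteq> c 1" "c 0 \<noteq> c 2" "c 0 \<noteq> c 3" "c 1 \<noteq> c 2" "c 1 \<noteq> c 3" "c 2 \<noteq> c 3"
    using inj_eq[OF c] by simp_all
  note d = d d[symmetric]
  have mh: "m \<in> hom C (Dom C m) (Cod C m)" and p: "p \<in> hom C (Cod C m) (Cod C p)" and q: "q \<in> hom C (Cod C m) (Cod C p)"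
    and pm: "p \<cdot> m = q \<cdot> m"
    using m unfolding is_equaliser_def by (simp_all add: hom_iff)
  have eq: "\<forall>h\<in>Ar C. Cod C h = Cod C m \<longrightarrow> p \<cdot> h = q \<cdot> h \<longrightarrow> (\<exists>!k. k \<in> hom C (Dom C h) (Dom C m) \<and> m \<cdot> k = h)"
    using m unfolding is_equaliser_def by (elim conjE)
  have e: "Dom C p = Cod C m" using p by (simp add: hom_iff)
  let ?J = "parallel_cat c" and ?F = "parallel_func c C p q"
  note s = parallel_cat_def parallel_func_def
  let ?l = "\<lambda>j. if j = c 0 then m else p \<cdot> m"
  have F: "is_functor ?J C ?F" by (rule parallel_functor[OF universe c p q])
  have cone: "is_cone ?J C ?F Y \<kappa> \<longleftrightarrow> \<kappa> (c 0) \<in> hom C Y (Cod C m) \<and> \<kappa> (c 1) = p \<cdot> \<kappa> (c 0) \<and> p \<cdot> \<kappa> (c 0) = q \<cdot> \<kappa> (c 0)" for Y \<kappa>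
  proof
    assume "is_cone ?J C ?F Y \<kappa>"
    then show "\<kappa> (c 0) \<in> hom C Y (Cod C m) \<and> \<kappa> (c 1) = p \<cdot> \<kappa> (c 0) \<and> p \<cdot> \<kappa> (c 0) = q \<cdot> \<kappa> (c 0)"
      using d unfolding is_cone_def by (simp add: s e)
  next
    assume k: "\<kappa> (c 0) \<in> hom C Y (Cod C m) \<and> \<kappa> (c 1) = p \<cdot> \<kappa> (c 0) \<and> p \<cdot> \<kappa> (c 0) = q \<cdot> \<kappa> (c 0)"
    then have "\<kappa> (c 1) \<in> hom C Y (Cod C p)" using comp_hom[OF _ p] by metis
    then show "is_cone ?J C ?F Y \<kappa>"
      using d k hom_Ob(1)[of "\<kappa> (c 0)" Y "Cod C m"] Id_comp[of "\<kappa> (c 0)" Y "Cod C m"] Id_comp[of "\<kappa> (c 1)" Y "Cod C p"]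
      unfolding is_cone_def by (simp add: s e)
  qed
  have "is_limit ?J C ?F (Dom C m) ?l"
    unfolding is_limit_def
  proof (intro conjI allI impI)
    show "is_cone ?J C ?F (Dom C m) ?l" using d mh pm by (simp add: cone)
    fix Y \<kappa> assume "is_cone ?J C ?F Y \<kappa>"
    then have k: "\<kappa> (c 0) \<in> hom C Y (Cod C m)" "\<kappa> (c 1) = p \<cdot> \<kappa> (c 0)" "p \<cdot> \<kappa> (c 0) = q \<cdot> \<kappa> (c 0)" by (simp_all add: cone)
    have "\<kappa> (c 0) \<in> Ar C" "Cod C (\<kappa> (c 0)) = Cod C m" "Dom C (\<kappa> (c 0)) = Y" using k(1) by (simp_all add: hom_iff)
    then have "\<exists>!h. h \<in> hom C Y (Dom C m) \<and> m \<cdot> h = \<kappa> (c 0)" using eq k(3) by metis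
    moreover have "h \<in> hom C Y (Dom C m) \<and> (\<forall>j\<in>Ob ?J. ?l j \<cdot> h = \<kappa> j) \<longleftrightarrow> h \<in> hom C Y (Dom C m) \<and> m \<cdot> h = \<kappa> (c 0)" for h
      using d assoc[OF _ mh p, of h Y] k(2) by (auto simp: s)
    ultimately show "\<exists>!h. h \<in> hom C Y (Dom C m) \<and> (\<forall>j\<in>Ob ?J. ?l j \<cdot> h = \<kappa> j)" by simp
  qed
  then have L: "is_limit ?J (set_cat TYPE('u)) (comp_func D ?F) (fob D (Dom C m)) (\<lambda>j. far D (?l j))"
    using D(2) parallel_cat_small[OF universe c] F unfolding continuous_domain_def preserves_small_limits_def by blast
  let ?x = "\<lambda>j. if j = c 0 then x else fn (far D p) x"
  have Dp: "far D p \<in> hom (set_cat TYPE('u)) (fob D (Cod C m)) (fob D (Cod C p))"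
    using functorD(3)[OF D(1), of p] p e by (simp add: hom_iff)
  have px: "fn (far D p) x \<in> fob D (Cod C p)" using Dp x(1) by (auto simp: set_cat_hom)
  have "fn (Id (set_cat TYPE('u)) X) y = y" if "y \<in> X" for y :: 'x and X using that by (simp add: set_cat_def)
  then have I: "fn (far D (Id C B)) y = y" if "B \<in> Ob C" "y \<in> fob D B" for B y using functorD(4)[OF D(1) that(1)] that(2) by simp
  have "fn (far D (Id C (Cod C m))) x = x" "fn (far D (Id C (Cod C p))) (fn (far D p) x) = fn (far D p) x"
    using I hom_Ob[OF p] x(1) px by simp_all
  then have c1: "fn (far (comp_func D ?F) u) (?x (Dom ?J u)) = ?x (Cod ?J u)" if "u \<in> Ar ?J" for u
    using that d x by (auto simp: comp_func_def s e)
  have x1: "?x j \<in> fob (comp_func D ?F) j" if "j \<in> Ob ?J" for j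
    using that d x(1) px by (auto simp: comp_func_def s e)
  obtain y where y: "y \<in> fob D (Dom C m)" "\<And>j. j \<in> Ob ?J \<Longrightarrow> fn (far D (?l j)) y = ?x j"
    using set_limit_point[OF universe comp_functor[OF F D(1)] L, of ?x, OF x1 c1] by blast
  have "fn (far D m) y = x" using y(2)[of "c 0"] by (simp add: s)
  with y(1) show ?thesis by (rule that)
qed

end

section \<open>Implicit partial operations\<close>

context projectively_generated_cat
begin

text \<open>
  The functor of elements, which the theorem calls \<open>V\<close>.
\<close>

abbreviation El where "El \<equiv> hom_functor C G"

definition act :: "'i set \<Rightarrow> 'u \<Rightarrow> ('i \<Rightarrow> 'u) \<Rightarrow> 'i \<Rightarrow> 'u" where
  "act I h t = (\<lambda>i\<in>I. h \<cdot> t i)"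

lemma power_fob: "fob (power_functor I El) A = (I \<rightarrow>\<^sub>E hom C G A)"
  by (simp add: power_functor_def hom_functor_def)

lemma power_far:
  assumes h: "h \<in> hom C A B" and t: "t \<in> I \<rightarrow>\<^sub>E hom C G A"
  shows "fn (far (power_functor I El) h) t = act I h t"
proof -
  have "src (far El h) = hom C G A" using h by (simp add: hom_functor_def hom_iff)
  then show ?thesis
    using t hom_functor_fn[OF h] PiE_mem[OF t] by (auto simp: power_functor_def act_def intro!: restrict_ext)
qed

lemma act_mem: "h \<in> hom C A B \<Longrightarrow> t \<in> I \<rightarrow>\<^sub>E hom C G A \<Longrightarrow> act I h t \<in> I \<rightarrow>\<^sub>E hom C G B"
  unfolding act_def by (auto intro!: comp_hom[of _ G A h B] dest: PiE_mem)

lemma act_comp: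
  assumes "h \<in> hom C A B" "k \<in> hom C B D" "t \<in> I \<rightarrow>\<^sub>E hom C G A"
  shows "act I (k \<cdot> h) t = act I k (act I h t)"
  unfolding act_def using assoc[OF PiE_mem[OF assms(3)] assms(1,2)] by (auto intro!: restrict_ext)

lemma act_Id:
  assumes t: "t \<in> I \<rightarrow>\<^sub>E hom C G A"
  shows "act I (Id C A) t = t"
proof -
  have "act I (Id C A) t = restrict t I"
    unfolding act_def by (rule restrict_ext) (rule Id_comp[OF PiE_mem[OF t]])
  then show ?thesis using PiE_restrict[OF t] by simp
qed

lemma operationD:
  assumes f: "implicit_partial_operation C El I D f"
  shows "is_functor C (set_cat TYPE('u)) D" "\<And>A. A \<in> Ob C \<Longrightarrow> fob D A \<subseteq> I \<rightarrow>\<^sub>E hom C G A"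
    "\<And>A B h x. h \<in> hom C A B \<Longrightarrow> x \<in> fob D A \<Longrightarrow> fn (far D h) x = act I h x"
    "\<And>A B h x. h \<in> hom C A B \<Longrightarrow> x \<in> fob D A \<Longrightarrow> act I h x \<in> fob D B"
    "\<And>A x. A \<in> Ob C \<Longrightarrow> x \<in> fob D A \<Longrightarrow> f A x \<in> hom C G A"
    "\<And>A B h x. h \<in> hom C A B \<Longrightarrow> x \<in> fob D A \<Longrightarrow> f B (act I h x) = h \<cdot> f A x"
proof -
  have sub: "subfunctor C D (power_functor I El)" and nat: "set_natural C D El f"
    using f unfolding implicit_partial_operation_def by blast+
  show F: "is_functor C (set_cat TYPE('u)) D" using sub unfolding subfunctor_def by blast
  show D: "fob D A \<subseteq> I \<rightarrow>\<^sub>E hom C G A" if "A \<in> Ob C" for A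
    using sub that unfolding subfunctor_def power_fob by blast
  show far: "fn (far D h) x = act I h x" if h: "h \<in> hom C A B" and x: "x \<in> fob D A" for A B h x
  proof -
    have "h \<in> Ar C" "Dom C h = A" using h by (simp_all add: hom_iff)
    then have "fn (far D h) x = fn (far (power_functor I El) h) x" using sub x unfolding subfunctor_def by blast
    moreover have "x \<in> I \<rightarrow>\<^sub>E hom C G A" using D[OF hom_Ob(1)[OF h]] x by blast
    ultimately show ?thesis using power_far[OF h] by simp
  qed
  show "act I h x \<in> fob D B" if h: "h \<in> hom C A B" and x: "x \<in> fob D A" for A B h x
  proof -
    have "far D h \<in> hom (set_cat TYPE('u)) (fob D A) (fob D B)"
      using functorD(3)[OF F, of h] h by (simp add: hom_iff)
    then have "fn (far D h) \<in> fob D A \<rightarrow>\<^sub>E fob D B" by (simp add: set_cat_hom)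
    then have "fn (far D h) x \<in> fob D B" using x by (rule PiE_mem)
    then show ?thesis using far[OF h x] by simp
  qed
  show val: "f A x \<in> hom C G A" if "A \<in> Ob C" "x \<in> fob D A" for A x
    using nat that unfolding set_natural_def by (auto simp: hom_functor_def)
  show "f B (act I h x) = h \<cdot> f A x" if h: "h \<in> hom C A B" and x: "x \<in> fob D A" for A B h x
  proof -
    have "h \<in> Ar C" "Dom C h = A" "Cod C h = B" using h by (simp_all add: hom_iff)
    then have "f B (fn (far D h) x) = fn (far El h) (f A x)" using nat x unfolding set_natural_def by blast
    then show ?thesis using far[OF h x] hom_functor_fn[OF h val[OF hom_Ob(1)[OF h] x]] by simp
  qed
qed

text \<open>
  A tuple of elements of \<open>A\<close> is encoded by its \<open>hat\<close>, the induced arrow \<open>P \<rightarrow> A\<close> out of the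
  copower of \<open>G\<close> over \<open>I\<close>. All members of \<open>D\<close> are images of a single one: the kernels of their
  hats form a small set, and a product of representatives, one for each kernel, carries a member
  \<open>x\<close> of \<open>D\<close> that projects to all of them. Its restriction \<open>x'\<close> to the image \<open>M\<close> of \<open>hat x\<close> is
  again in \<open>D\<close>, because the inclusion of \<open>M\<close> is an equaliser, which \<open>D\<close> preserves. As
  \<open>hat x' : P \<rightarrow> M\<close> is extremal, the value of \<open>f\<close> at \<open>x'\<close> lifts to an element \<open>\<gamma>\<close> of \<open>P\<close>, and \<open>\<gamma>\<close>
  is the total operation sought.
\<close>

lemma SES_extends:
  fixes I :: "'i set" and D :: "('o, 'u, ('i \<Rightarrow> 'u) set, ('i \<Rightarrow> 'u) setarr) func"
  assumes SES: "SES C" and I: "finite I" and f: "implicit_partial_operation C El I D f" and cD: "continuous_domain C D"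
  shows "extends_to_total C El I D f"
proof -
  note op = operationD[OF f]
  obtain P \<iota> where P: "is_coprod I (\<lambda>_. G) P \<iota>"
    using coprod_exists[OF small_finite[OF universe I], of "\<lambda>_. G"] G_Ob by blast
  note \<iota> = coprod_hom[OF P]
  have PO: "P \<in> Ob C" using P by (simp add: is_coprod_def)
  define hat where "hat A t = (SOME p. p \<in> hom C P A \<and> (\<forall>i\<in>I. p \<cdot> \<iota> i = t i))" for A t
  have hat: "hat A t \<in> hom C P A" "\<And>i. i \<in> I \<Longrightarrow> hat A t \<cdot> \<iota> i = t i"
    if t: "t \<in> I \<rightarrow>\<^sub>E hom C G A" and A: "A \<in> Ob C" for A t
  proof -
    have "\<exists>p. p \<in> hom C P A \<and> (\<forall>i\<in>I. p \<cdot> \<iota> i = t i)"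
      using coprod_ex1[OF P A, of t, OF PiE_mem[OF t]] by blast
    then have "hat A t \<in> hom C P A \<and> (\<forall>i\<in>I. hat A t \<cdot> \<iota> i = t i)"
      unfolding hat_def by (rule someI_ex)
    then show "hat A t \<in> hom C P A" "\<And>i. i \<in> I \<Longrightarrow> hat A t \<cdot> \<iota> i = t i" by simp_all
  qed
  have hat_act: "hat B (act I h t) = h \<cdot> hat A t" if h: "h \<in> hom C A B" and t: "t \<in> I \<rightarrow>\<^sub>E hom C G A" for h A B t
  proof -
    note ht = hat[OF t hom_Ob(1)[OF h]] and hh = hat[OF act_mem[OF h t] hom_Ob(2)[OF h]]
    show ?thesis
    proof (rule coprod_eqI[OF P hh(1) comp_hom[OF ht(1) h]])
      fix i assume i: "i \<in> I"
      show "hat B (act I h t) \<cdot> \<iota> i = (h \<cdot> hat A t) \<cdot> \<iota> i"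
        using hh(2)[OF i] assoc[OF \<iota>[OF i] ht(1) h] ht(2)[OF i] i by (simp add: act_def)
    qed
  qed
  let ?K = "{kernel (hat A y) P | A y. A \<in> Ob C \<and> y \<in> fob D A}"
  have "?K \<subseteq> Pow (hom C G P \<times> hom C G P)" using kernel_subset by blast
  then have "small TYPE('u) ?K"
    by (rule small_subset[OF _ small_Pow[OF universe small_Times[OF universe small_hom[OF G_Ob PO] small_hom[OF G_Ob PO]]]])
  then obtain c :: "('u \<times> 'u) set \<Rightarrow> 'u" where c: "inj_on c ?K" "small TYPE('u) (c ` ?K)" by (rule small_code)
  have "\<forall>r\<in>c ` ?K. \<exists>z. fst z \<in> Ob C \<and> snd z \<in> fob D (fst z) \<and> r = c (kernel (hat (fst z) (snd z)) P)"
    by force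
  then obtain z where z: "\<forall>r\<in>c ` ?K. fst (z r) \<in> Ob C \<and> snd (z r) \<in> fob D (fst (z r)) \<and>
      r = c (kernel (hat (fst (z r)) (snd (z r))) P)"
    by (rule bchoice[THEN exE])
  define A where "A r = fst (z r)" for r
  define y where "y r = snd (z r)" for r
  have Ay: "A r \<in> Ob C" "y r \<in> fob D (A r)" "r = c (kernel (hat (A r) (y r)) P)" if "r \<in> c ` ?K" for r
    using bspec[OF z that] unfolding A_def y_def by blast+
  obtain N \<pi> x where \<pi>: "\<And>r. r \<in> c ` ?K \<Longrightarrow> \<pi> r \<in> hom C N (A r)" and N: "N \<in> Ob C" and x: "x \<in> fob D N"
    and \<pi>x: "\<And>r. r \<in> c ` ?K \<Longrightarrow> fn (far D (\<pi> r)) x = y r"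
    by (rule continuous_product_point[OF op(1) cD c(2) Ay(1,2)]) blast+
  have xt: "x \<in> I \<rightarrow>\<^sub>E hom C G N" using op(2)[OF N] x by blast
  obtain M q m where q: "q \<in> hom C P M" "extremal_epi C q" and m: "m \<in> hom C M N" "monic C m" and mq: "m \<cdot> q = hat N x"
    using image_factorisation[OF hat(1)[OF xt N]] by blast
  have MO: "M \<in> Ob C" by (rule hom_Ob(2)[OF q(1)])
  define x' where "x' = act I q (\<lambda>i\<in>I. \<iota> i)"
  have x't: "x' \<in> I \<rightarrow>\<^sub>E hom C G M" unfolding x'_def by (rule act_mem[OF q(1)]) (use \<iota> in auto)
  have x'i: "x' i = q \<cdot> \<iota> i" if "i \<in> I" for i using that by (simp add: x'_def act_def)
  have mx': "m \<cdot> x' i = x i" if i: "i \<in> I" for i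
    using assoc[OF \<iota>[OF i] q(1) m(1)] mq hat(2)[OF xt N i] x'i[OF i] by simp
  \<comment> \<open>The equaliser that SES provides brings \<open>x\<close> down to a member of \<open>D\<close> on \<open>M\<close>, which has to be \<open>x'\<close>.\<close>
  obtain u v where uv: "is_equaliser C m u v" using SES m(2) unfolding SES_def regular_mono_def by blast
  have u: "u \<in> hom C N (Cod C u)" and v: "v \<in> hom C N (Cod C u)" and um: "u \<cdot> m = v \<cdot> m"
    using uv m(1) unfolding is_equaliser_def by (simp_all add: hom_iff)
  have "u \<cdot> x i = v \<cdot> x i" if i: "i \<in> I" for i
    using assoc[OF PiE_mem[OF x't i] m(1) u] assoc[OF PiE_mem[OF x't i] m(1) v] um mx'[OF i] by simp
  then have "act I u x = act I v x" unfolding act_def by (rule restrict_ext)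
  then have "fn (far D u) x = fn (far D v) x" using op(3)[OF u x] op(3)[OF v x] by simp
  moreover have "x \<in> fob D (Cod C m)" using x m(1) by (simp add: hom_iff)
  ultimately obtain x'' where x'': "x'' \<in> fob D (Dom C m)" "fn (far D m) x'' = x"
    using continuous_equaliser_point[OF op(1) cD uv] by blast
  then have x''M: "x'' \<in> fob D M" using m(1) by (simp add: hom_iff)
  have x''t: "x'' \<in> I \<rightarrow>\<^sub>E hom C G M" using op(2)[OF MO] x''M by blast
  have ax: "act I m x'' = x" using op(3)[OF m(1) x''M] x''(2) by simp
  have "x'' = x'"
  proof (rule PiE_ext[OF x''t x't])
    fix i assume i: "i \<in> I"
    have "m \<cdot> x'' i = x i" using fun_cong[OF ax, of i] i by (simp add: act_def)
    then show "x'' i = x' i"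
      using monicD[OF m(2,1) PiE_mem[OF x''t i] PiE_mem[OF x't i]] mx'[OF i] by simp
  qed
  then have x'D: "x' \<in> fob D M" using x''M by simp
  obtain \<gamma> where \<gamma>: "\<gamma> \<in> hom C G P" "q \<cdot> \<gamma> = f M x'" by (rule extremal_lift[OF q(2,1) op(5)[OF MO x'D]])
  define g where "g A t = hat A t \<cdot> \<gamma>" for A t
  have "set_natural C (power_functor I El) El g"
    unfolding set_natural_def
  proof (intro conjI ballI)
    show "g A \<in> fob (power_functor I El) A \<rightarrow> fob El A" if A: "A \<in> Ob C" for A
      unfolding power_fob g_def using comp_hom[OF \<gamma>(1) hat(1)[OF _ A]] by (auto simp: hom_functor_def)
    fix h t assume h: "h \<in> Ar C" and "t \<in> fob (power_functor I El) (Dom C h)"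
    then have t: "t \<in> I \<rightarrow>\<^sub>E hom C G (Dom C h)" by (simp add: power_fob)
    note hh = Ar_hom[OF h]
    have ht: "hat (Dom C h) t \<in> hom C P (Dom C h)" by (rule hat(1)[OF t Ar_Ob(1)[OF h]])
    show "g (Cod C h) (fn (far (power_functor I El) h) t) = fn (far El h) (g (Dom C h) t)"
      unfolding g_def power_far[OF hh t] hat_act[OF hh t] hom_functor_fn[OF hh comp_hom[OF \<gamma>(1) ht]]
      by (rule assoc[OF \<gamma>(1) ht hh])
  qed
  moreover have "g B z = f B z" if B: "B \<in> Ob C" and z: "z \<in> fob D B" for B z
  proof -
    have zt: "z \<in> I \<rightarrow>\<^sub>E hom C G B" using op(2)[OF B] z by blast
    note hz = hat(1)[OF zt B]
    \<comment> \<open>The representative of the kernel of \<open>z\<close> is a projection of \<open>x\<close>, so the kernel of \<open>q\<close> is below that of \<open>z\<close>.\<close>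
    let ?r = "c (kernel (hat B z) P)"
    have k: "kernel (hat B z) P \<in> ?K" using B z by blast
    then have r: "?r \<in> c ` ?K" by blast
    have "kernel (hat (A ?r) (y ?r)) P \<in> ?K" using Ay(1,2)[OF r] by blast
    then have ker: "kernel (hat (A ?r) (y ?r)) P = kernel (hat B z) P"
      using inj_onD[OF c(1) Ay(3)[OF r, symmetric]] k by blast
    have "act I (\<pi> ?r) x = y ?r" using op(3)[OF \<pi>[OF r] x] \<pi>x[OF r] by simp
    then have hy: "hat (A ?r) (y ?r) = \<pi> ?r \<cdot> m \<cdot> q" using hat_act[OF \<pi>[OF r] xt] mq by simp
    have "hat B z \<cdot> s = hat B z \<cdot> t" if s: "s \<in> hom C G P" and t: "t \<in> hom C G P" and st: "q \<cdot> s = q \<cdot> t" for s t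
    proof -
      have "(\<pi> ?r \<cdot> m \<cdot> q) \<cdot> w = \<pi> ?r \<cdot> m \<cdot> q \<cdot> w" if w: "w \<in> hom C G P" for w
        using assoc[OF w comp_hom[OF q(1) m(1)] \<pi>[OF r]] assoc[OF w q(1) m(1)] by simp
      then have "hat (A ?r) (y ?r) \<cdot> s = hat (A ?r) (y ?r) \<cdot> t" using hy s t st by metis
      then have "(s, t) \<in> kernel (hat (A ?r) (y ?r)) P" using s t by (simp only: kernel_iff)
      then show ?thesis unfolding ker kernel_iff by blast
    qed
    then obtain d where d: "d \<in> hom C M B" "d \<cdot> q = hat B z" using extremal_descent[OF q(2,1) hz] by blast
    have "act I d x' = z"
    proof (rule PiE_ext[OF act_mem[OF d(1) x't] zt])
      fix i assume i: "i \<in> I"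
      show "act I d x' i = z i"
        using i x'i[OF i] assoc[OF \<iota>[OF i] q(1) d(1)] d(2) hat(2)[OF zt B i] by (simp add: act_def)
    qed
    then have "f B z = d \<cdot> q \<cdot> \<gamma>" using op(6)[OF d(1) x'D] \<gamma>(2) by simp
    then show ?thesis using assoc[OF \<gamma>(1) q(1) d(1)] d(2) by (simp add: g_def)
  qed
  ultimately show ?thesis unfolding extends_to_total_def by blast
qed

text \<open>
  The subfunctor of the power functor that consists of all images of a tuple \<open>b\<close> of elements of
  \<open>B\<close>. When arrows out of \<open>B\<close> are determined by their effect on \<open>b\<close>, it is the functor
  represented by \<open>B\<close>.
\<close>

definition orbit_functor :: "'i set \<Rightarrow> 'o \<Rightarrow> ('i \<Rightarrow> 'u) \<Rightarrow> ('o, 'u, ('i \<Rightarrow> 'u) set, ('i \<Rightarrow> 'u) setarr) func" where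
  "orbit_functor I B b =
     \<lparr>fob = (\<lambda>X. (\<lambda>w. act I w b) ` hom C B X),
      far = (\<lambda>h. SetArr ((\<lambda>w. act I w b) ` hom C B (Dom C h))
                   (\<lambda>t\<in>(\<lambda>w. act I w b) ` hom C B (Dom C h). act I h t)
                   ((\<lambda>w. act I w b) ` hom C B (Cod C h)))\<rparr>"

lemma orbit_fob: "fob (orbit_functor I B b) X = (\<lambda>w. act I w b) ` hom C B X"
  by (simp add: orbit_functor_def)

lemma orbit_fn:
  assumes b: "b \<in> I \<rightarrow>\<^sub>E hom C G B" and h: "h \<in> hom C X Y" and w: "w \<in> hom C B X"
  shows "fn (far (orbit_functor I B b) h) (act I w b) = act I (h \<cdot> w) b"
proof -
  have "Dom C h = X" using h by (simp add: hom_iff)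
  then show ?thesis using w act_comp[OF w h b] by (simp add: orbit_functor_def)
qed

lemma orbit_far_hom:
  assumes b: "b \<in> I \<rightarrow>\<^sub>E hom C G B" and B: "B \<in> Ob C" and h: "h \<in> hom C X Y"
  shows "far (orbit_functor I B b) h \<in> hom (set_cat TYPE('u)) (fob (orbit_functor I B b) X) (fob (orbit_functor I B b) Y)"
proof -
  have d: "Dom C h = X" "Cod C h = Y" using h by (simp_all add: hom_iff)
  have "act I h (act I w b) \<in> (\<lambda>w. act I w b) ` hom C B Y" if w: "w \<in> hom C B X" for w
    using act_comp[OF w h b] comp_hom[OF w h] by (metis image_eqI)
  then show ?thesis
    using small_image[OF small_hom[OF B hom_Ob(1)[OF h]]] small_image[OF small_hom[OF B hom_Ob(2)[OF h]]]
    by (auto simp: set_cat_hom orbit_functor_def d)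
qed

lemma orbit_is_functor:
  fixes I :: "'i set"
  assumes b: "b \<in> I \<rightarrow>\<^sub>E hom C G B" and B: "B \<in> Ob C"
  shows "is_functor C (set_cat TYPE('u)) (orbit_functor I B b)"
  unfolding is_functor_def
proof (intro conjI ballI impI)
  let ?S = "set_cat TYPE('u) :: (('i \<Rightarrow> 'u) set, ('i \<Rightarrow> 'u) setarr) cat" and ?D = "orbit_functor I B b"
  show "category C" by (rule category)
  show "category ?S" by (rule set_cat_category)
  show "fob ?D X \<in> Ob ?S" if "X \<in> Ob C" for X
    using small_image[OF small_hom[OF B that]] by (simp add: set_cat_Ob orbit_fob)
  show "far ?D h \<in> hom ?S (fob ?D (Dom C h)) (fob ?D (Cod C h))" if "h \<in> Ar C" for h
    by (rule orbit_far_hom[OF b B Ar_hom[OF that]])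
  show "far ?D (Id C X) = Id ?S (fob ?D X)" if X: "X \<in> Ob C" for X
  proof (rule setarr_eqI[OF orbit_far_hom[OF b B Id_hom[OF X]]])
    show "Id ?S (fob ?D X) \<in> hom ?S (fob ?D X) (fob ?D X)"
      by (rule cat.Id_hom[OF cat.intro[OF set_cat_category]])
        (simp add: set_cat_Ob orbit_fob small_image[OF small_hom[OF B X]])
    fix t assume "t \<in> fob ?D X"
    then obtain w where w: "w \<in> hom C B X" "t = act I w b" by (auto simp: orbit_fob)
    then show "fn (far ?D (Id C X)) t = fn (Id ?S (fob ?D X)) t"
      using orbit_fn[OF b Id_hom[OF X] w(1)] Id_comp[OF w(1)] by (simp add: set_cat_def orbit_fob)
  qed
  fix h k assume hk: "h \<in> Ar C" "k \<in> Ar C" "Cod C h = Dom C k"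
  have h: "h \<in> hom C (Dom C h) (Dom C k)" and k: "k \<in> hom C (Dom C k) (Cod C k)" using hk by (simp_all add: hom_iff)
  note fh = orbit_far_hom[OF b B h] and fk = orbit_far_hom[OF b B k]
  show "far ?D (k \<cdot> h) = Comp ?S (far ?D k) (far ?D h)"
  proof (rule setarr_eqI[OF orbit_far_hom[OF b B comp_hom[OF h k]]])
    show "Comp ?S (far ?D k) (far ?D h) \<in> hom ?S (fob ?D (Dom C h)) (fob ?D (Cod C k))"
      using fh fk unfolding set_cat_comp set_cat_hom by (auto simp: compose_def)
    fix t assume "t \<in> fob ?D (Dom C h)"
    then obtain w where w: "w \<in> hom C B (Dom C h)" "t = act I w b" by (auto simp: orbit_fob)
    have "src (far ?D h) = fob ?D (Dom C h)" using fh by (simp add: set_cat_hom)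
    then have "fn (Comp ?S (far ?D k) (far ?D h)) t = fn (far ?D k) (fn (far ?D h) t)"
      using w by (simp add: set_cat_comp compose_def orbit_fob)
    then show "fn (far ?D (k \<cdot> h)) t = fn (Comp ?S (far ?D k) (far ?D h)) t"
      using orbit_fn[OF b comp_hom[OF h k] w(1)] orbit_fn[OF b h w(1)] orbit_fn[OF b k comp_hom[OF w(1) h]]
        assoc[OF w(1) h k] w(2) by simp
  qed
qed

text \<open>
  A member of the orbit at \<open>X\<close> is the same as an arrow \<open>B \<rightarrow> X\<close>, so a compatible family of
  members is a cone with vertex \<open>B\<close>.
\<close>

lemma orbit_continuous:
  fixes I :: "'i set"
  assumes b: "b \<in> I \<rightarrow>\<^sub>E hom C G B" and B: "B \<in> Ob C"
    and faithful: "\<And>X. inj_on (\<lambda>w. act I w b) (hom C B X)"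
  shows "continuous_domain C (orbit_functor I B b)"
  unfolding continuous_domain_def preserves_small_limits_def
proof (intro allI impI)
  let ?S = "set_cat TYPE('u) :: (('i \<Rightarrow> 'u) set, ('i \<Rightarrow> 'u) setarr) cat" and ?D = "orbit_functor I B b"
  have inj: "w = w'" if "w \<in> hom C B X" "w' \<in> hom C B X" "act I w b = act I w' b" for X w w'
    using inj_onD[OF faithful that(3,1,2)] .
  fix J :: "('u, 'u) cat" and F X \<pi>
  assume F: "is_functor J C F" and L: "is_limit J C F X \<pi>"
  have JO: "Dom J u \<in> Ob J" "Cod J u \<in> Ob J" if "u \<in> Ar J" for u
    using cat.Ar_Ob[OF cat.intro[OF functorD(1)[OF F]] that] by blast+
  note Ff = functorD(3)[OF F]
  have XO: "X \<in> Ob C" using L unfolding is_limit_def is_cone_def by blast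
  have \<pi>: "\<pi> j \<in> hom C X (fob F j)" if "j \<in> Ob J" for j using L that unfolding is_limit_def is_cone_def by blast
  have \<pi>c: "far F u \<cdot> \<pi> (Dom J u) = \<pi> (Cod J u)" if "u \<in> Ar J" for u
    using L that unfolding is_limit_def is_cone_def by blast
  have cf: "fob (comp_func ?D F) j = fob ?D (fob F j)" "far (comp_func ?D F) u = far ?D (far F u)" for j u
    by (simp_all add: comp_func_def)
  have comp: "fn (Comp ?S (far ?D h) g) s = fn (far ?D h) (fn g s)" if "s \<in> src g" for s h and g :: "('i \<Rightarrow> 'u) setarr"
    using that by (simp add: set_cat_comp compose_def)
  have comp_in: "Comp ?S (far ?D h) g \<in> hom ?S S (fob ?D Z)"
    if "h \<in> hom C Y Z" "g \<in> hom ?S S (fob ?D Y)" for h g Y Z S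
    using orbit_far_hom[OF b B that(1)] that(2) unfolding set_cat_comp set_cat_hom by (auto simp: compose_def)
  show "is_limit J ?S (comp_func ?D F) (fob ?D X) (\<lambda>j. far ?D (\<pi> j))"
    unfolding is_limit_def
  proof (intro conjI allI impI)
    show "is_cone J ?S (comp_func ?D F) (fob ?D X) (\<lambda>j. far ?D (\<pi> j))"
      unfolding is_cone_def cf
    proof (intro conjI ballI)
      show "fob ?D X \<in> Ob ?S" by (rule functorD(2)[OF orbit_is_functor[OF b B] XO])
      show "far ?D (\<pi> j) \<in> hom ?S (fob ?D X) (fob ?D (fob F j))" if "j \<in> Ob J" for j
        by (rule orbit_far_hom[OF b B \<pi>[OF that]])
      fix u assume u: "u \<in> Ar J"
      have "far ?D (far F u \<cdot> \<pi> (Dom J u)) = Comp ?S (far ?D (far F u)) (far ?D (\<pi> (Dom J u)))"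
        using functorD(5)[OF orbit_is_functor[OF b B], of "\<pi> (Dom J u)" "far F u"] \<pi>[OF JO(1)[OF u]] Ff[OF u]
        by (simp add: hom_iff)
      then show "Comp ?S (far ?D (far F u)) (far ?D (\<pi> (Dom J u))) = far ?D (\<pi> (Cod J u))" using \<pi>c[OF u] by simp
    qed
    fix Y \<kappa> assume K: "is_cone J ?S (comp_func ?D F) Y \<kappa>"
    have k: "\<kappa> j \<in> hom ?S Y (fob ?D (fob F j))" if "j \<in> Ob J" for j using K that unfolding is_cone_def cf by blast
    have Y: "small TYPE('u) Y" using K unfolding is_cone_def set_cat_Ob by blast
    have "\<exists>w\<in>hom C B X. \<forall>j\<in>Ob J. fn (\<kappa> j) s = act I (\<pi> j \<cdot> w) b" if s: "s \<in> Y" for s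
    proof -
      have "\<exists>w. j \<in> Ob J \<longrightarrow> w \<in> hom C B (fob F j) \<and> fn (\<kappa> j) s = act I w b" for j
        using k[of j] s unfolding set_cat_hom orbit_fob by blast
      then obtain w where w: "\<And>j. j \<in> Ob J \<Longrightarrow> w j \<in> hom C B (fob F j)" "\<And>j. j \<in> Ob J \<Longrightarrow> fn (\<kappa> j) s = act I (w j) b" by metis
      have "far F u \<cdot> w (Dom J u) = w (Cod J u)" if u: "u \<in> Ar J" for u
      proof (rule inj[OF comp_hom[OF w(1)[OF JO(1)[OF u]] Ff[OF u]] w(1)[OF JO(2)[OF u]]])
        have "Comp ?S (far ?D (far F u)) (\<kappa> (Dom J u)) = \<kappa> (Cod J u)" using K u unfolding is_cone_def cf by blast
        then have "fn (Comp ?S (far ?D (far F u)) (\<kappa> (Dom J u))) s = fn (\<kappa> (Cod J u)) s" by simp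
        moreover have "s \<in> src (\<kappa> (Dom J u))" using k[OF JO(1)[OF u]] s by (simp add: set_cat_hom)
        ultimately have "fn (far ?D (far F u)) (fn (\<kappa> (Dom J u)) s) = fn (\<kappa> (Cod J u)) s" using comp by metis
        then show "act I (far F u \<cdot> w (Dom J u)) b = act I (w (Cod J u)) b"
          using w(2)[OF JO(1)[OF u]] w(2)[OF JO(2)[OF u]] orbit_fn[OF b Ff[OF u] w(1)[OF JO(1)[OF u]]] by simp
      qed
      then have "is_cone J C F B w" unfolding is_cone_def using B w(1) by blast
      then obtain h where "h \<in> hom C B X" "\<forall>j\<in>Ob J. \<pi> j \<cdot> h = w j" using L unfolding is_limit_def by blast
      then show ?thesis using w(2) by metis
    qed
    then obtain w where w: "\<And>s. s \<in> Y \<Longrightarrow> w s \<in> hom C B X"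
      "\<And>s j. s \<in> Y \<Longrightarrow> j \<in> Ob J \<Longrightarrow> fn (\<kappa> j) s = act I (\<pi> j \<cdot> w s) b" by metis
    let ?h = "SetArr Y (\<lambda>s\<in>Y. act I (w s) b) (fob ?D X)"
    have hh: "?h \<in> hom ?S Y (fob ?D X)"
      using Y w(1) small_image[OF small_hom[OF B XO]] by (auto simp: set_cat_hom orbit_fob)
    show "\<exists>!h. h \<in> hom ?S Y (fob ?D X) \<and> (\<forall>j\<in>Ob J. Comp ?S (far ?D (\<pi> j)) h = \<kappa> j)"
    proof (rule ex1I[of _ ?h])
      have "Comp ?S (far ?D (\<pi> j)) ?h = \<kappa> j" if j: "j \<in> Ob J" for j
      proof (rule setarr_eqI[OF comp_in[OF \<pi>[OF j] hh] k[OF j]])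
        fix s assume s: "s \<in> Y"
        show "fn (Comp ?S (far ?D (\<pi> j)) ?h) s = fn (\<kappa> j) s"
          using comp[of s ?h] s orbit_fn[OF b \<pi>[OF j] w(1)[OF s]] w(2)[OF s j] by simp
      qed
      then show "?h \<in> hom ?S Y (fob ?D X) \<and> (\<forall>j\<in>Ob J. Comp ?S (far ?D (\<pi> j)) ?h = \<kappa> j)" using hh by blast
      fix g assume "g \<in> hom ?S Y (fob ?D X) \<and> (\<forall>j\<in>Ob J. Comp ?S (far ?D (\<pi> j)) g = \<kappa> j)"
      then have g: "g \<in> hom ?S Y (fob ?D X)" "\<And>j. j \<in> Ob J \<Longrightarrow> Comp ?S (far ?D (\<pi> j)) g = \<kappa> j" by blast+
      show "g = ?h"
      proof (rule setarr_eqI[OF g(1) hh])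
        fix s assume s: "s \<in> Y"
        obtain v where v: "v \<in> hom C B X" "fn g s = act I v b" using g(1) s unfolding set_cat_hom orbit_fob by blast
        have vj: "\<pi> j \<cdot> v = \<pi> j \<cdot> w s" if j: "j \<in> Ob J" for j
        proof (rule inj[OF comp_hom[OF v(1) \<pi>[OF j]] comp_hom[OF w(1)[OF s] \<pi>[OF j]]])
          have "s \<in> src g" using g(1) s by (simp add: set_cat_hom)
          then have "fn (far ?D (\<pi> j)) (fn g s) = fn (\<kappa> j) s" using comp[of s g "\<pi> j"] g(2)[OF j] by simp
          then show "act I (\<pi> j \<cdot> v) b = act I (\<pi> j \<cdot> w s) b"
            using v(2) orbit_fn[OF b \<pi>[OF j] v(1)] w(2)[OF s j] by simp
        qed
        have "is_cone J C F B (\<lambda>j. \<pi> j \<cdot> v)"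
          unfolding is_cone_def
        proof (intro conjI ballI)
          show "B \<in> Ob C" by (rule B)
          show "\<pi> j \<cdot> v \<in> hom C B (fob F j)" if "j \<in> Ob J" for j by (rule comp_hom[OF v(1) \<pi>[OF that]])
          show "far F u \<cdot> \<pi> (Dom J u) \<cdot> v = \<pi> (Cod J u) \<cdot> v" if u: "u \<in> Ar J" for u
            using assoc[OF v(1) \<pi>[OF JO(1)[OF u]] Ff[OF u]] \<pi>c[OF u] by simp
        qed
        then have "\<exists>!h. h \<in> hom C B X \<and> (\<forall>j\<in>Ob J. \<pi> j \<cdot> h = \<pi> j \<cdot> v)" using L unfolding is_limit_def by blast
        then have "v = w s" using v(1) w(1)[OF s] vj by metis
        then show "fn g s = fn ?h s" using v(2) s by simp
      qed
    qed
  qed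
qed

text \<open>
  By the Yoneda lemma every element \<open>\<beta>\<close> of \<open>B\<close> is an operation defined on the orbit of \<open>b\<close>.
\<close>

lemma orbit_operation:
  assumes b: "b \<in> I \<rightarrow>\<^sub>E hom C G B" and B: "B \<in> Ob C"
    and faithful: "\<And>X. inj_on (\<lambda>w. act I w b) (hom C B X)"
    and \<beta>: "\<beta> \<in> hom C G B"
  obtains f where "implicit_partial_operation C El I (orbit_functor I B b) f"
    "\<And>X w. w \<in> hom C B X \<Longrightarrow> f X (act I w b) = w \<cdot> \<beta>"
proof -
  let ?D = "orbit_functor I B b"
  have inj: "w = w'" if "w \<in> hom C B X" "w' \<in> hom C B X" "act I w b = act I w' b" for X w w'
    using inj_onD[OF faithful that(3,1,2)] .
  define f where "f X t = (THE w. w \<in> hom C B X \<and> t = act I w b) \<cdot> \<beta>" for X t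
  have f: "f X (act I w b) = w \<cdot> \<beta>" if w: "w \<in> hom C B X" for X w
  proof -
    have "(THE w'. w' \<in> hom C B X \<and> act I w b = act I w' b) = w"
      by (rule the_equality) (use w inj in auto)
    then show ?thesis by (simp add: f_def)
  qed
  have "subfunctor C ?D (power_functor I El)"
    unfolding subfunctor_def
  proof (intro conjI ballI)
    show "is_functor C (set_cat TYPE('u)) ?D" by (rule orbit_is_functor[OF b B])
    show "fob ?D X \<subseteq> fob (power_functor I El) X" for X unfolding orbit_fob power_fob using act_mem[OF _ b] by blast
    fix h t assume h: "h \<in> Ar C" and t: "t \<in> fob ?D (Dom C h)"
    then obtain w where w: "w \<in> hom C B (Dom C h)" "t = act I w b" unfolding orbit_fob by blast
    note hh = Ar_hom[OF h]
    show "fn (far ?D h) t = fn (far (power_functor I El) h) t"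
      using orbit_fn[OF b hh w(1)] power_far[OF hh act_mem[OF w(1) b]] act_comp[OF w(1) hh b] w(2) by simp
  qed
  moreover have "set_natural C ?D El f"
    unfolding set_natural_def
  proof (intro conjI ballI)
    show "f X \<in> fob ?D X \<rightarrow> fob El X" for X
      using f comp_hom[OF \<beta>] by (auto simp: orbit_fob hom_functor_def)
    fix h t assume h: "h \<in> Ar C" and t: "t \<in> fob ?D (Dom C h)"
    then obtain w where w: "w \<in> hom C B (Dom C h)" "t = act I w b" unfolding orbit_fob by blast
    note hh = Ar_hom[OF h]
    show "f (Cod C h) (fn (far ?D h) t) = fn (far El h) (f (Dom C h) t)"
      using orbit_fn[OF b hh w(1)] f[OF comp_hom[OF w(1) hh]] f[OF w(1)] hom_functor_fn[OF hh comp_hom[OF \<beta> w(1)]]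
        assoc[OF \<beta> w(1) hh] w(2) by simp
  qed
  ultimately show ?thesis using that f unfolding implicit_partial_operation_def by blast
qed

end

context lfp_cat
begin

text \<open>
  Let \<open>q : P \<rightarrow> A\<close> be an extremal quotient of a finite copower of \<open>G\<close>, with generators \<open>j\<close>, and
  let \<open>e : A \<rightarrow> B\<close> be epic. The image \<open>b\<close> of \<open>j\<close> in \<open>B\<close> determines arrows out of \<open>B\<close>, so every
  element \<open>\<beta>\<close> of \<open>B\<close> is a continuous implicit operation with value \<open>\<beta>\<close> at \<open>b\<close>. Evaluating a
  total extension at \<open>j\<close> gives an element of \<open>P\<close> over \<open>\<beta>\<close>. Hence \<open>e\<close> is surjective on elements.
\<close>

lemma extension_imp_WES:
  assumes ext: "\<And>(n :: nat) (D :: ('o, 'u, (nat \<Rightarrow> 'u) set, (nat \<Rightarrow> 'u) setarr) func) f.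
      implicit_partial_operation C El {..<n} D f \<Longrightarrow> continuous_domain C D \<Longrightarrow> extends_to_total C El {..<n} D f"
  shows "WES C"
  unfolding WES_def
proof (intro allI impI)
  fix e assume e: "epic C e" and fg: "finitely_generated C (Dom C e)"
  then have eh: "e \<in> hom C (Dom C e) (Cod C e)" by (simp add: epic_def hom_iff)
  let ?B = "Cod C e"
  have BO: "?B \<in> Ob C" by (rule hom_Ob(2)[OF eh])
  obtain S P \<iota> q where S: "finite S" "S \<subseteq> hom C G (Dom C e)" and P: "is_coprod S (\<lambda>_. G) P \<iota>"
    and q: "q \<in> hom C P (Dom C e)" "extremal_epi C q" by (rule fg_finite_cover[OF fg])
  have PO: "P \<in> Ob C" by (rule hom_Ob(1)[OF q(1)])
  obtain s where s: "bij_betw s {..<card S} S" using ex_bij_betw_nat_finite[OF S(1)] by (auto simp: atLeast0LessThan)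
  let ?I = "{..<card S}"
  define j where "j = (\<lambda>i\<in>?I. \<iota> (s i))"
  have j: "j \<in> ?I \<rightarrow>\<^sub>E hom C G P"
    unfolding j_def using coprod_hom[OF P] bij_betwE[OF s] by auto
  have eq: "e \<cdot> q \<in> hom C P ?B" by (rule comp_hom[OF q(1) eh])
  define b where "b = act ?I (e \<cdot> q) j"
  have b: "b \<in> ?I \<rightarrow>\<^sub>E hom C G ?B" unfolding b_def by (rule act_mem[OF eq j])
  have faithful: "inj_on (\<lambda>w. act ?I w b) (hom C ?B X)" for X
  proof (rule inj_onI)
    fix w w' assume w: "w \<in> hom C ?B X" and w': "w' \<in> hom C ?B X" and ww: "act ?I w b = act ?I w' b"
    have aw: "act ?I (w \<cdot> e \<cdot> q) j = act ?I (w' \<cdot> e \<cdot> q) j"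
      using act_comp[OF eq w j] act_comp[OF eq w' j] ww by (simp add: b_def)
    have a: "(w \<cdot> e \<cdot> q) \<cdot> \<iota> (s i) = (w' \<cdot> e \<cdot> q) \<cdot> \<iota> (s i)" if "i \<in> ?I" for i
      using fun_cong[OF aw, of i] that by (simp add: act_def j_def)
    have "w \<cdot> e \<cdot> q = w' \<cdot> e \<cdot> q"
    proof (rule coprod_eqI[OF P comp_hom[OF eq w] comp_hom[OF eq w']])
      fix x assume "x \<in> S"
      then obtain i where "i \<in> ?I" "x = s i" using bij_betw_imp_surj_on[OF s] by blast
      then show "(w \<cdot> e \<cdot> q) \<cdot> \<iota> x = (w' \<cdot> e \<cdot> q) \<cdot> \<iota> x" using a by blast
    qed
    then have "(w \<cdot> e) \<cdot> q = (w' \<cdot> e) \<cdot> q" using assoc[OF q(1) eh w] assoc[OF q(1) eh w'] by simp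
    then have "w \<cdot> e = w' \<cdot> e" by (rule epicD[OF extremal_epic[OF q(2)] q(1) comp_hom[OF eh w] comp_hom[OF eh w']])
    then show "w = w'" by (rule epicD[OF e eh w w'])
  qed
  show "extremal_epi C e"
  proof (rule extremal_elementwise[OF eh])
    fix \<beta> assume \<beta>: "\<beta> \<in> hom C G ?B"
    obtain f where f: "implicit_partial_operation C El ?I (orbit_functor ?I ?B b) f"
      "\<And>X w. w \<in> hom C ?B X \<Longrightarrow> f X (act ?I w b) = w \<cdot> \<beta>"
      using orbit_operation[OF b BO faithful \<beta>] by blast
    obtain g where g: "set_natural C (power_functor ?I El) El g"
      "\<forall>A\<in>Ob C. \<forall>x\<in>fob (orbit_functor ?I ?B b) A. g A x = f A x"
      using ext[OF f(1) orbit_continuous[OF b BO faithful]] unfolding extends_to_total_def by blast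
    have bD: "act ?I (Id C ?B) b \<in> fob (orbit_functor ?I ?B b) ?B"
      unfolding orbit_fob using Id_hom[OF BO] by blast
    have "g ?B b = f ?B (act ?I (Id C ?B) b)" using g(2) BO bD act_Id[OF b] by metis
    then have gb: "g ?B b = \<beta>" using f(2)[OF Id_hom[OF BO]] Id_comp[OF \<beta>] by simp
    have jP: "j \<in> fob (power_functor ?I El) P" using j by (simp add: power_fob)
    have gj: "g P j \<in> hom C G P" using g(1) PO jP unfolding set_natural_def by (auto simp: hom_functor_def)
    have d: "Dom C (e \<cdot> q) = P" "Cod C (e \<cdot> q) = ?B" "e \<cdot> q \<in> Ar C" using eq by (simp_all add: hom_iff)
    have "g (Cod C (e \<cdot> q)) (fn (far (power_functor ?I El) (e \<cdot> q)) j) = fn (far El (e \<cdot> q)) (g (Dom C (e \<cdot> q)) j)"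
      using g(1) d(3) jP d(1) unfolding set_natural_def by metis
    then have "g ?B b = (e \<cdot> q) \<cdot> g P j"
      unfolding d using power_far[OF eq j] hom_functor_fn[OF eq gj] by (simp add: b_def)
    then have "e \<cdot> q \<cdot> g P j = \<beta>" using gb assoc[OF gj q(1) eh] by simp
    then show "\<exists>x\<in>hom C G (Dom C e). e \<cdot> x = \<beta>" using comp_hom[OF gj q(1)] by blast
  qed
qed

end

section \<open>The equivalence\<close>

theorem theorem7p1:
  fixes C :: "('o, 'u) cat" and G :: 'o
    and V :: "('o, 'u, 'u set, 'u setarr) func"
  assumes "universe TYPE('u)"
    and "category C" and "locally_small C"
    and "locally_finitely_presentable C"
    and "amalgamation_property C"
    and "extremal_projective_generator C G"
    and "V = hom_functor C G"
  shows "(ES C \<longleftrightarrow> WES C) \<and> (ES C \<longleftrightarrow> SES C) \<and>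
    (ES C \<longleftrightarrow>
      (\<forall>(n :: nat) (D :: ('o, 'u, (nat \<Rightarrow> 'u) set, (nat \<Rightarrow> 'u) setarr) func) f.
         implicit_partial_operation C V {..<n} D f \<longrightarrow> continuous_domain C D \<longrightarrow>
         extends_to_total C V {..<n} D f))"
proof -
  have "cocomplete C" using assms(4) by (simp add: locally_finitely_presentable_def)
  then interpret lfp_cat C G by unfold_locales (use assms in simp_all)
  have "ES C \<longleftrightarrow> WES C" using ES_imp_WES WES_imp_ES[OF assms(5)] by blast
  moreover have "ES C \<longleftrightarrow> SES C" using ES_imp_SES[OF assms(5)] SES_imp_ES by blast
  moreover have "extends_to_total C V {..<n} D f"
    if "SES C" "implicit_partial_operation C V {..<n} D f" "continuous_domain C D"
    for n :: nat and D :: "('o, 'u, (nat \<Rightarrow> 'u) set, (nat \<Rightarrow> 'u) setarr) func" and f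
    using SES_extends[OF that(1) finite_lessThan] that(2,3) assms(7) by blast
  moreover have "WES C" if "\<forall>(n :: nat) (D :: ('o, 'u, (nat \<Rightarrow> 'u) set, (nat \<Rightarrow> 'u) setarr) func) f.
      implicit_partial_operation C V {..<n} D f \<longrightarrow> continuous_domain C D \<longrightarrow> extends_to_total C V {..<n} D f"
    by (rule extension_imp_WES) (use that assms(7) in blast)
  ultimately show ?thesis by blast
qed

end
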